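(* Let $n\ge3$ be a constant. On instances of fair division with $n$ agents with additive valuations, $m$ goods $M$ with $m$ divisible by $n$, and conflict graph $G=(M,E)$ with $|E|\ge1$, the algorithm \textsc{GraphEF1} (described in the context) runs (in a suitable implementation) in $O(m+|E|)$ time, where the implied constant depends only on $n$.
   Context: Setting. $N=\{1,\dots,n\}$ is the set of agents, $M=\{1,\dots,m\}$ the set of goods; each agent $i$ has an additive valuation $v_i:2^M\to\mathbb R_{\ge0}$, $v_i(S)=\sum_{g\in S}v_i(\{g\})$. An allocation is $\mathcal A=(A_1,\dots,A_n)$ with pairwise disjoint bundles $A_i\subseteq M$ (not necessarily covering $M$). It is EF1 if for all $i\ne j$, $A_j=\emptyset$ or $v_i(A_i)\ge v_i(A_j\setminus\{g\})$ for some $g\in A_j$. The conflict graph $G=(M,E)$ is a simple undirected graph on the goods. For $X\subseteq M$, $d_X(g)$ is the number of neighbours of $g$ in $X$. The envy graph $\mathcal G(\mathcal A)$ is the directed graph on $N$ with an edge $(i,j)$ whenever $v_i(A_i)<v_i(A_j)$. Biswas--Barman round. Given a current EF1 allocation $\mathcal A$ and a set $C$ of $n$ unassigned goods: (1) permute the bundles among the agents so that the allocation remains EF1 and its envy graph becomes acyclic (such a permutation always exists and is obtained by envy-cycle elimination); (2) let $\pi$ be a topological order of the envy graph; (3) for $j=1,\dots,n$, agent $\pi(j)$ receives a good of maximum $v_{\pi(j)}$-value among the goods of $C$ not yet taken. Profile vectors. Keep the $n$ bundles as $A'_1,\dots,A'_n$ with fixed indices, independent of which agent currently owns which bundle. The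 profile vector of an unassigned good $g$ is $p_g=(d_{A'_2}(g)-d_{A'_1}(g),\dots,d_{A'_n}(g)-d_{A'_1}(g))\in\mathbb Z^{n-1}$. Subroutine \textsc{DegreeEF1} with parameters $\Delta$, a current allocation $\mathcal A$, and a set $S$ of unassigned goods with $|S|$ divisible by $n$. Let $R=S$. While $R\neq\emptyset$: with $kn=|R|$ and $d=n-1$, set $q=2^{\lfloor\log_2(k^{1/d})\rfloor}$, partition the cube $[-\Delta,\Delta]^{d}$ (which contains all $p_g$, $g\in R$) into $q^{d}$ equal subcubes, and choose $n$ goods of $R$ whose profile vectors lie in a common subcube (which exist by the pigeonhole principle); assign these $n$ goods by a Biswas--Barman round; remove them from $R$; update the profile vectors. Algorithm \textsc{GraphEF1}. Start with $\mathcal A=(\emptyset,\dots,\emptyset)$ and $R=M$. For $i=0,1,\dots,\lceil\log_2 m\rceil$: let $L_i$ be the set of the $2^{\max(i-1,0)}\,n\,\lceil\sqrt{|E|}\rceil$ highest-degree vertices of $G$ among $R$ (all of $R$ if fewer remain); let $\Delta=\sqrt{|E|}/(2^{i-2}n)$ if $i\ge1$ and $\Delta=\lceil\sqrt{|E|}\rceil$ if $i=0$; run \textsc{DegreeEF1} with parameter $\Delta$ starting from $\mathcal A$ to allocate the goods of $L_i$; replace $R$ by $R\setminus L_i$. Return $\mathcal A$. Cost model. Running time counts elementary operations; arithmetic and comparison of valuations have unit cost, and hash-table insertion, deletion and lookup are taken to cost $O(1)$. *)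

theory Defs
  imports Complex_Main
begin

section \<open>Fair division with a conflict graph\<close>

text \<open>Agents are \<open>{1..n}\<close>, goods are \<open>{1..m}\<close>. Functions indexed by agents, goods or bundles are
  only meaningful on these ranges.\<close>

type_synonym valuation = "nat \<Rightarrow> nat set \<Rightarrow> real"
type_synonym allocation = "nat \<Rightarrow> nat set"

definition additive_valuations :: "nat \<Rightarrow> nat \<Rightarrow> valuation \<Rightarrow> bool" where
  "additive_valuations n m v \<longleftrightarrow>
     (\<forall>i\<in>{1..n}. \<forall>S\<subseteq>{1..m}. 0 \<le> v i S \<and> v i S = (\<Sum>g\<in>S. v i {g}))"

definition simple_graph :: "nat \<Rightarrow> nat set set \<Rightarrow> bool" where
  "simple_graph m E \<longleftrightarrow> E \<subseteq> {{a, b} | a b. a \<in> {1..m} \<and> b \<in> {1..m} \<and> a \<noteq> b}"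

definition deg_in :: "nat set set \<Rightarrow> nat set \<Rightarrow> nat \<Rightarrow> nat" where
  "deg_in E X g = card {h \<in> X. {g, h} \<in> E}"

definition EF1 :: "nat \<Rightarrow> valuation \<Rightarrow> allocation \<Rightarrow> bool" where
  "EF1 n v A \<longleftrightarrow> (\<forall>i\<in>{1..n}. \<forall>j\<in>{1..n}. i \<noteq> j \<longrightarrow>
     A j = {} \<or> (\<exists>g\<in>A j. v i (A i) \<ge> v i (A j - {g})))"

definition envy :: "nat \<Rightarrow> valuation \<Rightarrow> allocation \<Rightarrow> (nat \<times> nat) set" where
  "envy n v A = {(i, j). i \<in> {1..n} \<and> j \<in> {1..n} \<and> v i (A i) < v i (A j)}"


section \<open>The algorithm as a nondeterministic transition system\<close>

text \<open>Bundles keep their indices. In a state \<open>(\<sigma>, B)\<close>, \<open>B b\<close> is the bundle with index \<open>b\<close> and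
  \<open>\<sigma> i\<close> is the index of the bundle owned by agent \<open>i\<close>; the current allocation is thus \<open>B \<circ> \<sigma>\<close>.\<close>

type_synonym state = "(nat \<Rightarrow> nat) \<times> allocation"

text \<open>One envy-cycle elimination: along a cycle \<open>cs\<close> of the envy graph every agent takes over the
  bundle of the successor.\<close>

definition eliminate_cycle ::
    "nat \<Rightarrow> valuation \<Rightarrow> allocation \<Rightarrow> (nat \<Rightarrow> nat) \<Rightarrow> (nat \<Rightarrow> nat) \<Rightarrow> bool" where
  "eliminate_cycle n v B \<sigma> \<sigma>' \<longleftrightarrow> (\<exists>cs. cs \<noteq> [] \<and> distinct cs \<and>
     (\<forall>l<length cs. (cs ! l, cs ! (Suc l mod length cs)) \<in> envy n v (B \<circ> \<sigma>)) \<and>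
     (\<forall>l<length cs. \<sigma>' (cs ! l) = \<sigma> (cs ! (Suc l mod length cs))) \<and>
     (\<forall>i. i \<notin> set cs \<longrightarrow> \<sigma>' i = \<sigma> i))"

definition topological_order :: "nat \<Rightarrow> (nat \<times> nat) set \<Rightarrow> (nat \<Rightarrow> nat) \<Rightarrow> bool" where
  "topological_order n r \<pi> \<longleftrightarrow> bij_betw \<pi> {1..n} {1..n} \<and>
     (\<forall>j\<in>{1..n}. \<forall>l\<in>{1..n}. (\<pi> j, \<pi> l) \<in> r \<longrightarrow> j < l)"

text \<open>A round is recorded by the ownership \<open>\<sigma>'\<close> after the permutation step, the topological order
  \<open>\<pi>\<close>, and the picks \<open>c\<close>: agent \<open>\<pi> j\<close> receives the good \<open>c j\<close>.\<close>

type_synonym round = "(nat \<Rightarrow> nat) \<times> (nat \<Rightarrow> nat) \<times> (nat \<Rightarrow> nat)"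

fun bb_round :: "nat \<Rightarrow> valuation \<Rightarrow> nat set \<Rightarrow> state \<Rightarrow> round \<Rightarrow> state \<Rightarrow> bool" where
  "bb_round n v C (\<sigma>, B) (\<sigma>', \<pi>, c) s' \<longleftrightarrow>
     (eliminate_cycle n v B)\<^sup>*\<^sup>* \<sigma> \<sigma>' \<and>
     EF1 n v (B \<circ> \<sigma>') \<and> acyclic (envy n v (B \<circ> \<sigma>')) \<and>
     topological_order n (envy n v (B \<circ> \<sigma>')) \<pi> \<and>
     bij_betw c {1..n} C \<and>
     (\<forall>j\<in>{1..n}. \<forall>g\<in>C - c ` {1..<j}. v (\<pi> j) {g} \<le> v (\<pi> j) {c j}) \<and>
     s' = (\<sigma>', \<lambda>b. B b \<union> c ` {j \<in> {1..n}. \<sigma>' (\<pi> j) = b})"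

text \<open>The coordinates of a profile vector are indexed by \<open>{2..n}\<close>.\<close>

definition profile :: "nat set set \<Rightarrow> allocation \<Rightarrow> nat \<Rightarrow> nat \<Rightarrow> int" where
  "profile E B g j = int (deg_in E (B j) g) - int (deg_in E (B 1) g)"

text \<open>The \<open>t\<close>-th of the \<open>q\<close> equal pieces (\<open>t < q\<close>) into which \<open>[-\<Delta>, \<Delta>]\<close> is partitioned. They are
  half-open, except that the last one also contains \<open>\<Delta>\<close>.\<close>

definition piece :: "real \<Rightarrow> nat \<Rightarrow> nat \<Rightarrow> real set" where
  "piece \<Delta> q t = {x. - \<Delta> + 2 * \<Delta> * real t / real q \<le> x \<and>
     (if Suc t = q then x \<le> \<Delta> else x < - \<Delta> + 2 * \<Delta> * real (Suc t) / real q)}"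

definition subcubes :: "nat \<Rightarrow> real \<Rightarrow> nat \<Rightarrow> (nat \<Rightarrow> real) set set" where
  "subcubes n \<Delta> q =
     {{x. \<forall>j\<in>{2..n}. x j \<in> piece \<Delta> q (t j)} | t. \<forall>j\<in>{2..n}. t j < q}"

inductive degree_ef1 ::
    "nat \<Rightarrow> valuation \<Rightarrow> nat set set \<Rightarrow> real \<Rightarrow> nat set \<Rightarrow> state \<Rightarrow> round list \<Rightarrow> state \<Rightarrow> bool"
  for n v E \<Delta> where
  finish: "degree_ef1 n v E \<Delta> {} s [] s"
| step: "\<lbrakk> R \<noteq> {}; k * n = card R;
     q = 2 ^ nat \<lfloor>log 2 (real k powr (1 / real (n - 1)))\<rfloor>;
     C \<subseteq> R; card C = n;
     Q \<in> subcubes n \<Delta> q; \<forall>g\<in>C. (\<lambda>j. real_of_int (profile E (snd s) g j)) \<in> Q;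
     bb_round n v C s \<rho> s1;
     degree_ef1 n v E \<Delta> (R - C) s1 tr s2 \<rbrakk>
   \<Longrightarrow> degree_ef1 n v E \<Delta> R s (\<rho> # tr) s2"

text \<open>\<open>L\<close> consists of \<open>N\<close> goods of highest degree among \<open>R\<close>, ties being broken arbitrarily; \<open>deg_in E UNIV\<close>
  is the degree in the whole graph.\<close>

definition highest_degree :: "nat set set \<Rightarrow> nat set \<Rightarrow> nat \<Rightarrow> nat set \<Rightarrow> bool" where
  "highest_degree E R N L \<longleftrightarrow> L \<subseteq> R \<and> card L = min N (card R) \<and>
     (\<forall>g\<in>L. \<forall>h\<in>R - L. deg_in E UNIV h \<le> deg_in E UNIV g)"

definition phase_size :: "nat \<Rightarrow> nat set set \<Rightarrow> nat \<Rightarrow> nat" where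
  "phase_size n E i = 2 ^ nat (max (int i - 1) 0) * n * nat \<lceil>sqrt (card E)\<rceil>"

definition phase_delta :: "nat \<Rightarrow> nat set set \<Rightarrow> nat \<Rightarrow> real" where
  "phase_delta n E i = (if i = 0 then real_of_int \<lceil>sqrt (card E)\<rceil>
     else sqrt (card E) / (2 powi (int i - 2) * real n))"

inductive phases ::
    "nat \<Rightarrow> nat \<Rightarrow> valuation \<Rightarrow> nat set set \<Rightarrow> nat \<Rightarrow> nat set \<Rightarrow> state \<Rightarrow> round list \<Rightarrow> state \<Rightarrow> bool"
  for n m v E where
  stop: "int i > \<lceil>log 2 (real m)\<rceil> \<Longrightarrow> phases n m v E i R s [] s"
| phase: "\<lbrakk> int i \<le> \<lceil>log 2 (real m)\<rceil>;
     highest_degree E R (phase_size n E i) L;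
     degree_ef1 n v E (phase_delta n E i) L s tr1 s1;
     phases n m v E (Suc i) (R - L) s1 tr2 s2 \<rbrakk>
   \<Longrightarrow> phases n m v E i R s (tr1 @ tr2) s2"

text \<open>\<open>graph_ef1 n m v E tr A\<close>: some execution of GraphEF1 performs the sequence of rounds \<open>tr\<close> and
  returns the allocation \<open>A\<close>.\<close>

definition graph_ef1 ::
    "nat \<Rightarrow> nat \<Rightarrow> valuation \<Rightarrow> nat set set \<Rightarrow> round list \<Rightarrow> allocation \<Rightarrow> bool" where
  "graph_ef1 n m v E tr A \<longleftrightarrow>
     (\<exists>\<sigma> B. phases n m v E 0 {1..m} (id, \<lambda>_. {}) tr (\<sigma>, B) \<and> A = B \<circ> \<sigma>)"


section \<open>The cost model\<close>

text \<open>Programs run on a random access machine whose memory consists of finitely many named hash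
  tables with integer tuples as keys (a table used with the empty tuple is a plain variable).
  Entries are either integers or reals (valuations); reals cannot be converted to integers, they can
  only be combined arithmetically and compared. A key that was never inserted reads as \<open>0\<close>, and
  deletion is overwriting by \<open>0\<close>. Every operation, including a table access, has unit cost.
  Programs contain only integer constants.\<close>

datatype iexp =
    IConst int
  | IGet string "iexp list"
  | IAdd iexp iexp | ISub iexp iexp | IMul iexp iexp | IDiv iexp iexp

datatype rexp =
    RConst int
  | RGet string "iexp list"
  | RAdd rexp rexp | RSub rexp rexp | RMul rexp rexp | RDiv rexp rexp

datatype bexp =
    ILess iexp iexp | IEq iexp iexp
  | RLess rexp rexp | REq rexp rexp
  | BNot bexp | BAnd bexp bexp

datatype com =
    Skip
  | ISet string "iexp list" iexp
  | RSet string "iexp list" rexp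
  | Emit iexp
  | Seq com com
  | Cond bexp com com
  | While bexp com

record store =
  itab :: "string \<Rightarrow> int list \<Rightarrow> int"
  rtab :: "string \<Rightarrow> int list \<Rightarrow> real"
  out :: "int list"

primrec ival :: "store \<Rightarrow> iexp \<Rightarrow> int" where
  "ival s (IConst x) = x"
| "ival s (IGet a ks) = itab s a (map (ival s) ks)"
| "ival s (IAdd e f) = ival s e + ival s f"
| "ival s (ISub e f) = ival s e - ival s f"
| "ival s (IMul e f) = ival s e * ival s f"
| "ival s (IDiv e f) = ival s e div ival s f"

primrec rval :: "store \<Rightarrow> rexp \<Rightarrow> real" where
  "rval s (RConst x) = real_of_int x"
| "rval s (RGet a ks) = rtab s a (map (ival s) ks)"
| "rval s (RAdd e f) = rval s e + rval s f"
| "rval s (RSub e f) = rval s e - rval s f"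
| "rval s (RMul e f) = rval s e * rval s f"
| "rval s (RDiv e f) = rval s e / rval s f"

primrec bval :: "store \<Rightarrow> bexp \<Rightarrow> bool" where
  "bval s (ILess e f) \<longleftrightarrow> ival s e < ival s f"
| "bval s (IEq e f) \<longleftrightarrow> ival s e = ival s f"
| "bval s (RLess e f) \<longleftrightarrow> rval s e < rval s f"
| "bval s (REq e f) \<longleftrightarrow> rval s e = rval s f"
| "bval s (BNot b) \<longleftrightarrow> \<not> bval s b"
| "bval s (BAnd b c) \<longleftrightarrow> bval s b \<and> bval s c"

primrec icost :: "iexp \<Rightarrow> nat" where
  "icost (IConst x) = 1"
| "icost (IGet a ks) = 1 + sum_list (map icost ks)"
| "icost (IAdd e f) = 1 + icost e + icost f"
| "icost (ISub e f) = 1 + icost e + icost f"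
| "icost (IMul e f) = 1 + icost e + icost f"
| "icost (IDiv e f) = 1 + icost e + icost f"

primrec rcost :: "rexp \<Rightarrow> nat" where
  "rcost (RConst x) = 1"
| "rcost (RGet a ks) = 1 + sum_list (map icost ks)"
| "rcost (RAdd e f) = 1 + rcost e + rcost f"
| "rcost (RSub e f) = 1 + rcost e + rcost f"
| "rcost (RMul e f) = 1 + rcost e + rcost f"
| "rcost (RDiv e f) = 1 + rcost e + rcost f"

primrec bcost :: "bexp \<Rightarrow> nat" where
  "bcost (ILess e f) = 1 + icost e + icost f"
| "bcost (IEq e f) = 1 + icost e + icost f"
| "bcost (RLess e f) = 1 + rcost e + rcost f"
| "bcost (REq e f) = 1 + rcost e + rcost f"
| "bcost (BNot b) = 1 + bcost b"
| "bcost (BAnd b c) = 1 + bcost b + bcost c"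

definition iupdate :: "string \<Rightarrow> int list \<Rightarrow> int \<Rightarrow> store \<Rightarrow> store" where
  "iupdate a ks x s = s\<lparr>itab := (itab s)(a := (itab s a)(ks := x))\<rparr>"

definition rupdate :: "string \<Rightarrow> int list \<Rightarrow> real \<Rightarrow> store \<Rightarrow> store" where
  "rupdate a ks x s = s\<lparr>rtab := (rtab s)(a := (rtab s a)(ks := x))\<rparr>"

text \<open>\<open>exec W p s T s'\<close>: started in \<open>s\<close>, the program \<open>p\<close> halts in \<open>s'\<close> after \<open>T\<close> elementary operations.
  Integers are machine words: an execution that tries to store an integer of absolute value more
  than \<open>W\<close> fails, which keeps unit-cost integer arithmetic realistic. (Unstored intermediate results
  are then polynomial in \<open>W\<close>, because expressions have constant size.)\<close>

inductive exec :: "nat \<Rightarrow> com \<Rightarrow> store \<Rightarrow> nat \<Rightarrow> store \<Rightarrow> bool" for W where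
  Skip: "exec W Skip s 1 s"
| ISet: "\<bar>ival s e\<bar> \<le> int W \<Longrightarrow>
    exec W (ISet a ks e) s (1 + sum_list (map icost ks) + icost e)
      (iupdate a (map (ival s) ks) (ival s e) s)"
| RSet: "exec W (RSet a ks e) s (1 + sum_list (map icost ks) + rcost e)
      (rupdate a (map (ival s) ks) (rval s e) s)"
| Emit: "exec W (Emit e) s (1 + icost e) (s\<lparr>out := out s @ [ival s e]\<rparr>)"
| Seq: "\<lbrakk> exec W p s T s1; exec W p' s1 T' s2 \<rbrakk> \<Longrightarrow> exec W (Seq p p') s (T + T') s2"
| CondTrue: "\<lbrakk> bval s b; exec W p s T s' \<rbrakk> \<Longrightarrow> exec W (Cond b p p') s (1 + bcost b + T) s'"
| CondFalse: "\<lbrakk> \<not> bval s b; exec W p' s T s' \<rbrakk> \<Longrightarrow> exec W (Cond b p p') s (1 + bcost b + T) s'"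
| WhileFalse: "\<not> bval s b \<Longrightarrow> exec W (While b p) s (1 + bcost b) s"
| WhileTrue: "\<lbrakk> bval s b; exec W p s T s1; exec W (While b p) s1 T' s2 \<rbrakk>
    \<Longrightarrow> exec W (While b p) s (1 + bcost b + T + T') s2"


section \<open>Input, output, and implementations\<close>

text \<open>The graph is given as a list of its edges, each listed once, in arbitrary order and
  orientation.\<close>

definition edge_list :: "(nat \<times> nat) list \<Rightarrow> nat set set \<Rightarrow> bool" where
  "edge_list es E \<longleftrightarrow> (\<lambda>(a, b). {a, b}) ` set es = E \<and> length es = card E"

text \<open>Input: the variables \<open>n\<close>, \<open>m\<close>, \<open>e\<close> (the number of edges), the endpoints \<open>edge[k,0]\<close> and
  \<open>edge[k,1]\<close> of the \<open>k\<close>-th edge (counting from 0), and \<open>v[i,g]\<close>, the value of good \<open>g\<close> for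
  agent \<open>i\<close>.\<close>

definition input :: "nat \<Rightarrow> nat \<Rightarrow> valuation \<Rightarrow> (nat \<times> nat) list \<Rightarrow> store" where
  "input n m v es = \<lparr>
     itab = (\<lambda>a ks.
       if a = ''n'' \<and> ks = [] then int n
       else if a = ''m'' \<and> ks = [] then int m
       else if a = ''e'' \<and> ks = [] then int (length es)
       else if a = ''edge'' \<and> (\<exists>k<length es. ks = [int k, 0]) then int (fst (es ! nat (hd ks)))
       else if a = ''edge'' \<and> (\<exists>k<length es. ks = [int k, 1]) then int (snd (es ! nat (hd ks)))
       else 0),
     rtab = (\<lambda>a ks.
       if a = ''v'' \<and> (\<exists>i\<in>{1..n}. \<exists>g\<in>{1..m}. ks = [int i, int g])
       then v (nat (ks ! 0)) {nat (ks ! 1)} else 0),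
     out = [] \<rparr>"

text \<open>The program logs every round it performs on the output tape, and leaves the returned allocation
  in the table \<open>owner\<close>, \<open>owner[g]\<close> being the agent who gets good \<open>g\<close> (and no agent's number if \<open>g\<close> is
  unallocated).\<close>

fun log_round :: "nat \<Rightarrow> round \<Rightarrow> int list" where
  "log_round n (\<sigma>, \<pi>, c) =
     map (\<lambda>i. int (\<sigma> i)) [1..<Suc n] @ map (\<lambda>j. int (\<pi> j)) [1..<Suc n] @
     map (\<lambda>j. int (c j)) [1..<Suc n]"

definition outputs :: "nat \<Rightarrow> nat \<Rightarrow> store \<Rightarrow> round list \<Rightarrow> allocation \<Rightarrow> bool" where
  "outputs n m s tr A \<longleftrightarrow> out s = concat (map (log_round n) tr) \<and>
     (\<forall>i\<in>{1..n}. A i = {g \<in> {1..m}. itab s ''owner'' [int g] = int i})"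

text \<open>\<open>implements_within n p K t\<close>: on every instance with \<open>n\<close> agents, the program \<open>p\<close>, using words of
  absolute value at most \<open>(m + |E|)^K\<close>, performs some execution of GraphEF1 in at most
  \<open>t m |E|\<close> elementary operations.\<close>

definition implements_within :: "nat \<Rightarrow> com \<Rightarrow> nat \<Rightarrow> (nat \<Rightarrow> nat \<Rightarrow> real) \<Rightarrow> bool" where
  "implements_within n p K t \<longleftrightarrow> (\<forall>m v E es.
     additive_valuations n m v \<and> n dvd m \<and> simple_graph m E \<and> card E \<ge> 1 \<and> edge_list es E \<longrightarrow>
     (\<exists>T s' tr A. exec ((m + card E) ^ K) p (input n m v es) T s' \<and>
        graph_ef1 n m v E tr A \<and> outputs n m s' tr A \<and> real T \<le> t m (card E)))"

end

(* Since n is a constant, loops over agents and bundles can be unrolled, and a round costs O(1) plus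
   the degrees of its goods, spent on updating the degrees d_B(g) of their neighbours. The point is
   to find n goods in a common subcube in amortised constant time. The unassigned goods of a phase
   are put into buckets, one per subcube, and a bucket is inspected only when it holds n goods. Either
   they still lie in the subcube and form a round, or one of them has moved since it was inserted;
   such a failure is paid for by the edge that moved it. If no good is pending, every bucket holds
   fewer than n goods, so by the pigeonhole principle the phase is over. The buckets are rebuilt only
   when q is halved; as then |R| = O(q^(n-1)), these costs form a geometric series dominated by the
   size of the phase. Goods of phase i >= 1 have degree at most Delta_i because the goods preceding
   them in the degree order would otherwise have more than 2|E| edge ends. *)
theory Submission
  imports Defs "HOL-Combinatorics.Permutations"
begin

section \<open>Counting loop iterations\<close>

text \<open>The obstacle is to name the subcube of a profile vector with a bounded number of integer
  operations: \<Delta> may be irrational, and both \<Delta> and the grid change during the run.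
  Since q is always a power of two, every grid coarsens one fixed dyadic grid with at least m
  intervals, so a table from integers to fine intervals suffices, followed by an integer division.
  The phases from 1 on differ only by powers of two in \<Delta>; multiplying the coordinates by such
  a power lets them share one table. A table has O(sqrt |E|) entries and is filled by a single
  monotone sweep. In phase 0 the degrees are unbounded, and the coordinates fit into
  [-\<Delta>, \<Delta>] for another reason: bundles then hold at most ceil(sqrt |E|) goods. Emptying
  all buckets at each change of grid is avoided by making an epoch number part of the bucket key.
  Inside a round the algorithm is nondeterministic, so any valid permutation, topological order and
  tie-breaking may be compiled into the program; which one is valid depends only on the outcomes of
  finitely many comparisons.\<close>

text \<open>The cost of a single pass through the text of a program: a loop body is charged once,
  together with one test, and both branches of a conditional are added. It depends on the program
  only, so it becomes part of the implied constant.\<close>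

primrec straight_cost :: "com \<Rightarrow> nat" where
  "straight_cost Skip = 1"
| "straight_cost (ISet a ks e) = 1 + sum_list (map icost ks) + icost e"
| "straight_cost (RSet a ks e) = 1 + sum_list (map icost ks) + rcost e"
| "straight_cost (Emit e) = 1 + icost e"
| "straight_cost (Seq p p') = straight_cost p + straight_cost p'"
| "straight_cost (Cond b p p') = 1 + bcost b + straight_cost p + straight_cost p'"
| "straight_cost (While b p) = 1 + bcost b + straight_cost p"

text \<open>In \<open>wp W p Q s\<close> the first argument of \<open>Q\<close> bounds the total number of loop iterations of the
  execution. For a fixed program this determines the running time up to a constant factor, so that
  no cost of a straight-line piece of code ever has to be computed.\<close>

definition wp :: "nat \<Rightarrow> com \<Rightarrow> (nat \<Rightarrow> store \<Rightarrow> bool) \<Rightarrow> store \<Rightarrow> bool" where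
  "wp W p Q s \<longleftrightarrow> (\<exists>T s' N. exec W p s T s' \<and> T \<le> straight_cost p * Suc N \<and> Q N s')"

lemma wp_mono: "wp W p Q s \<Longrightarrow> (\<And>N s'. Q N s' \<Longrightarrow> Q' N s') \<Longrightarrow> wp W p Q' s"
  unfolding wp_def by blast

lemma wp_Seq:
  assumes "wp W p (\<lambda>N. wp W p' (\<lambda>N'. Q (N + N'))) s"
  shows "wp W (Seq p p') Q s"
proof -
  obtain T s1 N T' s2 N' where "exec W p s T s1" "T \<le> straight_cost p * Suc N"
    "exec W p' s1 T' s2" "T' \<le> straight_cost p' * Suc N'" "Q (N + N') s2"
    using assms unfolding wp_def by blast
  moreover from this have "T + T' \<le> straight_cost (Seq p p') * Suc (N + N')"
    by (simp add: algebra_simps)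
  ultimately show ?thesis
    unfolding wp_def by (meson exec.Seq)
qed

lemma wp_Cond:
  assumes "bval s b \<Longrightarrow> wp W p Q s" "\<not> bval s b \<Longrightarrow> wp W p' Q s"
  shows "wp W (Cond b p p') Q s"
proof (cases "bval s b")
  case True
  then obtain T s' N where "exec W p s T s'" "T \<le> straight_cost p * Suc N" "Q N s'"
    using assms(1) unfolding wp_def by blast
  moreover from this have "1 + bcost b + T \<le> straight_cost (Cond b p p') * Suc N"
    by (simp add: algebra_simps)
  ultimately show ?thesis
    unfolding wp_def using True exec.CondTrue by blast
next
  case False
  then obtain T s' N where "exec W p' s T s'" "T \<le> straight_cost p' * Suc N" "Q N s'"
    using assms(2) unfolding wp_def by blast
  moreover from this have "1 + bcost b + T \<le> straight_cost (Cond b p p') * Suc N"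
    by (simp add: algebra_simps)
  ultimately show ?thesis
    unfolding wp_def using False exec.CondFalse by blast
qed

text \<open>Amortised analysis: \<phi> is a potential, and every iteration must pay from it for
  itself (the + 1) and for the N iterations of the loops inside its body. The strict decrease also
  yields termination, and what remains of the potential is available to an enclosing loop.\<close>

lemma wp_While:
  assumes "I \<phi> s"
    and "\<And>\<phi> s. I \<phi> s \<Longrightarrow> bval s b \<Longrightarrow> wp W p (\<lambda>N s'. \<exists>\<phi>'. I \<phi>' s' \<and> \<phi>' + N + 1 \<le> \<phi>) s"
  shows "wp W (While b p) (\<lambda>N s'. \<exists>\<phi>'. I \<phi>' s' \<and> \<not> bval s' b \<and> \<phi>' + N \<le> \<phi>) s"
  using assms(1)
proof (induction \<phi> arbitrary: s rule: less_induct)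
  case (less \<phi>)
  show ?case
  proof (cases "bval s b")
    case False
    show ?thesis
      unfolding wp_def
      by (rule exI[of _ "1 + bcost b"], rule exI[of _ s], rule exI[of _ 0])
        (use False less.prems in \<open>auto intro: exec.WhileFalse[simplified]\<close>)
  next
    case True
    from assms(2)[OF less.prems True] obtain T s1 N \<phi>' where
      1: "exec W p s T s1" "T \<le> straight_cost p * Suc N" "I \<phi>' s1" "\<phi>' + N + 1 \<le> \<phi>"
      unfolding wp_def by blast
    then have "\<phi>' < \<phi>" by simp
    from less.IH[OF this 1(3)] obtain T' s2 N' \<phi>'' where
      2: "exec W (While b p) s1 T' s2" "T' \<le> straight_cost (While b p) * Suc N'" "I \<phi>'' s2"
        "\<not> bval s2 b" "\<phi>'' + N' \<le> \<phi>'"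
      unfolding wp_def by blast
    \<comment> \<open>The test and one pass through the body make up one multiple of the
      \<open>straight_cost\<close> of the loop; the inner iterations account for N more.\<close>
    have "1 + bcost b + T + T' \<le> straight_cost (While b p) * Suc (N + N' + 1)"
      using 1(2) 2(2) by (simp add: algebra_simps)
    moreover have "\<phi>'' + (N + N' + 1) \<le> \<phi>" using 1(4) 2(5) by simp
    ultimately show ?thesis
      unfolding wp_def using exec.WhileTrue[OF True 1(1) 2(1)] 2(3,4) by blast
  qed
qed

text \<open>Weakest preconditions for loop-free code, where unfolding the equations executes the
  program symbolically. A loop gets \<open>False\<close>, which confines \<open>vc\<close> to such
  code.\<close>

primrec vc :: "nat \<Rightarrow> com \<Rightarrow> (store \<Rightarrow> bool) \<Rightarrow> store \<Rightarrow> bool" where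
  "vc W Skip Q s = Q s"
| "vc W (ISet a ks e) Q s =
    (\<bar>ival s e\<bar> \<le> int W \<and> Q (iupdate a (map (ival s) ks) (ival s e) s))"
| "vc W (RSet a ks e) Q s = Q (rupdate a (map (ival s) ks) (rval s e) s)"
| "vc W (Emit e) Q s = Q (s\<lparr>out := out s @ [ival s e]\<rparr>)"
| "vc W (Seq p p') Q s = vc W p (vc W p' Q) s"
| "vc W (Cond b p p') Q s = (if bval s b then vc W p Q s else vc W p' Q s)"
| "vc W (While b p) Q s = False"

lemma wp_vc: "vc W p Q s \<Longrightarrow> wp W p (\<lambda>N s'. N = 0 \<and> Q s') s"
proof (induction p arbitrary: Q s)
  case (Seq p1 p2)
  then have "wp W p1 (\<lambda>N s'. N = 0 \<and> vc W p2 Q s') s" by simp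
  then show ?case
    by (intro wp_Seq) (auto elim!: wp_mono dest!: Seq.IH(2))
next
  case (Cond b p1 p2)
  then show ?case by (intro wp_Cond) (auto split: if_splits)
qed (force simp: wp_def intro: exec.intros)+

lemma wp_straight: "vc W p (Q 0) s \<Longrightarrow> wp W p Q s"
  using wp_vc by (rule wp_mono) auto

lemma wp_SeqI:
  assumes "wp W p Q1 s" "\<And>N s'. Q1 N s' \<Longrightarrow> wp W p' (\<lambda>N'. Q (N + N')) s'"
  shows "wp W (Seq p p') Q s"
  by (rule wp_Seq, rule wp_mono[OF assms(1)], rule assms(2))

lemma wp_Set_Seq:
  assumes "\<bar>ival s e\<bar> \<le> int W" "wp W p Q (iupdate a (map (ival s) ks) (ival s e) s)"
  shows "wp W (Seq (ISet a ks e) p) Q s"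
  by (rule wp_Seq, rule wp_straight) (use assms in simp)

text \<open>This is \<open>wp_While\<close> with the potential K - k. The counter k is a ghost: the
  guard need not mention it and only has to agree with k < K under the invariant.\<close>

lemma wp_for:
  assumes "I 0 s"
    and "\<And>k s. k \<le> K \<Longrightarrow> I k s \<Longrightarrow> bval s b \<longleftrightarrow> k < K"
    and "\<And>k s. k < K \<Longrightarrow> I k s \<Longrightarrow> vc W p (I (Suc k)) s"
  shows "wp W (While b p) (\<lambda>N s'. I K s' \<and> N \<le> K) s"
proof -
  let ?I = "\<lambda>\<phi> s. \<phi> \<le> K \<and> I (K - \<phi>) s"
  have "wp W (While b p) (\<lambda>N s'. \<exists>\<phi>'. ?I \<phi>' s' \<and> \<not> bval s' b \<and> \<phi>' + N \<le> K) s"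
  proof (rule wp_While)
    show "?I K s" using assms(1) by simp
    fix \<phi> s assume I: "?I \<phi> s" and b: "bval s b"
    then have "K - \<phi> < K" using assms(2)[of "K - \<phi>" s] by simp
    then have "vc W p (I (Suc (K - \<phi>))) s" using assms(3) I by blast
    moreover have "Suc (K - \<phi>) = K - (\<phi> - 1)" using I \<open>K - \<phi> < K\<close> by linarith
    ultimately have "vc W p (I (K - (\<phi> - 1))) s" by simp
    then show "wp W p (\<lambda>N s'. \<exists>\<phi>'. ?I \<phi>' s' \<and> \<phi>' + N + 1 \<le> \<phi>) s"
      by (rule wp_mono[OF wp_vc]) (use I \<open>K - \<phi> < K\<close> in \<open>auto intro!: exI[of _ "\<phi> - 1"]\<close>)
  qed
  then show ?thesis
  proof (rule wp_mono)
    fix N s' assume "\<exists>\<phi>'. ?I \<phi>' s' \<and> \<not> bval s' b \<and> \<phi>' + N \<le> K"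
    then obtain \<phi>' where *: "\<phi>' \<le> K" "I (K - \<phi>') s'" "\<not> bval s' b" "\<phi>' + N \<le> K" by blast
    then have "\<phi>' = 0" using assms(2)[of "K - \<phi>'" s'] by simp
    then show "I K s' \<and> N \<le> K" using * by simp
  qed
qed

lemma vc_mono: "vc W p Q s \<Longrightarrow> (\<And>s'. Q s' \<Longrightarrow> Q' s') \<Longrightarrow> vc W p Q' s"
proof (induction p arbitrary: Q Q' s)
  case (Seq p1 p2)
  show ?case using Seq.prems(1)
    by (auto elim!: Seq.IH(1) elim: Seq.IH(2) intro: Seq.prems(2))
qed (auto split: if_splits)

primrec iwrites :: "com \<Rightarrow> string set" where
  "iwrites Skip = {}"
| "iwrites (ISet a ks e) = {a}"
| "iwrites (RSet a ks e) = {}"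
| "iwrites (Emit e) = {}"
| "iwrites (Seq p p') = iwrites p \<union> iwrites p'"
| "iwrites (Cond b p p') = iwrites p \<union> iwrites p'"
| "iwrites (While b p) = iwrites p"

primrec rwrites :: "com \<Rightarrow> string set" where
  "rwrites Skip = {}"
| "rwrites (ISet a ks e) = {}"
| "rwrites (RSet a ks e) = {a}"
| "rwrites (Emit e) = {}"
| "rwrites (Seq p p') = rwrites p \<union> rwrites p'"
| "rwrites (Cond b p p') = rwrites p \<union> rwrites p'"
| "rwrites (While b p) = rwrites p"

primrec emits :: "com \<Rightarrow> bool" where
  "emits Skip = False"
| "emits (ISet a ks e) = False"
| "emits (RSet a ks e) = False"
| "emits (Emit e) = True"
| "emits (Seq p p') = (emits p \<or> emits p')"
| "emits (Cond b p p') = (emits p \<or> emits p')"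
| "emits (While b p) = emits p"

text \<open>A table that is no target of an assignment in p keeps its contents however often the
  loops of p run. This saves carrying untouched tables through the loop invariants.\<close>

definition framed :: "com \<Rightarrow> store \<Rightarrow> store \<Rightarrow> bool" where
  "framed p s s' \<longleftrightarrow> (\<forall>a. a \<notin> iwrites p \<longrightarrow> itab s' a = itab s a) \<and>
     (\<forall>a. a \<notin> rwrites p \<longrightarrow> rtab s' a = rtab s a) \<and> (\<not> emits p \<longrightarrow> out s' = out s)"

lemma store_update [simp]:
  "itab (iupdate a ks x s) = (itab s)(a := (itab s a)(ks := x))"
  "rtab (iupdate a ks x s) = rtab s" "out (iupdate a ks x s) = out s"
  "itab (rupdate a ks y s) = itab s"
  "rtab (rupdate a ks y s) = (rtab s)(a := (rtab s a)(ks := y))" "out (rupdate a ks y s) = out s"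
  by (simp_all add: iupdate_def rupdate_def)

lemma exec_framed: "exec W p s T s' \<Longrightarrow> framed p s s'"
  by (induction rule: exec.induct) (auto simp: framed_def)

lemma wp_frame: "wp W p Q s \<Longrightarrow> wp W p (\<lambda>N s'. Q N s' \<and> framed p s s') s"
  unfolding wp_def using exec_framed by blast

text \<open>Iteration over a list that is fixed when the program is written, such as the agents. The
  code is unrolled and therefore contributes no loop iterations of its own.\<close>

primrec seqs :: "com list \<Rightarrow> com" where
  "seqs [] = Skip"
| "seqs (p # ps) = Seq p (seqs ps)"

lemma writes_seqs [simp]:
  "iwrites (seqs ps) = (\<Union>p\<in>set ps. iwrites p)"
  "rwrites (seqs ps) = (\<Union>p\<in>set ps. rwrites p)"
  "emits (seqs ps) \<longleftrightarrow> (\<exists>p\<in>set ps. emits p)"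
  by (induction ps) auto

lemma wp_seqs_map:
  assumes "I 0 0 s"
    and "\<And>l N s. l < length xs \<Longrightarrow> I l N s \<Longrightarrow> wp W (f (xs ! l)) (\<lambda>N'. I (Suc l) (N + N')) s"
  shows "wp W (seqs (map f xs)) (I (length xs)) s"
proof -
  have "wp W (seqs (map f (drop l xs))) (\<lambda>N'. I (length xs) (N + N')) s"
    if "l \<le> length xs" "I l N s" for l N s
    using that
  proof (induction "length xs - l" arbitrary: l N s)
    case 0
    then show ?case by (auto intro!: wp_straight)
  next
    case (Suc x)
    then have l: "l < length xs" by simp
    have "wp W (Seq (f (xs ! l)) (seqs (map f (drop (Suc l) xs)))) (\<lambda>N'. I (length xs) (N + N')) s"
      using assms(2)[OF l Suc.prems(2)]
      by (rule wp_Seq[OF wp_mono], use Suc l in \<open>auto simp: add.assoc [symmetric] intro!: Suc.hyps(1)\<close>)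
    then show ?case using l by (simp add: Cons_nth_drop_Suc [symmetric])
  qed
  from this[of 0 0 s] assms(1) show ?thesis by simp
qed

lemma vc_seqs_map:
  assumes "I 0 s"
    and "\<And>l s. l < length xs \<Longrightarrow> I l s \<Longrightarrow> vc W (f (xs ! l)) (I (Suc l)) s"
  shows "vc W (seqs (map f xs)) (I (length xs)) s"
proof -
  have "vc W (seqs (map f (drop l xs))) (I (length xs)) s" if "l \<le> length xs" "I l s" for l s
    using that
  proof (induction "length xs - l" arbitrary: l s)
    case (Suc x)
    then have l: "l < length xs" by simp
    have "vc W (Seq (f (xs ! l)) (seqs (map f (drop (Suc l) xs)))) (I (length xs)) s"
      using assms(2)[OF l Suc.prems(2)] Suc l by (auto elim!: vc_mono intro!: Suc.hyps(1))
    then show ?case using l by (simp add: Cons_nth_drop_Suc [symmetric])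
  qed simp
  from this[of 0 s] assms(1) show ?thesis by simp
qed

text \<open>A decision tree whose leaves are selected by the logic and not at run time: f may be any
  function from outcomes to programs, even one defined by \<open>SOME\<close>.\<close>

primrec decide :: "bexp list \<Rightarrow> (bool list \<Rightarrow> com) \<Rightarrow> com" where
  "decide [] f = f []"
| "decide (b # bs) f = Cond b (decide bs (\<lambda>t. f (True # t))) (decide bs (\<lambda>t. f (False # t)))"

lemma vc_decide: "vc W (decide bs f) Q s = vc W (f (map (bval s) bs)) Q s"
  by (induction bs arbitrary: f) auto

lemma writes_decide:
  assumes "\<And>t. iwrites (f t) \<subseteq> A"
  shows "iwrites (decide bs f) \<subseteq> A"
  using assms by (induction bs arbitrary: f) auto

lemma rwrites_decide:
  assumes "\<And>t. rwrites (f t) \<subseteq> A"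
  shows "rwrites (decide bs f) \<subseteq> A"
  using assms by (induction bs arbitrary: f) auto

primrec conj_all :: "bexp list \<Rightarrow> bexp" where
  "conj_all [] = IEq (IConst 0) (IConst 0)"
| "conj_all (b # bs) = BAnd b (conj_all bs)"

lemma bval_conj_all [simp]: "bval s (conj_all bs) \<longleftrightarrow> (\<forall>b\<in>set bs. bval s b)"
  by (induction bs) auto

primrec ipow :: "iexp \<Rightarrow> nat \<Rightarrow> iexp" where
  "ipow e 0 = IConst 1"
| "ipow e (Suc d) = IMul e (ipow e d)"

lemma ival_ipow [simp]: "ival s (ipow e d) = ival s e ^ d"
  by (induction d) auto

section \<open>Biswas--Barman rounds\<close>

text \<open>Envy-cycle elimination with the envy graph replaced by an arbitrary relation, so that it
  also makes sense for a graph known only through outcomes of comparisons.\<close>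

definition rotate_along :: "('a \<times> 'a) set \<Rightarrow> ('a \<Rightarrow> 'b) \<Rightarrow> ('a \<Rightarrow> 'b) \<Rightarrow> bool" where
  "rotate_along r \<sigma> \<sigma>' \<longleftrightarrow> (\<exists>cs. cs \<noteq> [] \<and> distinct cs \<and>
     (\<forall>l<length cs. (cs ! l, cs ! (Suc l mod length cs)) \<in> r) \<and>
     (\<forall>l<length cs. \<sigma>' (cs ! l) = \<sigma> (cs ! (Suc l mod length cs))) \<and>
     (\<forall>i. i \<notin> set cs \<longrightarrow> \<sigma>' i = \<sigma> i))"

lemma eliminate_cycle_iff_rotate:
  "eliminate_cycle n v B \<sigma> \<sigma>' \<longleftrightarrow> rotate_along (envy n v (B \<circ> \<sigma>)) \<sigma> \<sigma>'"
  unfolding eliminate_cycle_def rotate_along_def ..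

lemma rotate_along_step:
  assumes "rotate_along r \<sigma> \<sigma>'"
  shows "\<sigma>' i = \<sigma> i \<or> (\<exists>j. (i, j) \<in> r \<and> \<sigma>' i = \<sigma> j)"
  using assms unfolding rotate_along_def by (metis in_set_conv_nth)

lemma rotate_along_moves:
  assumes "rotate_along r \<sigma> \<sigma>'"
  shows "\<exists>i j. (i, j) \<in> r \<and> \<sigma>' i = \<sigma> j"
  using assms unfolding rotate_along_def by (metis length_greater_0_conv)

lemma Suc_mod_inj: "l < k \<Longrightarrow> l' < k \<Longrightarrow> Suc l mod k = Suc l' mod k \<Longrightarrow> l = l'"
  by (metis Suc_lessI mod_Suc mod_less nat.inject nat.simps(3))

text \<open>The rotation composes \<sigma> with the cyclic permutation \<tau> of cs, and \<tau> is
  injective because the cyclic successor of an index is.\<close>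

lemma rotate_along_permutes:
  assumes "rotate_along r \<sigma> \<sigma>'" "r \<subseteq> S \<times> S" "finite S" "\<sigma> permutes S"
  shows "\<sigma>' permutes S"
proof -
  obtain cs where cs: "cs \<noteq> []" "distinct cs"
     "\<And>l. l < length cs \<Longrightarrow> (cs ! l, cs ! (Suc l mod length cs)) \<in> r"
     "\<And>l. l < length cs \<Longrightarrow> \<sigma>' (cs ! l) = \<sigma> (cs ! (Suc l mod length cs))"
     "\<And>i. i \<notin> set cs \<Longrightarrow> \<sigma>' i = \<sigma> i"
    using assms(1) unfolding rotate_along_def by blast
  define \<tau> where "\<tau> i = (if i \<in> set cs then cs ! (Suc (THE l. l < length cs \<and> cs ! l = i) mod length cs) else i)" for i
  have the: "(THE l'. l' < length cs \<and> cs ! l' = cs ! l) = l" if "l < length cs" for l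
    using that cs(2) by (intro the_equality) (auto simp: nth_eq_iff_index_eq)
  have \<tau>: "\<tau> (cs ! l) = cs ! (Suc l mod length cs)" if "l < length cs" for l
    using that by (simp add: \<tau>_def the)
  have \<sigma>': "\<sigma>' i = \<sigma> (\<tau> i)" for i
  proof (cases "i \<in> set cs")
    case True
    then obtain l where "l < length cs" "i = cs ! l" by (metis in_set_conv_nth)
    then show ?thesis using cs(4) \<tau> by simp
  qed (simp add: cs(5) \<tau>_def)
  have sub: "set cs \<subseteq> S" using cs(3) assms(2) by (fastforce simp: in_set_conv_nth)
  have mem: "\<tau> i \<in> set cs" if "i \<in> set cs" for i
    using that cs(1) by (simp add: \<tau>_def)
  have "\<tau> permutes S"
  proof (rule bij_imp_permutes)
    have "inj_on \<tau> S"
    proof (rule inj_onI)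
      fix i j assume eq: "\<tau> i = \<tau> j"
      show "i = j"
      proof (cases "i \<in> set cs \<and> j \<in> set cs")
        case True
        then obtain l l' where l: "l < length cs" "i = cs ! l" "l' < length cs" "j = cs ! l'"
          by (metis in_set_conv_nth)
        then have "Suc l mod length cs = Suc l' mod length cs"
          using eq \<tau> cs(1,2) by (simp add: nth_eq_iff_index_eq)
        then show ?thesis using l Suc_mod_inj by blast
      next
        case False
        then show ?thesis using eq mem by (metis \<tau>_def)
      qed
    qed
    moreover have "\<tau> ` S \<subseteq> S" using mem sub by (auto simp: \<tau>_def)
    ultimately show "bij_betw \<tau> S S"
      using assms(3) by (simp add: bij_betw_def endo_inj_surj)
  next
    fix i assume "i \<notin> S"
    then show "\<tau> i = i" using sub by (auto simp: \<tau>_def)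
  qed
  then have "\<sigma> \<circ> \<tau> permutes S" using assms(4) by (rule permutes_compose)
  moreover have "\<sigma>' = \<sigma> \<circ> \<tau>" using \<sigma>' by auto
  ultimately show ?thesis by simp
qed

text \<open>A closed walk of least length repeats no vertex, since the part between two equal
  vertices would be a shorter closed walk. Its vertices therefore form a cycle with distinct
  entries.\<close>

lemma rotate_along_exists:
  assumes "\<not> acyclic r"
  shows "\<exists>\<sigma>'. rotate_along r \<sigma> \<sigma>'"
proof -
  define P where "P k \<longleftrightarrow> 0 < k \<and> (\<exists>x. (x, x) \<in> r ^^ k)" for k
  obtain x where "(x, x) \<in> r\<^sup>+" using assms by (auto simp: acyclic_def)
  then have "\<exists>k. P k" unfolding P_def by (meson trancl_power)
  define k where "k = (LEAST k. P k)"
  have "P k" using \<open>\<exists>k. P k\<close> unfolding k_def by (metis LeastI)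
  then obtain x where k: "0 < k" and "(x, x) \<in> r ^^ k" by (auto simp: P_def)
  then obtain f where f: "f 0 = x" "f k = x" "\<And>i. i < k \<Longrightarrow> (f i, f (Suc i)) \<in> r"
    by (auto simp: relpow_fun_conv)
  have neq: "f a \<noteq> f b" if "a < b" "b < k" for a b
  proof
    assume eq: "f a = f b"
    have "(f a, f b) \<in> r ^^ (b - a)"
      unfolding relpow_fun_conv using that f(3) by (intro exI[of _ "\<lambda>i. f (a + i)"]) auto
    then have "P (b - a)" unfolding P_def using that eq by auto
    then have "k \<le> b - a" unfolding k_def by (rule Least_le)
    then show False using that by simp
  qed
  define cs where "cs = map f [0..<k]"
  have dist: "distinct cs"
    unfolding cs_def distinct_map using neq by (auto intro!: inj_onI) (metis linorder_neqE_nat)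
  have nxt: "cs ! (Suc l mod length cs) = f (Suc l)" if "l < k" for l
  proof (cases "Suc l = k")
    case True
    then show ?thesis using k f by (simp add: cs_def)
  next
    case False
    then show ?thesis using that by (simp add: cs_def)
  qed
  define \<sigma>' where "\<sigma>' i = (if i \<in> set cs then \<sigma> (cs ! (Suc (THE l. l < length cs \<and> cs ! l = i) mod length cs)) else \<sigma> i)" for i
  have the: "(THE l'. l' < length cs \<and> cs ! l' = cs ! l) = l" if "l < length cs" for l
    using that dist by (intro the_equality) (auto simp: nth_eq_iff_index_eq)
  have "rotate_along r \<sigma> \<sigma>'"
    unfolding rotate_along_def
  proof (intro exI[of _ cs] conjI allI impI)
    show "cs \<noteq> []" using k by (simp add: cs_def)
    show "distinct cs" by (fact dist)
    fix l assume l: "l < length cs"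
    then have "l < k" by (simp add: cs_def)
    then show "(cs ! l, cs ! (Suc l mod length cs)) \<in> r"
      using f(3)[of l] by (simp only: nxt) (simp add: cs_def)
    show "\<sigma>' (cs ! l) = \<sigma> (cs ! (Suc l mod length cs))"
      using l by (simp add: \<sigma>'_def the)
  next
    fix i assume "i \<notin> set cs" then show "\<sigma>' i = \<sigma> i" by (simp add: \<sigma>'_def)
  qed
  then show ?thesis by blast
qed

section \<open>Topological orders and greedy picks\<close>

text \<open>A finite acyclic relation is well-founded, so a minimal element of S can be put first
  and the rest is listed recursively.\<close>

lemma topological_list:
  assumes "finite S" "acyclic r" "finite r"
  shows "\<exists>xs. distinct xs \<and> set xs = S \<and> (\<forall>j l. j < l \<longrightarrow> l < length xs \<longrightarrow> (xs ! l, xs ! j) \<notin> r)"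
  using assms(1)
proof (induction "card S" arbitrary: S)
  case 0
  then show ?case by (intro exI[of _ "[]"]) auto
next
  case (Suc k)
  have "wf r" using assms finite_acyclic_wf by blast
  moreover have "S \<noteq> {}" using Suc.hyps(2) by auto
  ultimately obtain x where x: "x \<in> S" "\<And>y. (y, x) \<in> r \<Longrightarrow> y \<notin> S"
    by (metis wf_eq_minimal ex_in_conv)
  have "k = card (S - {x})" "finite (S - {x})" using Suc x by auto
  from Suc.hyps(1)[OF this] obtain xs where xs: "distinct xs" "set xs = S - {x}"
    "\<And>j l. j < l \<Longrightarrow> l < length xs \<Longrightarrow> (xs ! l, xs ! j) \<notin> r" by blast
  have "((x # xs) ! l, (x # xs) ! j) \<notin> r" if "j < l" "l < length (x # xs)" for j l
  proof (cases j)
    case 0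
    have "xs ! (l - 1) \<in> S" using that xs(2) by (metis Diff_iff One_nat_def Suc_less_eq Suc_pred
      gr_implies_not0 length_Cons linorder_not_less not_gr_zero nth_mem zero_less_Suc)
    then show ?thesis using x(2) 0 that by (auto simp: nth_Cons')
  next
    case (Suc j')
    then show ?thesis using xs(3)[of j' "l - 1"] that by (auto simp: nth_Cons')
  qed
  then show ?case using xs x by (intro exI[of _ "x # xs"]) auto
qed

lemma bij_betw_nth_pred:
  assumes "distinct xs" "set xs = S" "length xs = n"
  shows "bij_betw (\<lambda>j. xs ! (j - 1)) {1..n} S"
proof -
  have "bij_betw (\<lambda>j. j - 1) {1..n} {..<n}"
    by (rule bij_betw_byWitness[where f' = Suc]) auto
  moreover have "bij_betw ((!) xs) {..<n} S" using assms by (intro bij_betw_nth) auto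
  ultimately show ?thesis by (rule bij_betw_trans[unfolded comp_def])
qed

lemma topological_order_exists:
  assumes "acyclic r" "r \<subseteq> {1..n} \<times> {1..n}"
  shows "\<exists>\<pi>. topological_order n r \<pi>"
proof -
  have "finite r" using assms(2) by (rule finite_subset) auto
  then obtain xs where xs: "distinct xs" "set xs = {1..n}"
    "\<And>j l. j < l \<Longrightarrow> l < length xs \<Longrightarrow> (xs ! l, xs ! j) \<notin> r"
    using topological_list[of "{1..n}" r] assms(1) by auto
  have len: "length xs = n" using xs(1,2) distinct_card by fastforce
  have "j < l" if "j \<in> {1..n}" "l \<in> {1..n}" "(xs ! (j - 1), xs ! (l - 1)) \<in> r" for j l
  proof (rule ccontr)
    assume "\<not> j < l"
    then have "j = l \<or> l - 1 < j - 1" using that by (auto simp: not_less)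
    then consider "j = l" | "l - 1 < j - 1" by blast
    then show False
    proof cases
      case 1
      then show False using that assms(1) by (auto simp: acyclic_def)
    next
      case 2
      moreover have "j - 1 < length xs" using that(1) len by (simp; linarith)
      ultimately show False using that(3) xs(3) by blast
    qed
  qed
  then show ?thesis
    unfolding topological_order_def using bij_betw_nth_pred[OF xs(1,2) len] by blast
qed

text \<open>Each agent in turn takes a maximum of what is left. The picks are collected in a list,
  whose positions start at 0 while turns start at 1; hence \<open>Suc l\<close> in the construction
  and j - 1 in the final witness.\<close>

lemma greedy_picks_exist:
  fixes w :: "nat \<Rightarrow> nat \<Rightarrow> 'a :: linorder"
  shows "\<exists>\<kappa>. bij_betw \<kappa> {1..n} {0..<n} \<and>
    (\<forall>j\<in>{1..n}. \<forall>x\<in>{0..<n} - \<kappa> ` {1..<j}. w j x \<le> w j (\<kappa> j))"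
proof -
  have "\<exists>ys. distinct ys \<and> set ys \<subseteq> {0..<n} \<and> length ys = k \<and>
     (\<forall>l<k. \<forall>x\<in>{0..<n} - set (take l ys). w (Suc l) x \<le> w (Suc l) (ys ! l))" if "k \<le> n" for k
    using that
  proof (induction k)
    case (Suc k)
    then obtain ys where ys: "distinct ys" "set ys \<subseteq> {0..<n}" "length ys = k"
      "\<And>l x. l < k \<Longrightarrow> x \<in> {0..<n} - set (take l ys) \<Longrightarrow> w (Suc l) x \<le> w (Suc l) (ys ! l)"
      by auto
    let ?D = "{0..<n} - set ys"
    have "card (set ys) < n" using ys Suc.prems distinct_card by fastforce
    then have "?D \<noteq> {}"
      by (metis Diff_eq_empty_iff card_atLeastLessThan card_mono diff_zero leD List.finite_set)
    then have "Max (w (Suc k) ` ?D) \<in> w (Suc k) ` ?D" by (intro Max_in) auto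
    then obtain y where y: "y \<in> ?D" "w (Suc k) y = Max (w (Suc k) ` ?D)" by force
    then have max: "w (Suc k) x \<le> w (Suc k) y" if "x \<in> ?D" for x
      using that by (simp add: Max_ge)
    have "w (Suc l) x \<le> w (Suc l) ((ys @ [y]) ! l)"
      if "l < Suc k" "x \<in> {0..<n} - set (take l (ys @ [y]))" for l x
      using that ys max by (cases "l = k") (auto simp: nth_append)
    then show ?case using ys y by (intro exI[of _ "ys @ [y]"]) auto
  qed simp
  from this[of n] obtain ys where ys: "distinct ys" "set ys \<subseteq> {0..<n}" "length ys = n"
    "\<And>l x. l < n \<Longrightarrow> x \<in> {0..<n} - set (take l ys) \<Longrightarrow> w (Suc l) x \<le> w (Suc l) (ys ! l)"
    by auto
  have set: "set ys = {0..<n}"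
    by (rule card_subset_eq) (use ys distinct_card in auto)
  have img: "(\<lambda>j. ys ! (j - 1)) ` {1..<j} = set (take (j - 1) ys)" if "j \<in> {1..n}" for j
  proof -
    have "(\<lambda>j. ys ! (j - 1)) ` {1..<j} = (\<lambda>l. ys ! l) ` {0..<j - 1}"
      by (rule set_eqI) (force simp: image_iff intro: bexI[of _ "Suc _"])
    also have "\<dots> = set (take (j - 1) ys)" by (rule nth_image) (use that ys(3) in auto)
    finally show ?thesis .
  qed
  show ?thesis
  proof (intro exI conjI ballI)
    show "bij_betw (\<lambda>j. ys ! (j - 1)) {1..n} {0..<n}" using ys(1,3) set bij_betw_nth_pred by blast
    fix j x assume "j \<in> {1..n}" "x \<in> {0..<n} - (\<lambda>j. ys ! (j - 1)) ` {1..<j}"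
    then show "w j x \<le> w j (ys ! (j - 1))" using ys(4)[of "j - 1" x] img by auto
  qed
qed

section \<open>Rounds determined by finitely many comparisons\<close>

definition envy_of :: "nat \<Rightarrow> (nat \<Rightarrow> nat \<Rightarrow> nat \<Rightarrow> bool) \<Rightarrow> (nat \<Rightarrow> nat) \<Rightarrow> (nat \<times> nat) set" where
  "envy_of n lt \<sigma> = {(i, j). i \<in> {1..n} \<and> j \<in> {1..n} \<and> lt i (\<sigma> i) (\<sigma> j)}"

text \<open>The data of a round depends on the valuations only through finitely many comparisons:
  \<open>lt i b b'\<close> compares the bundles \<open>b\<close> and \<open>b'\<close>, and \<open>pr i x y\<close> the \<open>x\<close>-th and the \<open>y\<close>-th good of the
  round, in the eyes of agent \<open>i\<close>.\<close>

fun round_choice :: "nat \<Rightarrow> (nat \<Rightarrow> nat \<Rightarrow> nat \<Rightarrow> bool) \<Rightarrow> (nat \<Rightarrow> nat \<Rightarrow> nat \<Rightarrow> bool) \<Rightarrow> (nat \<Rightarrow> nat) \<Rightarrow>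
    round \<Rightarrow> bool" where
  "round_choice n lt pr \<sigma> (\<sigma>', \<pi>, \<kappa>) \<longleftrightarrow>
     (\<lambda>\<sigma>. rotate_along (envy_of n lt \<sigma>) \<sigma>)\<^sup>*\<^sup>* \<sigma> \<sigma>' \<and> acyclic (envy_of n lt \<sigma>') \<and>
     topological_order n (envy_of n lt \<sigma>') \<pi> \<and> bij_betw \<kappa> {1..n} {0..<n} \<and>
     (\<forall>j\<in>{1..n}. \<forall>x\<in>{0..<n} - \<kappa> ` {1..<j}. \<not> pr (\<pi> j) (\<kappa> j) x)"

lemma envy_of_subset: "envy_of n lt \<sigma> \<subseteq> {1..n} \<times> {1..n}"
  by (auto simp: envy_of_def)

lemma rotations_permute:
  assumes "(\<lambda>\<sigma>. rotate_along (envy_of n lt \<sigma>) \<sigma>)\<^sup>*\<^sup>* \<sigma> \<sigma>'" "\<sigma> permutes {1..n}"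
  shows "\<sigma>' permutes {1..n}"
  using assms
proof (induction rule: rtranclp_induct)
  case (step \<sigma>1 \<sigma>2)
  show ?case
    by (rule rotate_along_permutes[OF step(2) envy_of_subset _ step(3)]) (simp_all only: step finite_atLeastAtMost)
qed

text \<open>Every rotation strictly raises the sum of the agents' values for their own bundles. Only
  finitely many ownerships are reachable by rotations, and one that maximises this sum has an
  acyclic envy graph. The real-valued tables u and w matter only through the comparisons they
  induce.\<close>

lemma round_choice_exists:
  fixes u w :: "nat \<Rightarrow> nat \<Rightarrow> real"
  assumes \<sigma>: "\<sigma> permutes {1..n}"
    and lt: "\<And>i b c. \<lbrakk>i \<in> {1..n}; b \<in> {1..n}; c \<in> {1..n}\<rbrakk> \<Longrightarrow> lt i b c \<longleftrightarrow> u i b < u i c"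
    and pr: "\<And>i x y. \<lbrakk>i \<in> {1..n}; x < n; y < n\<rbrakk> \<Longrightarrow> pr i x y \<longleftrightarrow> w i x < w i y"
  shows "\<exists>\<rho>. round_choice n lt pr \<sigma> \<rho>"
proof -
  let ?rel = "\<lambda>\<sigma>. rotate_along (envy_of n lt \<sigma>) \<sigma>"
  let ?S = "{\<sigma>'. ?rel\<^sup>*\<^sup>* \<sigma> \<sigma>'}"
  have "?S \<subseteq> {\<sigma>. \<sigma> permutes {1..n}}" using rotations_permute \<sigma> by blast
  then have fin: "finite ?S" using finite_permutations finite_subset by blast
  define P where "P \<sigma> = (\<Sum>i\<in>{1..n}. u i (\<sigma> i))" for \<sigma>
  have "Max (P ` ?S) \<in> P ` ?S" using fin by (intro Max_in) auto
  then obtain \<sigma>' where \<sigma>': "?rel\<^sup>*\<^sup>* \<sigma> \<sigma>'" "P \<sigma>' = Max (P ` ?S)" by auto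
  then have max: "P \<sigma>'' \<le> P \<sigma>'" if "?rel\<^sup>*\<^sup>* \<sigma> \<sigma>''" for \<sigma>''
    using that fin by (simp add: Max_ge)
  have perm: "\<sigma>' permutes {1..n}" using rotations_permute \<sigma>'(1) \<sigma> by blast
  have acyc: "acyclic (envy_of n lt \<sigma>')"
  proof (rule ccontr)
    assume "\<not> ?thesis"
    then obtain \<sigma>'' where rot: "?rel \<sigma>' \<sigma>''" using rotate_along_exists by blast
    have less: "u i (\<sigma>' i) < u i (\<sigma>' j)" if "(i, j) \<in> envy_of n lt \<sigma>'" for i j
      using that lt permutes_in_image[OF perm] unfolding envy_of_def by blast
    have "P \<sigma>' < P \<sigma>''"
      unfolding P_def
    proof (rule sum_strict_mono_ex1)
      show "\<forall>i\<in>{1..n}. u i (\<sigma>' i) \<le> u i (\<sigma>'' i)"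
        using rotate_along_step[OF rot] less by (metis order.refl order.strict_implies_order)
      obtain i j where "(i, j) \<in> envy_of n lt \<sigma>'" "\<sigma>'' i = \<sigma>' j"
        using rotate_along_moves[OF rot] by blast
      moreover from this have "i \<in> {1..n}" by (auto simp: envy_of_def)
      ultimately show "\<exists>i\<in>{1..n}. u i (\<sigma>' i) < u i (\<sigma>'' i)" using less by metis
    qed simp
    moreover have "?rel\<^sup>*\<^sup>* \<sigma> \<sigma>''" using rtranclp.rtrancl_into_rtrancl[where r = ?rel, OF \<sigma>'(1) rot] .
    ultimately show False using max by fastforce
  qed
  obtain \<pi> where \<pi>: "topological_order n (envy_of n lt \<sigma>') \<pi>"
    using topological_order_exists[OF acyc envy_of_subset] by blast
  obtain \<kappa> where \<kappa>: "bij_betw \<kappa> {1..n} {0..<n}"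
    "\<And>j x. j \<in> {1..n} \<Longrightarrow> x \<in> {0..<n} - \<kappa> ` {1..<j} \<Longrightarrow> w (\<pi> j) x \<le> w (\<pi> j) (\<kappa> j)"
    using greedy_picks_exist[of n "\<lambda>j. w (\<pi> j)"] by blast
  have "\<not> pr (\<pi> j) (\<kappa> j) x" if "j \<in> {1..n}" "x \<in> {0..<n} - \<kappa> ` {1..<j}" for j x
  proof -
    have "\<pi> j \<in> {1..n}" "\<kappa> j < n"
      using that \<pi> \<kappa>(1) by (auto simp: topological_order_def bij_betw_def)
    then show ?thesis using pr[of "\<pi> j" "\<kappa> j" x] \<kappa>(2)[OF that] that(2) by auto
  qed
  then have "round_choice n lt pr \<sigma> (\<sigma>', \<pi>, \<kappa>)" using \<sigma>'(1) acyc \<pi> \<kappa>(1) by simp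
  then show ?thesis ..
qed

section \<open>Preservation of EF1\<close>

text \<open>The bundles remain the same sets and no agent's own value falls, so EF1 of agent i
  towards the former owner of a bundle carries over to the new owner. If the former owner is i
  itself, what i owns now is worth at least as much as that bundle.\<close>

lemma eliminate_cycle_EF1:
  assumes "eliminate_cycle n v B \<sigma> \<sigma>'" "\<sigma> permutes {1..n}" "EF1 n v (B \<circ> \<sigma>)"
    and mono: "\<And>i b g. i \<in> {1..n} \<Longrightarrow> b \<in> {1..n} \<Longrightarrow> v i (B b - {g}) \<le> v i (B b)"
  shows "EF1 n v (B \<circ> \<sigma>')"
proof -
  have rot: "rotate_along (envy n v (B \<circ> \<sigma>)) \<sigma> \<sigma>'"
    using assms(1) by (simp add: eliminate_cycle_iff_rotate)
  have "\<sigma>' permutes {1..n}"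
    by (rule rotate_along_permutes[OF rot _ _ assms(2)]) (auto simp: envy_def)
  have ge: "v i (B (\<sigma> i)) \<le> v i (B (\<sigma>' i))" for i
    using rotate_along_step[OF rot, of i] by (auto simp: envy_def)
  show ?thesis
    unfolding EF1_def
  proof (intro ballI impI)
    fix i j assume ij: "i \<in> {1..n}" "j \<in> {1..n}" "i \<noteq> j"
    obtain l where l: "l \<in> {1..n}" "\<sigma> l = \<sigma>' j"
      using assms(2) \<open>\<sigma>' permutes {1..n}\<close> ij(2) by (metis permutes_image image_iff permutes_in_image)
    show "(B \<circ> \<sigma>') j = {} \<or> (\<exists>g\<in>(B \<circ> \<sigma>') j. v i ((B \<circ> \<sigma>') j - {g}) \<le> v i ((B \<circ> \<sigma>') i))"
    proof (cases "l = i")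
      case False
      then have "(B \<circ> \<sigma>) l = {} \<or> (\<exists>g\<in>(B \<circ> \<sigma>) l. v i ((B \<circ> \<sigma>) l - {g}) \<le> v i ((B \<circ> \<sigma>) i))"
        using assms(3) ij l unfolding EF1_def by (metis comp_apply)
      then show ?thesis using ge[of i] l(2) by (auto intro: order.trans)
    next
      case True
      then have "v i (B (\<sigma>' j) - {g}) \<le> v i (B (\<sigma>' i))" for g
        using mono[of i "\<sigma> i" g] ge[of i] l(2) ij(1) permutes_in_image[OF assms(2), of i] by auto
      then show ?thesis by (metis comp_apply ex_in_conv)
    qed
  qed
qed

lemma additive_union:
  assumes "additive_valuations n m v" "i \<in> {1..n}" "S \<subseteq> {1..m}" "T \<subseteq> {1..m}" "S \<inter> T = {}"
  shows "v i (S \<union> T) = v i S + v i T"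
proof -
  have "finite S" "finite T" using assms finite_subset by blast+
  then have "(\<Sum>g\<in>S \<union> T. v i {g}) = (\<Sum>g\<in>S. v i {g}) + (\<Sum>g\<in>T. v i {g})"
    using assms(5) by (rule sum.union_disjoint)
  then show ?thesis using assms unfolding additive_valuations_def by (metis Un_least)
qed

lemma additive_insert:
  assumes "additive_valuations n m v" "i \<in> {1..n}" "S \<subseteq> {1..m}" "g \<in> {1..m}" "g \<notin> S"
  shows "v i (insert g S) = v i S + v i {g}"
  using additive_union[OF assms(1,2,3), of "{g}"] assms by simp

lemma additive_mono:
  assumes "additive_valuations n m v" "i \<in> {1..n}" "T \<subseteq> {1..m}"
  shows "v i (T - {g}) \<le> v i T"
proof (cases "g \<in> T")
  case True
  then have "v i T = v i (T - {g}) + v i {g}"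
    using additive_insert[OF assms(1,2), of "T - {g}" g] assms(3) subsetD[OF assms(3) True]
    by (simp add: insert_absorb subset_insertI2 Diff_subset[THEN order.trans])
  moreover have "0 \<le> v i {g}" using assms True unfolding additive_valuations_def by blast
  ultimately show ?thesis by simp
qed simp

text \<open>An agent does not envy those before it in the topological order, so at worst it envies them for
  the good they have just picked. With respect to those after it, EF1 persists because it picks first.\<close>

lemma picks_EF1:
  assumes add: "additive_valuations n m v"
    and \<sigma>: "\<sigma> permutes {1..n}" and ef: "EF1 n v (B \<circ> \<sigma>)"
    and B: "\<And>b. b \<in> {1..n} \<Longrightarrow> B b \<subseteq> {1..m} - C" and C: "C \<subseteq> {1..m}"
    and \<pi>: "topological_order n (envy n v (B \<circ> \<sigma>)) \<pi>"
    and c: "bij_betw c {1..n} C"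
      "\<And>j g. j \<in> {1..n} \<Longrightarrow> g \<in> C - c ` {1..<j} \<Longrightarrow> v (\<pi> j) {g} \<le> v (\<pi> j) {c j}"
    and B': "B' = (\<lambda>b. B b \<union> c ` {j \<in> {1..n}. \<sigma> (\<pi> j) = b})"
  shows "EF1 n v (B' \<circ> \<sigma>)"
proof -
  have \<pi>b: "bij_betw \<pi> {1..n} {1..n}" using \<pi> by (simp add: topological_order_def)
  have B'\<pi>: "B' (\<sigma> (\<pi> j)) = insert (c j) (B (\<sigma> (\<pi> j)))" if "j \<in> {1..n}" for j
  proof -
    have "{l \<in> {1..n}. \<sigma> (\<pi> l) = \<sigma> (\<pi> j)} = {j}"
      using that permutes_inj[OF \<sigma>] bij_betw_imp_inj_on[OF \<pi>b] by (auto dest: injD inj_onD)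
    then show ?thesis by (simp add: B')
  qed
  show ?thesis
    unfolding EF1_def
  proof (intro ballI impI)
    fix i i' assume i: "i \<in> {1..n}" "i' \<in> {1..n}" "i \<noteq> i'"
    obtain j l where jl: "j \<in> {1..n}" "l \<in> {1..n}" "i = \<pi> j" "i' = \<pi> l"
      using i \<pi>b by (metis bij_betw_imp_surj_on image_iff)
    have "j \<noteq> l" using jl i by auto
    have \<sigma>i: "\<sigma> i \<in> {1..n}" "\<sigma> i' \<in> {1..n}" using i permutes_in_image[OF \<sigma>] by auto
    have cC: "c j \<in> C" "c l \<in> C" using c(1) jl by (auto simp: bij_betw_def)
    have own: "v i (B' (\<sigma> i)) = v i (B (\<sigma> i)) + v i {c j}"
      unfolding jl(3) B'\<pi>[OF jl(1)]
      unfolding jl(3) [symmetric]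
      by (rule additive_insert[OF add i(1)]) (use B[OF \<sigma>i(1)] cC C in auto)
    have oth: "B' (\<sigma> i') = insert (c l) (B (\<sigma> i'))" unfolding jl(4) by (rule B'\<pi>[OF jl(2)])
    have new: "c l \<notin> B (\<sigma> i')" using B[OF \<sigma>i(2)] cC by auto
    have pos: "0 \<le> v i {c j}" using add i(1) cC C unfolding additive_valuations_def by blast
    have "\<exists>g\<in>B' (\<sigma> i'). v i (B' (\<sigma> i') - {g}) \<le> v i (B' (\<sigma> i))"
    \<comment> \<open>In the first case dropping \<open>c l\<close> suffices: i does not value the
      old bundle of i' above its own new one, because i' comes earlier in the topological order or
      that bundle was empty.\<close>
    proof (cases "l < j \<or> B (\<sigma> i') = {}")
      case True
      have "v i (B (\<sigma> i')) \<le> v i (B (\<sigma> i)) + v i {c j}"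
      proof (cases "B (\<sigma> i') = {}")
        case True
        then have "v i (B (\<sigma> i')) \<le> v i (B (\<sigma> i))"
          using add i(1) B[OF \<sigma>i(1)] unfolding additive_valuations_def
          by (metis Diff_subset empty_subsetI order.trans sum.empty)
        then show ?thesis using pos by simp
      next
        case False
        then have "l < j" using True by simp
        then have "(i, i') \<notin> envy n v (B \<circ> \<sigma>)"
          using \<pi> jl unfolding topological_order_def by (metis order.asym)
        then show ?thesis using i pos by (auto simp: envy_def)
      qed
      then show ?thesis using oth own new by (intro bexI[of _ "c l"]) auto
    next
      case False
      then have "j < l" using \<open>j \<noteq> l\<close> by auto
      have "c l \<notin> c ` {1..<j}"
      proof
        assume "c l \<in> c ` {1..<j}"
        then obtain x where "x \<in> {1..<j}" "c l = c x" by auto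
        then have "l = x" using c(1) jl by (auto simp: bij_betw_def dest: inj_onD)
        then show False using \<open>x \<in> {1..<j}\<close> \<open>j < l\<close> by simp
      qed
      then have pick: "v i {c l} \<le> v i {c j}" using c(2)[OF jl(1)] cC jl(3) by auto
      obtain g where g: "g \<in> B (\<sigma> i')" "v i (B (\<sigma> i') - {g}) \<le> v i (B (\<sigma> i))"
        using ef[unfolded EF1_def, rule_format, OF i] False by auto
      have "insert (c l) (B (\<sigma> i')) - {g} = insert (c l) (B (\<sigma> i') - {g})" using g new by auto
      moreover have "v i (insert (c l) (B (\<sigma> i') - {g})) = v i (B (\<sigma> i') - {g}) + v i {c l}"
        by (rule additive_insert[OF add i(1)]) (use B[OF \<sigma>i(2)] cC C in auto)
      ultimately show ?thesis using g oth own pick by (intro bexI[of _ g]) auto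
    qed
    then show "(B' \<circ> \<sigma>) i' = {} \<or> (\<exists>g\<in>(B' \<circ> \<sigma>) i'. v i ((B' \<circ> \<sigma>) i' - {g}) \<le> v i ((B' \<circ> \<sigma>) i))"
      by simp
  qed
qed

text \<open>The comparison graph and the envy graph agree for ownerships that permute {1..n}, as
  \<open>lt\<close> is specified on valid bundle numbers only. The permutation property is therefore
  carried along the chain of rotations, together with EF1.\<close>

lemma rotations_eliminate:
  assumes "(\<lambda>\<sigma>. rotate_along (envy_of n lt \<sigma>) \<sigma>)\<^sup>*\<^sup>* \<sigma> \<sigma>'" "\<sigma> permutes {1..n}"
    and lt: "\<And>i b c. \<lbrakk>i \<in> {1..n}; b \<in> {1..n}; c \<in> {1..n}\<rbrakk> \<Longrightarrow> lt i b c \<longleftrightarrow> v i (B b) < v i (B c)"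
    and mono: "\<And>i b g. i \<in> {1..n} \<Longrightarrow> b \<in> {1..n} \<Longrightarrow> v i (B b - {g}) \<le> v i (B b)"
    and "EF1 n v (B \<circ> \<sigma>)"
  shows "(eliminate_cycle n v B)\<^sup>*\<^sup>* \<sigma> \<sigma>' \<and> EF1 n v (B \<circ> \<sigma>') \<and>
    envy_of n lt \<sigma>' = envy n v (B \<circ> \<sigma>')"
proof -
  have env: "envy_of n lt \<sigma> = envy n v (B \<circ> \<sigma>)" if "\<sigma> permutes {1..n}" for \<sigma>
  proof -
    have "lt i (\<sigma> i) (\<sigma> j) \<longleftrightarrow> v i (B (\<sigma> i)) < v i (B (\<sigma> j))" if "i \<in> {1..n}" "j \<in> {1..n}" for i j
      using that lt permutes_in_image[OF \<open>\<sigma> permutes {1..n}\<close>] by blast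
    then show ?thesis unfolding envy_of_def envy_def by auto
  qed
  have "(eliminate_cycle n v B)\<^sup>*\<^sup>* \<sigma> \<sigma>' \<and> EF1 n v (B \<circ> \<sigma>')"
    using assms(1)
  proof (induction rule: rtranclp_induct)
    case base
    then show ?case using assms(5) by blast
  next
    case (step \<sigma>1 \<sigma>2)
    have p: "\<sigma>1 permutes {1..n}" using rotations_permute[OF step(1) assms(2)] .
    then have "eliminate_cycle n v B \<sigma>1 \<sigma>2"
      using step(2) by (simp add: eliminate_cycle_iff_rotate env)
    then show ?case
      using rtranclp.rtrancl_into_rtrancl[OF conjunct1[OF step(3)]]
        eliminate_cycle_EF1[OF _ p conjunct2[OF step(3)] mono] by blast
  qed
  then show ?thesis using env rotations_permute[OF assms(1,2)] by blast
qed

text \<open>The triple names goods by their position within the group and is thus independent of the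
  instance; \<open>gs\<close> translates positions back into goods, which turns the abstract choice
  into a round of the algorithm.\<close>

lemma round_choice_correct:
  assumes choice: "round_choice n lt pr \<sigma> (\<sigma>', \<pi>, \<kappa>)"
    and add: "additive_valuations n m v"
    and \<sigma>: "\<sigma> permutes {1..n}" and ef: "EF1 n v (B \<circ> \<sigma>)"
    and B: "\<And>b. b \<in> {1..n} \<Longrightarrow> B b \<subseteq> {1..m} - C" and C: "C \<subseteq> {1..m}"
    and lt: "\<And>i b c. \<lbrakk>i \<in> {1..n}; b \<in> {1..n}; c \<in> {1..n}\<rbrakk> \<Longrightarrow> lt i b c \<longleftrightarrow> v i (B b) < v i (B c)"
    and pr: "\<And>i x y. \<lbrakk>i \<in> {1..n}; x < n; y < n\<rbrakk> \<Longrightarrow> pr i x y \<longleftrightarrow> v i {gs x} < v i {gs y}"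
    and gs: "bij_betw gs {0..<n} C"
    and B': "B' = (\<lambda>b. B b \<union> (gs \<circ> \<kappa>) ` {j \<in> {1..n}. \<sigma>' (\<pi> j) = b})"
  shows "bb_round n v C (\<sigma>, B) (\<sigma>', \<pi>, gs \<circ> \<kappa>) (\<sigma>', B')" "EF1 n v (B' \<circ> \<sigma>')"
    "\<sigma>' permutes {1..n}"
proof -
  have ch: "(\<lambda>\<sigma>. rotate_along (envy_of n lt \<sigma>) \<sigma>)\<^sup>*\<^sup>* \<sigma> \<sigma>'" "acyclic (envy_of n lt \<sigma>')"
     "topological_order n (envy_of n lt \<sigma>') \<pi>" "bij_betw \<kappa> {1..n} {0..<n}"
     "\<And>j x. j \<in> {1..n} \<Longrightarrow> x \<in> {0..<n} - \<kappa> ` {1..<j} \<Longrightarrow> \<not> pr (\<pi> j) (\<kappa> j) x"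
    using choice by auto
  have mono: "v i (B b - {g}) \<le> v i (B b)" if "i \<in> {1..n}" "b \<in> {1..n}" for i b g
    using additive_mono[OF add that(1)] B[OF that(2)] by blast
  have el: "(eliminate_cycle n v B)\<^sup>*\<^sup>* \<sigma> \<sigma>'" "EF1 n v (B \<circ> \<sigma>')"
    and env: "envy_of n lt \<sigma>' = envy n v (B \<circ> \<sigma>')"
    using rotations_eliminate[OF ch(1) \<sigma> lt mono ef] by blast+
  show perm: "\<sigma>' permutes {1..n}" using rotations_permute[OF ch(1) \<sigma>] .
  have c: "bij_betw (gs \<circ> \<kappa>) {1..n} C" using ch(4) gs by (rule bij_betw_trans)
  have pick: "v (\<pi> j) {g} \<le> v (\<pi> j) {(gs \<circ> \<kappa>) j}"
    if j: "j \<in> {1..n}" and g: "g \<in> C - (gs \<circ> \<kappa>) ` {1..<j}" for j g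
  proof -
    obtain x where x: "x \<in> {0..<n}" "g = gs x" using g gs by (auto simp: bij_betw_def)
    have "\<pi> j \<in> {1..n}" "\<kappa> j < n"
      using j ch(3,4) by (auto simp: topological_order_def bij_betw_def)
    moreover have "x \<notin> \<kappa> ` {1..<j}" using g x by auto
    ultimately show ?thesis using ch(5)[OF j, of x] x pr[of "\<pi> j" "\<kappa> j" x] by auto
  qed
  show "bb_round n v C (\<sigma>, B) (\<sigma>', \<pi>, gs \<circ> \<kappa>) (\<sigma>', B')"
    using el ch(2,3) c pick unfolding env by (auto simp: B')
  show "EF1 n v (B' \<circ> \<sigma>')"
    by (rule picks_EF1[OF add perm el(2) B C _ c pick B']) (use ch(3) env in auto)
qed

section \<open>Enumerations in tables\<close>

text \<open>The common form of all lists kept in tables: adjacency lists, degree classes, the degree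
  order, the stack of pending goods and the buckets. Bijectivity excludes repetitions, so N is the
  size of S. Entries outside 0, ..., N - 1 are arbitrary, hence a list is emptied by resetting its
  length.\<close>

definition enum :: "(int \<Rightarrow> int) \<Rightarrow> int \<Rightarrow> nat set \<Rightarrow> bool" where
  "enum h N S \<longleftrightarrow> 0 \<le> N \<and> bij_betw h {0..<N} (int ` S)"

lemma enum_card:
  assumes "enum h N S"
  shows "finite S" "N = int (card S)"
proof -
  have b: "bij_betw h {0..<N} (int ` S)" and N: "0 \<le> N" using assms by (auto simp: enum_def)
  have "finite (int ` S)" using b bij_betw_finite by blast
  then show "finite S" by (rule finite_imageD) simp
  have "card (int ` S) = card {0..<N}" using bij_betw_same_card[OF b] by simp
  then show "N = int (card S)" using N by (simp add: card_image)
qed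

lemma enum_empty [simp]: "enum h 0 S \<longleftrightarrow> S = {}"
  by (auto simp: enum_def bij_betw_def)

lemma enum_cong: "(\<And>i. 0 \<le> i \<Longrightarrow> i < N \<Longrightarrow> h i = h' i) \<Longrightarrow> enum h N S \<longleftrightarrow> enum h' N S"
  unfolding enum_def by (intro conj_cong bij_betw_cong) auto

lemma enum_mem: "enum h N S \<Longrightarrow> 0 \<le> i \<Longrightarrow> i < N \<Longrightarrow> \<exists>x\<in>S. h i = int x"
  by (auto simp: enum_def bij_betw_def)

lemma enum_ex: "enum h N S \<Longrightarrow> x \<in> S \<Longrightarrow> \<exists>i. 0 \<le> i \<and> i < N \<and> h i = int x"
proof -
  assume "enum h N S" "x \<in> S"
  then have "int x \<in> h ` {0..<N}" by (simp add: enum_def bij_betw_def)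
  then show ?thesis by force
qed

lemma enum_inj: "enum h N S \<Longrightarrow> 0 \<le> i \<Longrightarrow> i < N \<Longrightarrow> 0 \<le> j \<Longrightarrow> j < N \<Longrightarrow> h i = h j \<Longrightarrow> i = j"
  by (auto simp: enum_def bij_betw_def dest: inj_onD)

lemma enum_push:
  assumes "enum h N S" "x \<notin> S" "h' N = int x" "\<And>i. 0 \<le> i \<Longrightarrow> i < N \<Longrightarrow> h' i = h i"
  shows "enum h' (N + 1) (insert x S)"
proof -
  have N: "0 \<le> N" using assms(1) by (simp add: enum_def)
  have "enum h' N S" using assms(1,4) enum_cong[of N h' h] by blast
  then have "bij_betw h' {0..<N} (int ` S)" by (simp add: enum_def)
  moreover have "bij_betw h' {N} {int x}" using assms(3) by simp
  ultimately have "bij_betw h' ({0..<N} \<union> {N}) (int ` S \<union> {int x})"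
    by (rule bij_betw_combine) (use assms(2) in auto)
  moreover have "{0..<N} \<union> {N} = {0..<N + 1}" using N by auto
  ultimately show ?thesis using N by (simp add: enum_def)
qed

lemma enum_pop:
  assumes "enum h N S" "0 < N"
  obtains x where "x \<in> S" "h (N - 1) = int x" "enum h (N - 1) (S - {x})"
proof -
  obtain x where x: "x \<in> S" "h (N - 1) = int x" using enum_mem[OF assms(1), of "N - 1"] assms(2) by auto
  have "bij_betw h ({0..<N} - {N - 1}) (int ` S - {h (N - 1)})"
  proof (rule bij_betw_DiffI)
    show "bij_betw h {0..<N} (int ` S)" using assms(1) by (simp add: enum_def)
    show "bij_betw h {N - 1} {h (N - 1)}" by simp
  qed (use assms(2) x in auto)
  moreover have "{0..<N} - {N - 1} = {0..<N - 1}" using assms(2) by auto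
  moreover have "int ` S - {h (N - 1)} = int ` (S - {x})" using x by auto
  ultimately show ?thesis using that x assms(2) by (simp add: enum_def)
qed

section \<open>The program: preprocessing\<close>

abbreviation V :: "string \<Rightarrow> iexp" where "V x \<equiv> IGet x []"

abbreviation assign :: "string \<Rightarrow> iexp \<Rightarrow> com" (infix "::=" 62) where "x ::= e \<equiv> ISet x [] e"

abbreviation incr :: "string \<Rightarrow> iexp list \<Rightarrow> com" where
  "incr a ks \<equiv> ISet a ks (IAdd (IGet a ks) (IConst 1))"

abbreviation ile :: "iexp \<Rightarrow> iexp \<Rightarrow> bexp" where "ile e f \<equiv> BNot (ILess f e)"

abbreviation bor :: "bexp \<Rightarrow> bexp \<Rightarrow> bexp" where "bor b c \<equiv> BNot (BAnd (BNot b) (BNot c))"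

notation Seq (infixr ";;" 60)

section \<open>Code for adjacency lists, degree order, constants and pieces\<close>

definition adj_body :: com where
  "adj_body =
    ''a'' ::= IGet ''edge'' [V ''i'', IConst 0] ;;
    ''b'' ::= IGet ''edge'' [V ''i'', IConst 1] ;;
    ISet ''adj'' [V ''a'', IGet ''deg'' [V ''a'']] (V ''b'') ;; incr ''deg'' [V ''a''] ;;
    ISet ''adj'' [V ''b'', IGet ''deg'' [V ''b'']] (V ''a'') ;; incr ''deg'' [V ''b''] ;;
    incr ''i'' []"

definition adj_prog :: com where
  "adj_prog = ''i'' ::= IConst 0 ;; While (ILess (V ''i'') (V ''e'')) adj_body"

definition fill_body :: com where
  "fill_body =
    ISet ''sb'' [IGet ''deg'' [V ''x''], IGet ''sn'' [IGet ''deg'' [V ''x'']]] (V ''x'') ;;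
    incr ''sn'' [IGet ''deg'' [V ''x'']] ;; incr ''x'' []"

definition sort_body :: com where
  "sort_body = Cond (ILess (IConst 0) (IGet ''sn'' [V ''y'']))
    (ISet ''sn'' [V ''y''] (ISub (IGet ''sn'' [V ''y'']) (IConst 1)) ;;
     ISet ''ord'' [V ''pos''] (IGet ''sb'' [V ''y'', IGet ''sn'' [V ''y'']]) ;; incr ''pos'' [])
    (''y'' ::= ISub (V ''y'') (IConst 1))"

definition sort_prog :: com where
  "sort_prog =
    ''x'' ::= IConst 1 ;; While (ile (V ''x'') (V ''m'')) fill_body ;;
    ''y'' ::= V ''m'' ;; ''pos'' ::= IConst 0 ;; While (ILess (V ''pos'') (V ''m'')) sort_body"

definition const_prog :: com where
  "const_prog =
    ''r'' ::= IConst 0 ;; While (ILess (IMul (V ''r'') (V ''r'')) (V ''e'')) (incr ''r'' []) ;;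
    ''Q'' ::= IConst 1 ;; While (ILess (V ''Q'') (V ''m'')) (''Q'' ::= IMul (V ''Q'') (IConst 2))"

text \<open>Decides \<open>y < sqrt F * z\<close> by comparing signs and squares, as \<open>\<Delta>\<close> may be irrational.\<close>

definition sqless :: "iexp \<Rightarrow> iexp \<Rightarrow> iexp \<Rightarrow> bexp" where
  "sqless y F z = bor
    (BAnd (ILess (IConst 0) z)
      (bor (ILess y (IConst 0)) (ILess (IMul y y) (IMul F (IMul z z)))))
    (BAnd (BNot (ILess (IConst 0) z))
      (BAnd (ILess y (IConst 0)) (ILess (IMul F (IMul z z)) (IMul y y))))"

text \<open>Tabulates, for the finest grid that is needed (\<open>Q\<close> intervals), the piece of every integer that
  can occur. All grids are dyadic, so the piece in a coarser grid is found by an integer division.\<close>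

definition sweep_body :: "nat \<Rightarrow> int \<Rightarrow> iexp \<Rightarrow> com" where
  "sweep_body n kd F = Cond
    (BAnd (ILess (IAdd (V ''t'') (IConst 1)) (V ''Q''))
      (BNot (sqless (IMul (IConst (int n)) (IMul (V ''x'') (V ''Q''))) F
        (ISub (IMul (IConst 2) (IAdd (V ''t'') (IConst 1))) (V ''Q'')))))
    (incr ''t'' [])
    (ISet ''pt'' [IConst kd, V ''x''] (V ''t'') ;; incr ''x'' [])"

definition sweep_prog :: "nat \<Rightarrow> int \<Rightarrow> iexp \<Rightarrow> com" where
  "sweep_prog n kd F =
    ''t'' ::= IConst 0 ;; ''x'' ::= IMul (IConst (-2)) (V ''r'') ;;
    While (ile (V ''x'') (IMul (IConst 2) (V ''r''))) (sweep_body n kd F)"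

text \<open>Phase 0 has \<open>\<Delta> = r\<close>; the later phases are rescaled to \<open>\<Delta> = 2 * sqrt e / n\<close>. In both cases
  \<open>F = (n * \<Delta>)\<^sup>2\<close>.\<close>

definition pieces_prog :: "nat \<Rightarrow> com" where
  "pieces_prog n =
    sweep_prog n 0 (IMul (IConst (int n * int n)) (IMul (V ''r'') (V ''r''))) ;;
    sweep_prog n 1 (IMul (IConst 4) (V ''e''))"

text \<open>Squaring preserves the order of non-negative numbers and reverses that of non-positive
  ones; when the signs differ, they decide.\<close>

lemma sq_less_sqrt:
  fixes y z F :: int
  assumes "0 \<le> F"
  shows "real_of_int y < sqrt (real_of_int F) * real_of_int z \<longleftrightarrow>
    (if 0 < z then y < 0 \<or> y * y < F * (z * z) else y < 0 \<and> F * (z * z) < y * y)"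
proof -
  define a b where "a = real_of_int y" and "b = sqrt (real_of_int F) * real_of_int z"
  have sq: "b * b = real_of_int (F * (z * z))" using assms by (simp add: b_def algebra_simps)
  have ay: "a * a = real_of_int (y * y)" by (simp add: a_def)
  have lt: "y * y < F * (z * z) \<longleftrightarrow> a * a < b * b" "F * (z * z) < y * y \<longleftrightarrow> b * b < a * a"
    unfolding sq ay of_int_less_iff by simp_all
  have y: "y < 0 \<longleftrightarrow> a < 0" by (simp add: a_def)
  show ?thesis
  proof (cases "0 < z")
    case True
    then have "0 \<le> b" using assms by (simp add: b_def)
    then have "a < b \<longleftrightarrow> a < 0 \<or> a * a < b * b"
      by (metis abs_le_square_iff abs_of_nonneg linorder_not_less order.strict_trans2 power2_eq_square)
    then show ?thesis using True lt y unfolding a_def [symmetric] b_def [symmetric] by simp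
  next
    case False
    then have "b \<le> 0" using assms by (simp add: b_def mult_nonneg_nonpos)
    have "a < b \<longleftrightarrow> a < 0 \<and> b * b < a * a"
    proof
      assume "a < b"
      then have "- b * - b < - a * - a" using \<open>b \<le> 0\<close> by (intro mult_strict_mono') auto
      then show "a < 0 \<and> b * b < a * a" using \<open>a < b\<close> \<open>b \<le> 0\<close> by simp
    next
      assume *: "a < 0 \<and> b * b < a * a"
      show "a < b"
      proof (rule ccontr)
        assume "\<not> a < b"
        then have "- a * - a \<le> - b * - b" using * by (intro mult_mono) auto
        then show False using * by simp
      qed
    qed
    then show ?thesis using False lt y unfolding a_def [symmetric] b_def [symmetric] by simp
  qed
qed

lemma bval_sqless:
  assumes "0 \<le> ival s F"
  shows "bval s (sqless y F z) \<longleftrightarrow>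
    real_of_int (ival s y) < sqrt (real_of_int (ival s F)) * real_of_int (ival s z)"
  unfolding sq_less_sqrt[OF assms] sqless_def by auto

text \<open>The word bound is kept abstract. The factor 4 leaves room for the larger numbers that
  are stored, such as the sweep positions up to 2 * \<open>rt\<close> + 1, powers of two below 2 *
  m, and counters.\<close>

locale instance_data =
  fixes n m :: nat and v :: valuation and E :: "nat set set" and es :: "(nat \<times> nat) list"
    and W :: nat
  assumes n3: "3 \<le> n" and additive: "additive_valuations n m v" and n_dvd_m: "n dvd m"
    and graph: "simple_graph m E" and E1: "1 \<le> card E" and edges: "edge_list es E"
    and W: "4 * (m + card E) \<le> W"
begin

definition nbrs :: "nat \<Rightarrow> nat set" where "nbrs g = {h. {g, h} \<in> E}"

abbreviation deg :: "nat \<Rightarrow> nat" where "deg g \<equiv> card (nbrs g)"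

lemma deg_in_UNIV: "deg_in E UNIV g = deg g"
  by (simp add: deg_in_def nbrs_def)

lemma deg_in_nbrs: "deg_in E X g = card (X \<inter> nbrs g)"
  by (simp add: deg_in_def nbrs_def Int_def)

lemma edgeD: "{a, b} \<in> E \<Longrightarrow> a \<in> {1..m} \<and> b \<in> {1..m} \<and> a \<noteq> b"
  using graph unfolding simple_graph_def by (fastforce simp: doubleton_eq_iff)

lemma nbrs_subset: "nbrs g \<subseteq> {1..m} - {g}"
  using edgeD by (auto simp: nbrs_def)

lemma finite_nbrs [simp]: "finite (nbrs g)"
  using nbrs_subset finite_subset by blast

lemma nbrs_sym: "h \<in> nbrs g \<longleftrightarrow> g \<in> nbrs h"
  by (simp add: nbrs_def insert_commute)

lemma deg_less: "g \<in> {1..m} \<Longrightarrow> deg g < m"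
  using card_mono[OF _ nbrs_subset[of g]] by (auto simp: card_Diff_singleton_if)

lemma deg_in_le_deg: "deg_in E X g \<le> deg g"
  unfolding deg_in_nbrs by (rule card_mono) auto

lemma deg_in_le_card: "finite X \<Longrightarrow> deg_in E X g \<le> card X"
  unfolding deg_in_nbrs by (rule card_mono) auto

lemma m3: "n \<le> m" "3 \<le> m"
proof -
  have "E \<noteq> {}" using E1 by auto
  then have "0 < m" using graph by (auto simp: simple_graph_def)
  then show "n \<le> m" using n_dvd_m by (rule dvd_imp_le[rotated])
  then show "3 \<le> m" using n3 by simp
qed

lemma W_int: "4 * int m + 4 * int (card E) \<le> int W"
  using of_nat_mono[OF W, where 'a = int] by simp

lemma length_es: "length es = card E"
  using edges by (simp add: edge_list_def)

text \<open>The list is exactly as long as the edge set is large, which leaves no slack for a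
  repeated entry or for an edge listed in both orientations.\<close>

lemma edges_inj: "inj_on (\<lambda>(a, b). {a, b}) (set es)" "distinct es"
proof -
  have "card E \<le> card (set es)"
    using edges card_image_le[of "set es" "\<lambda>(a, b). {a, b}"] by (auto simp: edge_list_def)
  moreover have "card (set es) \<le> length es" by (rule card_length)
  ultimately have "card (set es) = length es" "card (set es) = card E" using length_es by auto
  then show "distinct es" "inj_on (\<lambda>(a, b). {a, b}) (set es)"
    using edges by (auto simp: card_distinct edge_list_def intro: eq_card_imp_inj_on)
qed

text \<open>The sum counts incident pairs (g, h) with g in S, and each listed edge accounts for at
  most two of them, one per orientation.\<close>

lemma sum_deg:
  assumes "finite S"
  shows "(\<Sum>g\<in>S. deg g) \<le> 2 * card E"
proof -
  have "(\<Sum>g\<in>S. deg g) = card (SIGMA g:S. nbrs g)" using assms by simp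
  also have "\<dots> \<le> card (\<Union>p\<in>set es. {(fst p, snd p), (snd p, fst p)})"
  proof (rule card_mono)
    show "(SIGMA g:S. nbrs g) \<subseteq> (\<Union>p\<in>set es. {(fst p, snd p), (snd p, fst p)})"
    proof safe
      fix g h assume "h \<in> nbrs g"
      then have "{g, h} \<in> (\<lambda>(a, b). {a, b}) ` set es"
        using edges by (simp add: nbrs_def edge_list_def)
      then show "(g, h) \<in> (\<Union>p\<in>set es. {(fst p, snd p), (snd p, fst p)})"
        by (fastforce simp: doubleton_eq_iff)
    qed
  qed auto
  also have "\<dots> \<le> (\<Sum>p\<in>set es. card {(fst p, snd p), (snd p, fst p)})" by (rule card_UN_le) simp
  also have "\<dots> \<le> (\<Sum>p\<in>set es. 2)" by (rule sum_mono) (simp add: card_insert_if)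
  also have "\<dots> = 2 * card E" using edges_inj(2) by (simp add: distinct_card length_es)
  finally show ?thesis .
qed

section \<open>Adjacency lists from the edge list\<close>

definition adj_ok :: "store \<Rightarrow> bool" where
  "adj_ok s \<longleftrightarrow> (\<forall>g\<in>{1..m}. enum (\<lambda>j. itab s ''adj'' [int g, j]) (itab s ''deg'' [int g]) (nbrs g))"

lemma adj_ok_deg: "adj_ok s \<Longrightarrow> g \<in> {1..m} \<Longrightarrow> itab s ''deg'' [int g] = int (deg g)"
  unfolding adj_ok_def using enum_card(2) by blast

definition adj_inv :: "nat \<Rightarrow> store \<Rightarrow> bool" where
  "adj_inv k s \<longleftrightarrow> itab s ''i'' [] = int k \<and> itab s ''e'' [] = int (card E) \<and>
    (\<forall>k<card E. itab s ''edge'' [int k, 0] = int (fst (es ! k)) \<and>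
                itab s ''edge'' [int k, 1] = int (snd (es ! k))) \<and>
    (\<forall>g\<in>{1..m}. enum (\<lambda>j. itab s ''adj'' [int g, j]) (itab s ''deg'' [int g])
      {h. {g, h} \<in> (\<lambda>(a, b). {a, b}) ` set (take k es)})"

lemma adj_step:
  assumes k: "k < card E" and "adj_inv k s"
  shows "vc W adj_body (adj_inv (Suc k)) s"
proof -
  have i: "itab s ''i'' [] = int k" and e: "itab s ''e'' [] = int (card E)"
    and ed: "\<And>k. k < card E \<Longrightarrow> itab s ''edge'' [int k, 0] = int (fst (es ! k))"
      "\<And>k. k < card E \<Longrightarrow> itab s ''edge'' [int k, 1] = int (snd (es ! k))"
    and inv: "\<And>g. g \<in> {1..m} \<Longrightarrow> enum (\<lambda>j. itab s ''adj'' [int g, j]) (itab s ''deg'' [int g])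
      {h. {g, h} \<in> (\<lambda>(a, b). {a, b}) ` set (take k es)}"
    using assms(2) unfolding adj_inv_def by blast+
  define a b where ab: "a = fst (es ! k)" "b = snd (es ! k)"
  define E' where "E' = (\<lambda>(a, b). {a, b}) ` set (take k es)"
  have ek: "es ! k \<in> set es" using k length_es by simp
  then have abE: "{a, b} \<in> E" using edges by (force simp: edge_list_def ab split: prod.splits)
  from edgeD[OF this] have abm: "a \<in> {1..m}" "b \<in> {1..m}" "a \<noteq> b" by auto
  \<comment> \<open>The k-th edge has not occurred before in either orientation, so both pushes add
    a genuinely new neighbour.\<close>
  have new: "{a, b} \<notin> E'"
  proof
    assume "{a, b} \<in> E'"
    then obtain p where p: "p \<in> set (take k es)" "{a, b} = (\<lambda>(a, b). {a, b}) p" by (auto simp: E'_def)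
    have "p = es ! k"
      by (rule inj_onD[OF edges_inj(1) _ in_set_takeD[OF p(1)] ek])
        (use p(2) in \<open>simp add: ab case_prod_beta\<close>)
    with p(1) obtain i where "i < k" "es ! i = es ! k" using k length_es by (auto simp: in_set_conv_nth)
    then show False using edges_inj(2) k length_es by (simp add: nth_eq_iff_index_eq)
  qed
  have take: "(\<lambda>(a, b). {a, b}) ` set (take (Suc k) es) = insert {a, b} E'"
    using k length_es by (simp add: take_Suc_conv_app_nth ab E'_def split: prod.splits)
  have N: "{h. {g, h} \<in> insert {a, b} E'} =
     (if g = a then insert b {h. {g, h} \<in> E'} else if g = b then insert a {h. {g, h} \<in> E'} else {h. {g, h} \<in> E'})" for g
    using abm(3) by (auto simp: doubleton_eq_iff)
  note inv = inv[folded E'_def]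
  have "E' \<subseteq> E" using edges set_take_subset[of k es] by (auto simp: edge_list_def E'_def)
  have sub: "card {h. {g, h} \<in> E'} < m" if "g \<in> {1..m}" for g
  proof -
    have "{h. {g, h} \<in> E'} \<subseteq> nbrs g" using \<open>E' \<subseteq> E\<close> by (auto simp: nbrs_def)
    then have "card {h. {g, h} \<in> E'} \<le> deg g" by (intro card_mono) auto
    then show ?thesis using deg_less[OF that] by simp
  qed
  have dg: "itab s ''deg'' [int g] = int (card {h. {g, h} \<in> E'})" if "g \<in> {1..m}" for g
    using enum_card(2)[OF inv[OF that]] .
  have bnds: "int k + 1 \<le> int W" "int a \<le> int W" "int b \<le> int W" using k W abm by auto
  have degs: "\<bar>itab s ''deg'' [int g] + 1\<bar> \<le> int W" if "g \<in> {1..m}" for g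
    using dg[OF that] sub[OF that] W by auto
  have a: "enum (\<lambda>j. if j = itab s ''deg'' [int a] then int b else itab s ''adj'' [int a, j]) (itab s ''deg'' [int a] + 1)
     (insert b {h. {a, h} \<in> E'})"
    by (rule enum_push[OF inv[OF abm(1)]]) (use new in auto)
  have b: "enum (\<lambda>j. if j = itab s ''deg'' [int b] then int a else itab s ''adj'' [int b, j]) (itab s ''deg'' [int b] + 1)
     (insert a {h. {b, h} \<in> E'})"
    by (rule enum_push[OF inv[OF abm(2)]]) (use new in \<open>auto simp: insert_commute\<close>)
  show ?thesis
    unfolding adj_body_def adj_inv_def take N using abm(3) a b inv bnds degs[OF abm(1)] degs[OF abm(2)]
    by (simp add: i ed[OF k] ab [symmetric] e ed cong: if_cong)
qed

lemma adj_prog_correct: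
  assumes "s = input n m v es"
  shows "wp W adj_prog (\<lambda>N s'. adj_ok s' \<and> N \<le> card E) s"
  unfolding adj_prog_def
proof (rule wp_Seq, rule wp_straight, simp, rule wp_mono[OF wp_for[where I = adj_inv and K = "card E"]])
  show "adj_inv 0 (iupdate ''i'' [] 0 s)"
    using length_es by (auto simp: adj_inv_def assms input_def)
  show "vc W adj_body (adj_inv (Suc k)) s" if "k < card E" "adj_inv k s" for k s
    using adj_step that .
  fix N s' assume "adj_inv (card E) s' \<and> N \<le> card E"
  then show "adj_ok s' \<and> N \<le> card E"
    using edges by (auto simp: adj_ok_def nbrs_def edge_list_def adj_inv_def length_es [symmetric])
qed (simp add: adj_inv_def)

section \<open>Bucket sort by degree\<close>

definition fill_inv :: "nat \<Rightarrow> store \<Rightarrow> bool" where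
  "fill_inv k s \<longleftrightarrow> itab s ''x'' [] = int (Suc k) \<and> itab s ''m'' [] = int m \<and>
    (\<forall>g\<in>{1..m}. itab s ''deg'' [int g] = int (deg g)) \<and>
    (\<forall>d. enum (\<lambda>j. itab s ''sb'' [d, j]) (itab s ''sn'' [d]) {g \<in> {1..k}. int (deg g) = d})"

lemma fill_step:
  assumes k: "k < m" and "fill_inv k s"
  shows "vc W fill_body (fill_inv (Suc k)) s"
proof -
  have x: "itab s ''x'' [] = int (Suc k)" "itab s ''m'' [] = int m"
    and dg: "\<And>g. g \<in> {1..m} \<Longrightarrow> itab s ''deg'' [int g] = int (deg g)"
    and en: "\<And>d. enum (\<lambda>j. itab s ''sb'' [d, j]) (itab s ''sn'' [d]) {g \<in> {1..k}. int (deg g) = d}"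
    using assms(2) unfolding fill_inv_def by blast+
  have dx: "itab s ''deg'' [int (Suc k)] = int (deg (Suc k))" using dg[of "Suc k"] k by simp
  have sn: "\<bar>itab s ''sn'' [d] + 1\<bar> \<le> int W" for d
  proof -
    have "card {g \<in> {1..k}. int (deg g) = d} \<le> card {1..k}" by (rule card_mono) auto
    then show ?thesis using enum_card(2)[OF en[of d]] k W by auto
  qed
  have N: "{g \<in> {1..Suc k}. int (deg g) = d} =
     (if d = int (deg (Suc k)) then insert (Suc k) {g \<in> {1..k}. int (deg g) = d} else {g \<in> {1..k}. int (deg g) = d})" for d
    by (auto simp: le_Suc_eq)
  let ?d = "int (deg (Suc k))"
  have "enum (\<lambda>j. if j = itab s ''sn'' [?d] then int (Suc k) else itab s ''sb'' [?d, j]) (itab s ''sn'' [?d] + 1)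
     (insert (Suc k) {g \<in> {1..k}. int (deg g) = ?d})"
    by (rule enum_push[OF en]) auto
  then show ?thesis
    unfolding fill_body_def fill_inv_def N using x dx dg en sn k W by (simp add: cong: if_cong)
qed

definition ord_ok :: "store \<Rightarrow> bool" where
  "ord_ok s \<longleftrightarrow> enum (\<lambda>j. itab s ''ord'' [j]) (int m) {1..m} \<and>
    (\<forall>i j g h. 0 \<le> i \<longrightarrow> i < j \<longrightarrow> j < int m \<longrightarrow> itab s ''ord'' [i] = int g \<longrightarrow>
      itab s ''ord'' [j] = int h \<longrightarrow> deg h \<le> deg g)"

text \<open>y is the degree class being emptied. Goods already output have degree at least y and the
  others at most y, so the output stays sorted whatever is appended next.\<close>

definition sort_inv :: "nat \<Rightarrow> nat \<Rightarrow> nat set \<Rightarrow> store \<Rightarrow> bool" where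
  "sort_inv p y S s \<longleftrightarrow> itab s ''pos'' [] = int p \<and> itab s ''y'' [] = int y \<and> itab s ''m'' [] = int m \<and>
    p \<le> m \<and> y \<le> m \<and> S \<subseteq> {1..m} \<and> enum (\<lambda>j. itab s ''ord'' [j]) (int p) S \<and>
    (\<forall>d. enum (\<lambda>j. itab s ''sb'' [d, j]) (itab s ''sn'' [d]) {g \<in> {1..m} - S. int (deg g) = d}) \<and>
    (\<forall>g\<in>S. y \<le> deg g) \<and> (\<forall>g\<in>{1..m} - S. deg g \<le> y) \<and>
    (\<forall>i j g h. 0 \<le> i \<longrightarrow> i < j \<longrightarrow> j < int p \<longrightarrow> itab s ''ord'' [i] = int g \<longrightarrow>
      itab s ''ord'' [j] = int h \<longrightarrow> deg h \<le> deg g)"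

text \<open>Either a good is output or y goes down, and m - p + y falls in both cases. In the second
  case some good is left and has degree below y, so y is positive and the decrement does not pass
  0.\<close>

lemma sort_step:
  assumes p: "p < m" and inv: "sort_inv p y S s"
  shows "vc W sort_body (\<lambda>s'. (\<exists>S'. sort_inv (Suc p) y S' s') \<or> (\<exists>y'. y = Suc y' \<and> sort_inv p y' S s')) s"
proof -
  have x: "itab s ''pos'' [] = int p" "itab s ''y'' [] = int y" "itab s ''m'' [] = int m"
    and S: "S \<subseteq> {1..m}" "y \<le> m" and ord: "enum (\<lambda>j. itab s ''ord'' [j]) (int p) S"
    and en: "\<And>d. enum (\<lambda>j. itab s ''sb'' [d, j]) (itab s ''sn'' [d]) {g \<in> {1..m} - S. int (deg g) = d}"
    and ge: "\<And>g. g \<in> S \<Longrightarrow> y \<le> deg g" and le: "\<And>g. g \<in> {1..m} - S \<Longrightarrow> deg g \<le> y"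
    and sorted: "\<And>i j g h. 0 \<le> i \<Longrightarrow> i < j \<Longrightarrow> j < int p \<Longrightarrow> itab s ''ord'' [i] = int g \<Longrightarrow>
      itab s ''ord'' [j] = int h \<Longrightarrow> deg h \<le> deg g"
    using inv unfolding sort_inv_def by blast+
  show ?thesis
  proof (cases "0 < itab s ''sn'' [int y]")
    case True
    let ?N = "itab s ''sn'' [int y] - 1"
    obtain x where x': "x \<in> {g \<in> {1..m} - S. int (deg g) = int y}" "itab s ''sb'' [int y, ?N] = int x"
      "enum (\<lambda>j. itab s ''sb'' [int y, j]) ?N ({g \<in> {1..m} - S. int (deg g) = int y} - {x})"
      using enum_pop[OF en True] .
    have "card {g \<in> {1..m} - S. int (deg g) = int y} \<le> card {1..m}" by (rule card_mono) auto
    then have bnd: "\<bar>?N\<bar> \<le> int W" "int x \<le> int W" "\<bar>int p + 1\<bar> \<le> int W"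
      using enum_card(2)[OF en[of "int y"]] W True x'(1) p by auto
    have ordx: "enum (\<lambda>j. if j = int p then int x else itab s ''ord'' [j]) (int p + 1) (insert x S)"
      by (rule enum_push[OF ord]) (use x' in auto)
    have E1: "{g \<in> {1..m} - insert x S. int (deg g) = d} =
       (if d = int y then {g \<in> {1..m} - S. int (deg g) = int y} - {x} else {g \<in> {1..m} - S. int (deg g) = d})" for d
      using x'(1) by auto
    have sorted': "deg h \<le> deg g" if "0 \<le> i" "i < j" "j < int p + 1"
      "(if i = int p then int x else itab s ''ord'' [i]) = int g"
      "(if j = int p then int x else itab s ''ord'' [j]) = int h" for i j g h
    proof (cases "j = int p")
      case True
      then have "g \<in> S" using enum_mem[OF ord that(1)] that by auto
      then show ?thesis using ge[of g] x'(1) True that by auto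
    next
      case False
      then show ?thesis using sorted[of i j g h] that by auto
    qed
    have "vc W sort_body (sort_inv (Suc p) y (insert x S)) s"
      unfolding sort_body_def sort_inv_def E1 using x True bnd x' ordx en ge le p S
      by (auto simp: add.commute cong: if_cong intro: sorted')
    then show ?thesis by (rule vc_mono) blast
  next
    case False
    have "itab s ''sn'' [int y] = 0" using False en[of "int y"] by (auto simp: enum_def)
    then have "{g \<in> {1..m} - S. int (deg g) = int y} = {}" using en[of "int y"] by simp
    then have less: "deg g < y" if "g \<in> {1..m} - S" for g using le[OF that] that by fastforce
    have "card S = p" using enum_card(2)[OF ord] by simp
    then have "{1..m} - S \<noteq> {}"
      using p by (metis Diff_eq_empty_iff S(1) card_atLeastAtMost diff_Suc_1 less_irrefl subset_antisym)
    then obtain g where "g \<in> {1..m} - S" by blast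
    then obtain y' where y': "y = Suc y'" using less by (metis gr_implies_not0 not0_implies_Suc)
    have ge': "y' \<le> deg g" if "g \<in> S" for g using ge[OF that] y' by simp
    have less: "deg g \<le> y'" if "g \<in> {1..m} - S" for g using less[OF that] y' by simp
    have "vc W sort_body (sort_inv p y' S) s"
      unfolding sort_body_def sort_inv_def
      using x False en p S ord W less ge' by (auto simp: y' intro: sorted)
    then show ?thesis using y' by (elim vc_mono) blast
  qed
qed

lemma sort_prog_correct:
  assumes "adj_ok s" and m: "itab s ''m'' [] = int m" and sn: "\<And>d. itab s ''sn'' [d] = 0"
  shows "wp W sort_prog (\<lambda>N s'. ord_ok s' \<and> N \<le> 3 * m) s"
proof -
  have fill: "wp W (While (ile (V ''x'') (V ''m'')) fill_body) (\<lambda>N s'. fill_inv m s' \<and> N \<le> m)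
    (iupdate ''x'' [] 1 s)"
  proof (rule wp_for[where I = fill_inv])
    show "fill_inv 0 (iupdate ''x'' [] 1 s)"
      using adj_ok_deg[OF assms(1)] m sn by (simp add: fill_inv_def)
    show "vc W fill_body (fill_inv (Suc k)) s" if "k < m" "fill_inv k s" for k s
      using fill_step that .
  qed (auto simp: fill_inv_def)
  let ?I = "\<lambda>\<phi> (s :: store). \<exists>p y S. \<phi> = m - p + y \<and> sort_inv p y S s"
  have loop: "wp W (While (ILess (V ''pos'') (V ''m'')) sort_body)
    (\<lambda>N s'. \<exists>\<phi>'. ?I \<phi>' s' \<and> \<not> bval s' (ILess (V ''pos'') (V ''m'')) \<and> \<phi>' + N \<le> m + m) s0"
    if "?I (m + m) s0" for s0
  proof (rule wp_While[where I = ?I, OF that])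
    fix \<phi> s assume "?I \<phi> s" and b: "bval s (ILess (V ''pos'') (V ''m''))"
    then obtain p y S where *: "\<phi> = m - p + y" "sort_inv p y S s" by blast
    then have p: "p < m" using b by (simp add: sort_inv_def)
    show "wp W sort_body (\<lambda>N s'. \<exists>\<phi>'. ?I \<phi>' s' \<and> \<phi>' + N + 1 \<le> \<phi>) s"
    proof (rule wp_mono[OF wp_vc[OF sort_step[OF p *(2)]]], elim conjE disjE exE)
      fix N s' S' assume h: "N = (0::nat)" "sort_inv (Suc p) y S' s'"
      show "\<exists>\<phi>'. ?I \<phi>' s' \<and> \<phi>' + N + 1 \<le> \<phi>"
        by (rule exI[of _ "m - Suc p + y"], rule conjI, rule exI[of _ "Suc p"], rule exI[of _ y])
          (use h * p in auto)
    next
      fix N s' y' assume h: "N = (0::nat)" "y = Suc y'" "sort_inv p y' S s'"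
      show "\<exists>\<phi>'. ?I \<phi>' s' \<and> \<phi>' + N + 1 \<le> \<phi>"
        by (rule exI[of _ "m - p + y'"], rule conjI, rule exI[of _ p], rule exI[of _ y'])
          (use h * p in auto)
    qed
  qed
  show ?thesis
    unfolding sort_prog_def
  proof (rule wp_Set_Seq)
    show "\<bar>ival s (IConst 1)\<bar> \<le> int W" using W m3 by simp
    show "wp W (While (ile (V ''x'') (V ''m'')) fill_body ;;
      ''y'' ::= V ''m'' ;; ''pos'' ::= IConst 0 ;; While (ILess (V ''pos'') (V ''m'')) sort_body)
      (\<lambda>N s'. ord_ok s' \<and> N \<le> 3 * m) (iupdate ''x'' (map (ival s) []) (ival s (IConst 1)) s)"
      unfolding list.map ival.simps
    proof (rule wp_SeqI[OF fill])
      fix N s' assume f: "fill_inv m s' \<and> N \<le> m"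
      then have m': "itab s' ''m'' [] = int m" by (simp add: fill_inv_def)
      let ?s = "iupdate ''pos'' [] 0 (iupdate ''y'' [] (itab s' ''m'' []) s')"
      have "sort_inv 0 m {} ?s"
        using f deg_less unfolding sort_inv_def fill_inv_def by (force simp: less_imp_le)
      then have I: "?I (m + m) ?s" by force
      have "wp W (While (ILess (V ''pos'') (V ''m'')) sort_body) (\<lambda>N' s'. ord_ok s' \<and> N + N' \<le> 3 * m) ?s"
      proof (rule wp_mono[OF loop[OF I]], elim exE conjE)
        fix N' s2 \<phi> p y S
        assume *: "\<not> bval s2 (ILess (V ''pos'') (V ''m''))" "\<phi> + N' \<le> m + m" "sort_inv p y S s2"
        then have p: "p = m" by (simp add: sort_inv_def)
        then have "S = {1..m}"
          using *(3) enum_card(2)[of _ "int m" S] unfolding sort_inv_def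
          by (intro card_subset_eq) auto
        then show "ord_ok s2 \<and> N + N' \<le> 3 * m"
          using *(2,3) f p unfolding ord_ok_def sort_inv_def by auto
      qed
      then show "wp W (''y'' ::= V ''m'' ;; ''pos'' ::= IConst 0 ;; While (ILess (V ''pos'') (V ''m'')) sort_body)
        (\<lambda>N' s'. ord_ok s' \<and> N + N' \<le> 3 * m) s'"
        by (intro wp_Set_Seq) (use W in \<open>simp_all add: m'\<close>)
    qed
  qed
qed

section \<open>The rounded-up root and the finest grid\<close>

definition rt :: nat where "rt = nat \<lceil>sqrt (real (card E))\<rceil>"

text \<open>The exponent of the finest grid. For a positive number k of outstanding rounds, q is at
  most k and hence at most m, so a dyadic grid with at least m intervals refines every grid that
  occurs.\<close>

definition lgQ :: nat where "lgQ = (LEAST a. m \<le> 2 ^ a)"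

text \<open>Characterises the rounded-up root by integer squares, which is the test that the search
  loop of \<open>const_prog\<close> performs.\<close>

lemma rt_less_iff: "k < rt \<longleftrightarrow> k * k < card E"
proof -
  have "k < rt \<longleftrightarrow> real k < sqrt (real (card E))"
    unfolding rt_def by (simp add: zless_nat_eq_int_zless less_ceiling_iff)
  also have "\<dots> \<longleftrightarrow> (real k)\<^sup>2 < real (card E)"
    by (metis of_nat_0_le_iff real_sqrt_less_iff real_sqrt_abs abs_of_nonneg)
  also have "\<dots> \<longleftrightarrow> k * k < card E"
    by (metis of_nat_less_iff of_nat_mult power2_eq_square)
  finally show ?thesis .
qed

lemma rt_bounds: "1 \<le> rt" "rt \<le> card E" "sqrt (card E) \<le> real rt" "real_of_int \<lceil>sqrt (real (card E))\<rceil> = real rt"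
proof -
  show "1 \<le> rt" using rt_less_iff[of 0] E1 by auto
  show "rt \<le> card E" using rt_less_iff[of "card E"] E1 by (metis le_square linorder_not_less)
  show "sqrt (card E) \<le> real rt" unfolding rt_def by (rule real_nat_ceiling_ge)
  show "real_of_int \<lceil>sqrt (real (card E))\<rceil> = real rt" unfolding rt_def by simp
qed

lemma lgQ_bounds: "m \<le> 2 ^ lgQ" "2 ^ lgQ < 2 * m" "lgQ \<le> m" "k < lgQ \<longleftrightarrow> 2 ^ k < m"
proof -
  have m: "m \<le> 2 ^ m" by (rule less_imp_le) simp
  show 1: "m \<le> 2 ^ lgQ" unfolding lgQ_def by (rule LeastI[of "\<lambda>a. m \<le> 2 ^ a"]) (rule m)
  show "lgQ \<le> m" unfolding lgQ_def by (rule Least_le) (rule m)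
  show less: "k < lgQ \<longleftrightarrow> 2 ^ k < m" for k
  proof
    show "2 ^ k < m" if "k < lgQ" using that not_less_Least unfolding lgQ_def by (metis linorder_not_less)
    show "k < lgQ" if "2 ^ k < m"
      using that 1 by (metis linorder_not_less order.strict_trans2 order.trans power_increasing one_le_numeral)
  qed
  show "2 ^ lgQ < 2 * m"
  proof (cases lgQ)
    case 0
    then show ?thesis using m3 by simp
  next
    case (Suc k)
    then have "2 ^ k < m" using less[of k] by simp
    then show ?thesis by (simp add: Suc)
  qed
qed

lemma const_prog_correct:
  assumes "itab s ''m'' [] = int m" "itab s ''e'' [] = int (card E)"
  shows "wp W const_prog (\<lambda>N s'. itab s' ''r'' [] = int rt \<and> itab s' ''Q'' [] = 2 ^ lgQ \<and>
    N \<le> card E + m) s"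
proof -
  let ?b = "ILess (IMul (V ''r'') (V ''r'')) (V ''e'')" and ?c = "ILess (V ''Q'') (V ''m'')"
  let ?I = "\<lambda>k (s :: store). itab s ''r'' [] = int k \<and> itab s ''e'' [] = int (card E) \<and> itab s ''m'' [] = int m"
  let ?J = "\<lambda>k (s :: store). itab s ''r'' [] = int rt \<and> itab s ''Q'' [] = 2 ^ k \<and> itab s ''m'' [] = int m"
  have 1: "wp W (While ?b (incr ''r'' [])) (\<lambda>N s'. ?I rt s' \<and> N \<le> rt) (iupdate ''r'' [] 0 s)"
  proof (rule wp_for[where I = ?I])
    show "?I k s \<Longrightarrow> bval s ?b \<longleftrightarrow> k < rt" for k s
      unfolding rt_less_iff by (simp flip: of_nat_mult)
    show "vc W (incr ''r'' []) (?I (Suc k)) s" if "k < rt" "?I k s" for k s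
      using that rt_bounds W by auto
  qed (use assms in auto)
  have 2: "wp W (While ?c (''Q'' ::= IMul (V ''Q'') (IConst 2))) (\<lambda>N s'. ?J lgQ s' \<and> N \<le> lgQ) s'"
    if "?J 0 s'" for s'
  proof (rule wp_for[where I = ?J, OF that])
    have pow: "(2::int) ^ k < int m \<longleftrightarrow> 2 ^ k < m" for k by (metis of_nat_less_iff of_nat_numeral of_nat_power)
    show "?J k s \<Longrightarrow> bval s ?c \<longleftrightarrow> k < lgQ" for k s unfolding lgQ_bounds(4) by (simp add: pow)
    show "vc W (''Q'' ::= IMul (V ''Q'') (IConst 2)) (?J (Suc k)) s" if "k < lgQ" "?J k s" for k s
    proof -
      have "(2::int) ^ k < int m" using that(1) by (simp add: lgQ_bounds pow)
      then have "2 ^ k * 2 \<le> int W" using W_int by linarith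
      then show ?thesis using that by simp
    qed
  qed
  show ?thesis
    unfolding const_prog_def
  proof (rule wp_Set_Seq)
    show "wp W (While ?b (incr ''r'' []) ;; ''Q'' ::= IConst 1 ;; While ?c (''Q'' ::= IMul (V ''Q'') (IConst 2)))
      (\<lambda>N s'. itab s' ''r'' [] = int rt \<and> itab s' ''Q'' [] = 2 ^ lgQ \<and> N \<le> card E + m)
      (iupdate ''r'' (map (ival s) []) (ival s (IConst 0)) s)"
      unfolding list.map ival.simps
    proof (rule wp_SeqI[OF 1], rule wp_Set_Seq)
      fix N s' assume I: "?I rt s' \<and> N \<le> rt"
      show "\<bar>ival s' (IConst 1)\<bar> \<le> int W" using W m3 by simp
      show "wp W (While ?c (''Q'' ::= IMul (V ''Q'') (IConst 2)))
        (\<lambda>N' s'. itab s' ''r'' [] = int rt \<and> itab s' ''Q'' [] = 2 ^ lgQ \<and> N + N' \<le> card E + m)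
        (iupdate ''Q'' (map (ival s') []) (ival s' (IConst 1)) s')"
        by (rule wp_mono[OF 2]) (use I rt_bounds lgQ_bounds in auto)
    qed
  qed simp
qed

section \<open>The table of pieces\<close>

definition pieces_ok :: "store \<Rightarrow> int \<Rightarrow> real \<Rightarrow> bool" where
  "pieces_ok s kd \<Delta> \<longleftrightarrow> (\<forall>x. \<bar>real_of_int x\<bar> \<le> \<Delta> \<longrightarrow>
    (\<exists>T<2 ^ lgQ. itab s ''pt'' [kd, x] = int T \<and> real_of_int x \<in> piece \<Delta> (2 ^ lgQ) T))"

text \<open>The sweep merges two increasing sequences, the integers x and the interval bounds, so T
  never moves back. The alternative T = 0 covers the start at -2 * \<open>rt\<close>, which may lie
  to the left of -\<Delta> and thus of interval 0. P holds the old table, so that a second sweep is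
  known to spare the entries of the first.\<close>

definition sweep_inv :: "int \<Rightarrow> real \<Rightarrow> (int list \<Rightarrow> int) \<Rightarrow> nat \<Rightarrow> int \<Rightarrow> store \<Rightarrow> bool" where
  "sweep_inv kd \<Delta> P T x s \<longleftrightarrow> itab s ''r'' [] = int rt \<and> itab s ''Q'' [] = 2 ^ lgQ \<and>
    itab s ''e'' [] = int (card E) \<and> itab s ''t'' [] = int T \<and> itab s ''x'' [] = x \<and> T < 2 ^ lgQ \<and>
    - 2 * int rt \<le> x \<and> x \<le> 2 * int rt + 1 \<and>
    (T = 0 \<or> - \<Delta> + 2 * \<Delta> * real T / 2 ^ lgQ \<le> x) \<and>
    (\<forall>y. - 2 * int rt \<le> y \<longrightarrow> y < x \<longrightarrow> \<bar>real_of_int y\<bar> \<le> \<Delta> \<longrightarrow>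
      (\<exists>T<2 ^ lgQ. itab s ''pt'' [kd, y] = int T \<and> real_of_int y \<in> piece \<Delta> (2 ^ lgQ) T)) \<and>
    (\<forall>kd' y. kd' \<noteq> kd \<longrightarrow> itab s ''pt'' [kd', y] = P [kd', y])"

lemma sweep_step:
  assumes inv: "sweep_inv kd \<Delta> P T x s" and x: "x \<le> 2 * int rt"
    and F: "0 \<le> ival s F" "sqrt (real_of_int (ival s F)) = real n * \<Delta>"
  shows "vc W (sweep_body n kd F) (\<lambda>s'. sweep_inv kd \<Delta> P (Suc T) x s' \<or> sweep_inv kd \<Delta> P T (x + 1) s') s"
proof -
  let ?Q = "2 ^ lgQ :: nat"
  have i: "itab s ''r'' [] = int rt" "itab s ''Q'' [] = 2 ^ lgQ" "itab s ''e'' [] = int (card E)"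
    "itab s ''t'' [] = int T" "itab s ''x'' [] = x" "T < ?Q" "- 2 * int rt \<le> x"
    and low: "T = 0 \<or> - \<Delta> + 2 * \<Delta> * real T / 2 ^ lgQ \<le> x"
    and old: "\<And>y. - 2 * int rt \<le> y \<Longrightarrow> y < x \<Longrightarrow> \<bar>real_of_int y\<bar> \<le> \<Delta> \<Longrightarrow>
      (\<exists>T<2 ^ lgQ. itab s ''pt'' [kd, y] = int T \<and> real_of_int y \<in> piece \<Delta> (2 ^ lgQ) T)"
    and oth: "\<And>kd' y. kd' \<noteq> kd \<Longrightarrow> itab s ''pt'' [kd', y] = P [kd', y]"
    using inv unfolding sweep_inv_def by blast+
  have Qi: "int ?Q = 2 ^ lgQ" by simp
  have "int ?Q < int (2 * m)" using lgQ_bounds(2) by (simp only: of_nat_less_iff)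
  then have QW: "int ?Q \<le> int W" using W_int by linarith
  have bnd: "int T + 1 \<le> int W" "\<bar>x + 1\<bar> \<le> int W" "int T \<le> int W"
    using i(6) QW rt_bounds(1,2) x i(7) W_int m3 by linarith+
  \<comment> \<open>Multiplying the upper bound of interval T by n * Q clears the denominators, and
    n * \<Delta> is the root of the integer F.\<close>
  have test: "bval s (sqless (IMul (IConst (int n)) (IMul (V ''x'') (V ''Q''))) F
        (ISub (IMul (IConst 2) (IAdd (V ''t'') (IConst 1))) (V ''Q''))) \<longleftrightarrow>
     x < - \<Delta> + 2 * \<Delta> * real (Suc T) / 2 ^ lgQ" (is "?t \<longleftrightarrow> _")
  proof -
    have "?t \<longleftrightarrow> real n * (x * 2 ^ lgQ) < real n * (\<Delta> * (2 * (real T + 1) - 2 ^ lgQ))"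
      unfolding bval_sqless[OF F(1)] F(2) by (simp add: i algebra_simps)
    also have "\<dots> \<longleftrightarrow> x * 2 ^ lgQ < \<Delta> * (2 * (real T + 1) - 2 ^ lgQ)"
      using n3 by (simp add: mult_less_cancel_left_pos)
    also have "\<dots> \<longleftrightarrow> x < - \<Delta> + 2 * \<Delta> * real (Suc T) / 2 ^ lgQ"
      by (simp add: field_simps)
    finally show ?thesis .
  qed
  show ?thesis
  proof (cases "Suc T < ?Q \<and> \<not> ?t")
    case True
    then have "int T + 1 < 2 ^ lgQ" unfolding Qi [symmetric] by linarith
    then have "vc W (sweep_body n kd F) (sweep_inv kd \<Delta> P (Suc T) x) s"
      unfolding sweep_body_def using True
      by (simp add: i bnd) (use inv True test in \<open>auto simp: sweep_inv_def i\<close>)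
    then show ?thesis by (rule vc_mono) blast
  next
    case False
    then have cond: "\<not> (int T + 1 < 2 ^ lgQ \<and> \<not> ?t)" unfolding Qi [symmetric] by linarith
    \<comment> \<open>For the last interval no upper bound has been tested; it is closed on the
      right, so x \<le> \<Delta> is enough.\<close>
    have new: "real_of_int x \<in> piece \<Delta> ?Q T" if "\<bar>real_of_int x\<bar> \<le> \<Delta>"
      using that False test low i(6) by (auto simp: piece_def abs_le_iff)
    have up: "T = 0 \<or> - \<Delta> + 2 * \<Delta> * real T / 2 ^ lgQ \<le> real_of_int (x + 1)" using low by auto
    have all: "\<exists>T'<2 ^ lgQ. (if y = x then int T else itab s ''pt'' [kd, y]) = int T' \<and>
       real_of_int y \<in> piece \<Delta> (2 ^ lgQ) T'"
      if "- 2 * int rt \<le> y" "y < x + 1" "\<bar>real_of_int y\<bar> \<le> \<Delta>" for y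
      using that old[of y] new i(6) by (cases "y = x") auto
    have "vc W (sweep_body n kd F) (sweep_inv kd \<Delta> P T (x + 1)) s"
      unfolding sweep_body_def using cond i x bnd up all oth
      by (auto simp: sweep_inv_def)
    then show ?thesis by (rule vc_mono) blast
  qed
qed

lemma sweep_prog_correct:
  assumes "itab s ''r'' [] = int rt" "itab s ''Q'' [] = 2 ^ lgQ" "itab s ''e'' [] = int (card E)"
    and \<Delta>: "\<Delta> \<le> 2 * real rt"
    and F: "\<And>s :: store. itab s ''r'' [] = int rt \<Longrightarrow> itab s ''e'' [] = int (card E) \<Longrightarrow>
      0 \<le> ival s F \<and> sqrt (real_of_int (ival s F)) = real n * \<Delta>"
  shows "wp W (sweep_prog n kd F) (\<lambda>N s'. pieces_ok s' kd \<Delta> \<and>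
    (\<forall>kd' y. kd' \<noteq> kd \<longrightarrow> itab s' ''pt'' [kd', y] = itab s ''pt'' [kd', y]) \<and>
    N \<le> 2 * m + 4 * card E + 1) s"
proof -
  let ?b = "ile (V ''x'') (IMul (IConst 2) (V ''r''))"
  let ?I = "\<lambda>\<phi> (s' :: store). \<exists>T x. sweep_inv kd \<Delta> (itab s ''pt'') T x s' \<and>
    \<phi> = 2 ^ lgQ - T + nat (2 * int rt + 1 - x)"
  let ?s = "iupdate ''x'' [] (- 2 * int rt) (iupdate ''t'' [] 0 s)"
  have I: "?I (2 ^ lgQ + (4 * rt + 1)) ?s"
    using assms(1-3) by (intro exI[of _ 0] exI[of _ "- 2 * int rt"]) (auto simp: sweep_inv_def)
  have loop: "wp W (While ?b (sweep_body n kd F))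
    (\<lambda>N s'. \<exists>\<phi>'. ?I \<phi>' s' \<and> \<not> bval s' ?b \<and> \<phi>' + N \<le> 2 ^ lgQ + (4 * rt + 1)) ?s"
  proof (rule wp_While[where I = ?I, OF I])
    fix \<phi> s0 assume "?I \<phi> s0" and b: "bval s0 ?b"
    then obtain T x where *: "sweep_inv kd \<Delta> (itab s ''pt'') T x s0" "\<phi> = 2 ^ lgQ - T + nat (2 * int rt + 1 - x)"
      by blast
    then have x: "x \<le> 2 * int rt" "T < 2 ^ lgQ" using b by (simp_all add: sweep_inv_def)
    have F0: "0 \<le> ival s0 F" "sqrt (real_of_int (ival s0 F)) = real n * \<Delta>"
      using F[of s0] *(1) by (auto simp: sweep_inv_def)
    show "wp W (sweep_body n kd F) (\<lambda>N s'. \<exists>\<phi>'. ?I \<phi>' s' \<and> \<phi>' + N + 1 \<le> \<phi>) s0"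
    proof (rule wp_mono[OF wp_vc[OF sweep_step[OF *(1) x(1) F0]]], elim conjE disjE)
      fix N s' assume h: "N = (0::nat)" "sweep_inv kd \<Delta> (itab s ''pt'') (Suc T) x s'"
      show "\<exists>\<phi>'. ?I \<phi>' s' \<and> \<phi>' + N + 1 \<le> \<phi>"
        by (rule exI[of _ "2 ^ lgQ - Suc T + nat (2 * int rt + 1 - x)"], rule conjI,
            rule exI[of _ "Suc T"], rule exI[of _ x]) (use h * x in auto)
    next
      fix N s' assume h: "N = (0::nat)" "sweep_inv kd \<Delta> (itab s ''pt'') T (x + 1) s'"
      show "\<exists>\<phi>'. ?I \<phi>' s' \<and> \<phi>' + N + 1 \<le> \<phi>"
        by (rule exI[of _ "2 ^ lgQ - T + nat (2 * int rt + 1 - (x + 1))"], rule conjI,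
            rule exI[of _ T], rule exI[of _ "x + 1"]) (use h * x in auto)
    qed
  qed
  have "wp W (While ?b (sweep_body n kd F)) (\<lambda>N s'. pieces_ok s' kd \<Delta> \<and>
    (\<forall>kd' y. kd' \<noteq> kd \<longrightarrow> itab s' ''pt'' [kd', y] = itab s ''pt'' [kd', y]) \<and>
    N \<le> 2 * m + 4 * card E + 1) ?s"
  proof (rule wp_mono[OF loop], elim exE conjE)
    fix N s' \<phi> T x
    assume *: "\<not> bval s' ?b" "\<phi> + N \<le> 2 ^ lgQ + (4 * rt + 1)" "sweep_inv kd \<Delta> (itab s ''pt'') T x s'"
    then have x: "2 * int rt < x" by (simp add: sweep_inv_def)
    have "pieces_ok s' kd \<Delta>"
      unfolding pieces_ok_def
    proof (intro allI impI)
      fix y assume y: "\<bar>real_of_int y\<bar> \<le> \<Delta>"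
      then have "- (2 * real rt) \<le> real_of_int y" "real_of_int y \<le> 2 * real rt"
        using \<Delta> by (simp_all add: abs_le_iff)
      then have "- 2 * int rt \<le> y" "y < x" using x by linarith+
      then show "\<exists>T<2 ^ lgQ. itab s' ''pt'' [kd, y] = int T \<and> real_of_int y \<in> piece \<Delta> (2 ^ lgQ) T"
        using *(3) y unfolding sweep_inv_def by blast
    qed
    moreover have "N \<le> 2 * m + 4 * card E + 1" using *(2) lgQ_bounds(2) rt_bounds(2) by linarith
    ultimately show "pieces_ok s' kd \<Delta> \<and>
      (\<forall>kd' y. kd' \<noteq> kd \<longrightarrow> itab s' ''pt'' [kd', y] = itab s ''pt'' [kd', y]) \<and> N \<le> 2 * m + 4 * card E + 1"
      using *(3) unfolding sweep_inv_def by blast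
  qed
  then show ?thesis
    unfolding sweep_prog_def
    by (intro wp_Set_Seq) (use assms(1) rt_bounds(2) W_int in \<open>simp_all add: abs_mult\<close>)
qed

definition \<Delta>\<^sub>1 :: real where "\<Delta>\<^sub>1 = 2 * sqrt (card E) / n"

lemma pieces_prog_correct:
  assumes s: "itab s ''r'' [] = int rt" "itab s ''Q'' [] = 2 ^ lgQ" "itab s ''e'' [] = int (card E)"
  shows "wp W (pieces_prog n) (\<lambda>N s'. pieces_ok s' 0 (real rt) \<and> pieces_ok s' 1 \<Delta>\<^sub>1 \<and>
    N \<le> 4 * m + 8 * card E + 2) s"
proof -
  let ?F = "IMul (IConst (int n * int n)) (IMul (V ''r'') (V ''r''))" and ?G = "IMul (IConst 4) (V ''e'')"
  have F: "0 \<le> ival s ?F \<and> sqrt (real_of_int (ival s ?F)) = real n * real rt"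
    if "itab s ''r'' [] = int rt" for s :: store
    using that by (simp add: real_sqrt_mult)
  have G: "0 \<le> ival s ?G \<and> sqrt (real_of_int (ival s ?G)) = real n * \<Delta>\<^sub>1"
    if "itab s ''e'' [] = int (card E)" for s :: store
    using that n3 by (simp add: real_sqrt_mult \<Delta>\<^sub>1_def)
  \<comment> \<open>The sweep covers [-2 * \<open>rt\<close>, 2 * \<open>rt\<close>], which has to
    contain the interval of the later phases too.\<close>
  have "sqrt (card E) \<le> rt" using rt_bounds by simp
  then have "2 * sqrt (card E) \<le> (2 * real rt) * 1" by simp
  also have "\<dots> \<le> (2 * real rt) * real n" using n3 by (intro mult_left_mono) auto
  finally have D: "\<Delta>\<^sub>1 \<le> 2 * real rt" using n3 by (simp add: \<Delta>\<^sub>1_def field_simps)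
  show ?thesis
    unfolding pieces_prog_def
  proof (rule wp_SeqI[OF wp_frame[OF sweep_prog_correct[OF s, of "real rt" ?F]]])
    fix N s'
    assume *: "(pieces_ok s' 0 (real rt) \<and> (\<forall>kd' y. kd' \<noteq> 0 \<longrightarrow> itab s' ''pt'' [kd', y] = itab s ''pt'' [kd', y]) \<and>
      N \<le> 2 * m + 4 * card E + 1) \<and> framed (sweep_prog n 0 ?F) s s'"
    then have s': "itab s' ''r'' [] = int rt" "itab s' ''Q'' [] = 2 ^ lgQ" "itab s' ''e'' [] = int (card E)"
      using s by (simp_all add: framed_def sweep_prog_def sweep_body_def)
    show "wp W (sweep_prog n 1 ?G) (\<lambda>N' s'. pieces_ok s' 0 (real rt) \<and> pieces_ok s' 1 \<Delta>\<^sub>1 \<and>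
      N + N' \<le> 4 * m + 8 * card E + 2) s'"
      by (rule wp_mono[OF sweep_prog_correct[OF s' D]])
        (use * G in \<open>auto simp: pieces_ok_def\<close>)
  qed (use F in auto)
qed

end

section \<open>The program: a round\<close>

text \<open>Everything about the store on which the choice of a round depends: the ownership and,
  for each agent, the order of the bundle values and of the values of the n goods in
  \<open>gg\<close>. The number of tests depends on n only.\<close>

definition comparisons :: "nat \<Rightarrow> bexp list" where
  "comparisons n =
    [IEq (IGet ''sig'' [IConst (int i)]) (IConst (int b)). i \<leftarrow> [1..<Suc n], b \<leftarrow> [1..<Suc n]] @
    [RLess (RGet ''u'' [IConst (int i), IConst (int b)]) (RGet ''u'' [IConst (int i), IConst (int c)]).
      i \<leftarrow> [1..<Suc n], b \<leftarrow> [1..<Suc n], c \<leftarrow> [1..<Suc n]] @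
    [RLess (RGet ''v'' [IConst (int i), IGet ''gg'' [IConst (int x)]])
           (RGet ''v'' [IConst (int i), IGet ''gg'' [IConst (int y)]]).
      i \<leftarrow> [1..<Suc n], x \<leftarrow> [0..<n], y \<leftarrow> [0..<n]]"

text \<open>Depends on the outcomes of the equality tests alone. The default value i outside {1..n}
  makes it agree everywhere with the permutation stored in the table, not only on the
  agents.\<close>

definition sig_of :: "nat \<Rightarrow> store \<Rightarrow> nat \<Rightarrow> nat" where
  "sig_of n s i = (if i \<in> {1..n} \<and> (\<exists>b\<in>{1..n}. itab s ''sig'' [int i] = int b)
    then THE b. b \<in> {1..n} \<and> itab s ''sig'' [int i] = int b else i)"

definition lt_of :: "nat \<Rightarrow> store \<Rightarrow> nat \<Rightarrow> nat \<Rightarrow> nat \<Rightarrow> bool" where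
  "lt_of n s i b c \<longleftrightarrow> i \<in> {1..n} \<and> b \<in> {1..n} \<and> c \<in> {1..n} \<and>
     rtab s ''u'' [int i, int b] < rtab s ''u'' [int i, int c]"

definition pr_of :: "nat \<Rightarrow> store \<Rightarrow> nat \<Rightarrow> nat \<Rightarrow> nat \<Rightarrow> bool" where
  "pr_of n s i x y \<longleftrightarrow> i \<in> {1..n} \<and> x < n \<and> y < n \<and>
     rtab s ''v'' [int i, itab s ''gg'' [int x]] < rtab s ''v'' [int i, itab s ''gg'' [int y]]"

lemma comparisons_mem:
  "i \<in> {1..n} \<Longrightarrow> b \<in> {1..n} \<Longrightarrow>
    IEq (IGet ''sig'' [IConst (int i)]) (IConst (int b)) \<in> set (comparisons n)"
  "i \<in> {1..n} \<Longrightarrow> b \<in> {1..n} \<Longrightarrow> c \<in> {1..n} \<Longrightarrow>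
    RLess (RGet ''u'' [IConst (int i), IConst (int b)]) (RGet ''u'' [IConst (int i), IConst (int c)])
      \<in> set (comparisons n)"
  "i \<in> {1..n} \<Longrightarrow> x < n \<Longrightarrow> y < n \<Longrightarrow>
    RLess (RGet ''v'' [IConst (int i), IGet ''gg'' [IConst (int x)]])
          (RGet ''v'' [IConst (int i), IGet ''gg'' [IConst (int y)]]) \<in> set (comparisons n)"
proof -
  have mem2: "f i j \<in> set (concat (map (\<lambda>i. map (f i) ys) xs))"
    if "i \<in> set xs" "j \<in> set ys" for f :: "nat \<Rightarrow> nat \<Rightarrow> bexp" and i j xs ys
    using that by auto
  have mem3: "f i j k \<in> set (concat (map (\<lambda>i. concat (map (\<lambda>j. map (f i j) zs) ys)) xs))"
    if "i \<in> set xs" "j \<in> set ys" "k \<in> set zs" for f :: "nat \<Rightarrow> nat \<Rightarrow> nat \<Rightarrow> bexp" and i j k xs ys zs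
    using that by auto
  have n: "x \<in> set [1..<Suc n] \<longleftrightarrow> x \<in> {1..n}" for x by (auto simp del: upt_Suc)
  show "IEq (IGet ''sig'' [IConst (int i)]) (IConst (int b)) \<in> set (comparisons n)"
    if "i \<in> {1..n}" "b \<in> {1..n}"
    unfolding comparisons_def set_append using that by (intro UnI1 mem2) (simp_all only: n)
  show "RLess (RGet ''u'' [IConst (int i), IConst (int b)]) (RGet ''u'' [IConst (int i), IConst (int c)])
      \<in> set (comparisons n)" if "i \<in> {1..n}" "b \<in> {1..n}" "c \<in> {1..n}"
    unfolding comparisons_def set_append using that
    by (intro UnI2[OF UnI1] mem3[where f = "\<lambda>i b c. RLess (RGet ''u'' [IConst (int i), IConst (int b)]) (RGet ''u'' [IConst (int i), IConst (int c)])"])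
      (simp_all only: n)
  show "RLess (RGet ''v'' [IConst (int i), IGet ''gg'' [IConst (int x)]])
          (RGet ''v'' [IConst (int i), IGet ''gg'' [IConst (int y)]]) \<in> set (comparisons n)"
    if "i \<in> {1..n}" "x < n" "y < n"
    unfolding comparisons_def set_append using that
    by (intro UnI2 mem3[where f = "\<lambda>i x y. RLess (RGet ''v'' [IConst (int i), IGet ''gg'' [IConst (int x)]])
          (RGet ''v'' [IConst (int i), IGet ''gg'' [IConst (int y)]])"]) (simp_all only: n, simp_all)
qed

text \<open>This is what makes a leaf of the decision tree meaningful: stores with equal outcomes
  admit the same correct rounds.\<close>

lemma comparisons_determine:
  assumes "map (bval s) (comparisons n) = map (bval s') (comparisons n)"
  shows "sig_of n s = sig_of n s'" "lt_of n s = lt_of n s'" "pr_of n s = pr_of n s'"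
proof -
  have eq: "bval s b = bval s' b" if "b \<in> set (comparisons n)" for b
    using assms that by simp
  have "itab s ''sig'' [int i] = int b \<longleftrightarrow> itab s' ''sig'' [int i] = int b"
    if "i \<in> {1..n}" "b \<in> {1..n}" for i b
    using eq[OF comparisons_mem(1)[OF that]] by simp
  then show "sig_of n s = sig_of n s'"
    unfolding sig_of_def by (intro ext if_cong arg_cong[where f = The]) auto
  have "rtab s ''u'' [int i, int b] < rtab s ''u'' [int i, int c] \<longleftrightarrow>
      rtab s' ''u'' [int i, int b] < rtab s' ''u'' [int i, int c]"
    if "i \<in> {1..n}" "b \<in> {1..n}" "c \<in> {1..n}" for i b c
    using eq[OF comparisons_mem(2)[OF that]] by simp
  then show "lt_of n s = lt_of n s'" unfolding lt_of_def by (intro ext) blast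
  have "rtab s ''v'' [int i, itab s ''gg'' [int x]] < rtab s ''v'' [int i, itab s ''gg'' [int y]] \<longleftrightarrow>
      rtab s' ''v'' [int i, itab s' ''gg'' [int x]] < rtab s' ''v'' [int i, itab s' ''gg'' [int y]]"
    if "i \<in> {1..n}" "x < n" "y < n" for i x y
    using eq[OF comparisons_mem(3)[OF that]] by simp
  then show "pr_of n s = pr_of n s'" unfolding pr_of_def by (intro ext) blast
qed

text \<open>As \<open>n\<close> is a constant, envy-cycle elimination, the topological order and the picks need no
  algorithm: a decision tree over all relevant comparisons has, at each leaf, a fixed round that is
  correct for all stores reaching it.\<close>

definition chosen_round :: "nat \<Rightarrow> bool list \<Rightarrow> round" where
  "chosen_round n t = (SOME \<rho>. \<exists>s. map (bval s) (comparisons n) = t \<and>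
     round_choice n (lt_of n s) (pr_of n s) (sig_of n s) \<rho>)"

text \<open>The store hidden behind \<open>SOME\<close> need not be s, but it has the same outcomes
  as s, and these fix the condition on the round.\<close>

lemma chosen_round:
  assumes "round_choice n (lt_of n s) (pr_of n s) (sig_of n s) \<rho>"
  shows "round_choice n (lt_of n s) (pr_of n s) (sig_of n s) (chosen_round n (map (bval s) (comparisons n)))"
proof -
  let ?P = "\<lambda>\<rho>. \<exists>s'. map (bval s') (comparisons n) = map (bval s) (comparisons n) \<and>
     round_choice n (lt_of n s') (pr_of n s') (sig_of n s') \<rho>"
  have "?P \<rho>" using assms by blast
  then have "?P (chosen_round n (map (bval s) (comparisons n)))"
    unfolding chosen_round_def by (rule someI)
  then show ?thesis using comparisons_determine by metis
qed

definition sig_step :: "(nat \<Rightarrow> nat) \<Rightarrow> nat \<Rightarrow> com" where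
  "sig_step \<sigma>' i = ISet ''sig'' [IConst (int i)] (IConst (int (\<sigma>' i))) ;; Emit (IConst (int (\<sigma>' i)))"

definition u_step :: "nat \<Rightarrow> nat \<Rightarrow> nat \<Rightarrow> com" where
  "u_step b x i = RSet ''u'' [IConst (int i), IConst (int b)]
     (RAdd (RGet ''u'' [IConst (int i), IConst (int b)]) (RGet ''v'' [IConst (int i), IGet ''gg'' [IConst (int x)]]))"

definition pick_step :: "nat \<Rightarrow> (nat \<Rightarrow> nat) \<Rightarrow> (nat \<Rightarrow> nat) \<Rightarrow> nat \<Rightarrow> com" where
  "pick_step n \<beta> \<kappa> j =
    Emit (IGet ''gg'' [IConst (int (\<kappa> j))]) ;;
    ISet ''bun'' [IGet ''gg'' [IConst (int (\<kappa> j))]] (IConst (int (\<beta> j))) ;;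
    seqs (map (u_step (\<beta> j) (\<kappa> j)) [1..<Suc n])"

text \<open>Updates and output are interleaved in such a way that the three blocks emit ownership,
  order and picks in the sequence demanded by \<open>log_round\<close>.\<close>

fun apply_round :: "nat \<Rightarrow> round \<Rightarrow> com" where
  "apply_round n (\<sigma>', \<pi>, \<kappa>) =
    seqs (map (sig_step \<sigma>') [1..<Suc n]) ;;
    seqs (map (\<lambda>j. Emit (IConst (int (\<pi> j)))) [1..<Suc n]) ;;
    seqs (map (pick_step n (\<lambda>j. \<sigma>' (\<pi> j)) \<kappa>) [1..<Suc n])"

definition nbr_body :: "nat \<Rightarrow> com" where
  "nbr_body x =
    incr ''dg'' [IGet ''bun'' [IGet ''gg'' [IConst (int x)]], IGet ''adj'' [IGet ''gg'' [IConst (int x)], V ''h'']] ;;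
    incr ''h'' []"

definition nbr_loop :: "nat \<Rightarrow> com" where
  "nbr_loop x = ''h'' ::= IConst 0 ;;
    While (ILess (V ''h'') (IGet ''deg'' [IGet ''gg'' [IConst (int x)]])) (nbr_body x)"

definition round_prog :: "nat \<Rightarrow> com" where
  "round_prog n = decide (comparisons n) (\<lambda>t. apply_round n (chosen_round n t)) ;;
    seqs (map nbr_loop [0..<n])"

lemma writes_apply_round:
  "iwrites (apply_round n \<rho>) \<subseteq> {''sig'', ''bun''}" "rwrites (apply_round n \<rho>) \<subseteq> {''u''}"
  by (cases \<rho>; auto simp: sig_step_def u_step_def pick_step_def)+

lemma writes_round_prog:
  "iwrites (round_prog n) \<subseteq> {''sig'', ''bun'', ''dg'', ''h''}" "rwrites (round_prog n) \<subseteq> {''u''}"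
proof -
  have "iwrites (decide (comparisons n) (\<lambda>t. apply_round n (chosen_round n t))) \<subseteq> {''sig'', ''bun''}"
    by (rule writes_decide) (rule writes_apply_round)
  then show "iwrites (round_prog n) \<subseteq> {''sig'', ''bun'', ''dg'', ''h''}"
    by (auto simp: round_prog_def nbr_loop_def nbr_body_def)
  have "rwrites (decide (comparisons n) (\<lambda>t. apply_round n (chosen_round n t))) \<subseteq> {''u''}"
    by (rule rwrites_decide) (rule writes_apply_round)
  then show "rwrites (round_prog n) \<subseteq> {''u''}"
    by (auto simp: round_prog_def nbr_loop_def nbr_body_def)
qed

context instance_data
begin

section \<open>How a store represents a state of the algorithm\<close>

definition values_ok :: "store \<Rightarrow> bool" where
  "values_ok s \<longleftrightarrow> (\<forall>i\<in>{1..n}. \<forall>g\<in>{1..m}. rtab s ''v'' [int i, int g] = v i {g})"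

definition degrees_ok :: "allocation \<Rightarrow> store \<Rightarrow> bool" where
  "degrees_ok B s \<longleftrightarrow> (\<forall>b\<in>{1..n}. \<forall>g\<in>{1..m}. itab s ''dg'' [int b, int g] = int (deg_in E (B b) g))"

definition bundles_ok :: "allocation \<Rightarrow> store \<Rightarrow> bool" where
  "bundles_ok B s \<longleftrightarrow> (\<forall>g\<in>{1..m}. itab s ''bun'' [int g] \<in> {0..int n}) \<and>
    (\<forall>b\<in>{1..n}. B b = {g \<in> {1..m}. itab s ''bun'' [int g] = int b}) \<and>
    (\<forall>i\<in>{1..n}. \<forall>b\<in>{1..n}. rtab s ''u'' [int i, int b] = v i (B b))"

definition owners_ok :: "(nat \<Rightarrow> nat) \<Rightarrow> store \<Rightarrow> bool" where
  "owners_ok \<sigma> s \<longleftrightarrow> \<sigma> permutes {1..n} \<and> (\<forall>i\<in>{1..n}. itab s ''sig'' [int i] = int (\<sigma> i))"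

definition unalloc :: "store \<Rightarrow> nat set" where
  "unalloc s = {g \<in> {1..m}. itab s ''bun'' [int g] = 0}"

text \<open>k is the number of rounds so far. That all bundles have exactly k goods bounds the
  profile coordinates in phase 0 and converts rounds into allocated goods. EF1 is included because
  the next round presupposes it.\<close>

definition represents :: "nat \<Rightarrow> state \<Rightarrow> store \<Rightarrow> bool" where
  "represents k st s \<longleftrightarrow> owners_ok (fst st) s \<and> bundles_ok (snd st) s \<and> degrees_ok (snd st) s \<and>
    EF1 n v (snd st \<circ> fst st) \<and> (\<forall>b\<in>{1..n}. card (snd st b) = k)"

definition goods_ok :: "(nat \<Rightarrow> nat) \<Rightarrow> store \<Rightarrow> bool" where
  "goods_ok gs s \<longleftrightarrow> (\<forall>x<n. itab s ''gg'' [int x] = int (gs x))"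

lemma sig_of_eq:
  assumes "owners_ok \<sigma> s"
  shows "sig_of n s = \<sigma>"
proof
  fix i
  show "sig_of n s i = \<sigma> i"
  proof (cases "i \<in> {1..n}")
    case True
    then have "\<sigma> i \<in> {1..n}" "itab s ''sig'' [int i] = int (\<sigma> i)"
      using assms permutes_in_image[of \<sigma>] unfolding owners_ok_def by blast+
    then show ?thesis using True unfolding sig_of_def by auto
  next
    case False
    then have "\<sigma> i = i" using assms unfolding owners_ok_def by (meson permutes_not_in)
    then show ?thesis using False by (auto simp: sig_of_def)
  qed
qed

text \<open>When g joins bundle b, exactly the neighbours of g gain a neighbour in b. The adjacency
  list has no repetitions, so each of their counters is raised once.\<close>

lemma wp_nbr_loop:
  assumes adj: "adj_ok s" and x: "itab s ''gg'' [int x] = int g" and g: "g \<in> {1..m}"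
    and b: "b \<in> {1..n}" "itab s ''bun'' [int g] = int b" "g \<notin> D b" and dg: "degrees_ok D s"
  shows "wp W (nbr_loop x) (\<lambda>N s'. degrees_ok (D(b := insert g (D b))) s' \<and> N \<le> deg g) s"
proof -
  define A where "A i = itab s ''adj'' [int g, int i]" for i
  have en: "enum (\<lambda>j. itab s ''adj'' [int g, j]) (itab s ''deg'' [int g]) (nbrs g)"
    using adj g unfolding adj_ok_def by blast
  have dgg: "itab s ''deg'' [int g] = int (deg g)" using adj_ok_deg[OF adj g] .
  have A: "\<exists>y\<in>nbrs g. A i = int y" if "i < deg g" for i
    unfolding A_def using enum_mem[OF en, of "int i"] that dgg by simp
  have Ainj: "i = j" if "i < deg g" "j < deg g" "A i = A j" for i j
    using enum_inj[OF en, of "int i" "int j"] that dgg by (simp add: A_def)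
  have Aex: "\<exists>i<deg g. A i = int y" if "y \<in> nbrs g" for y
    using enum_ex[OF en that] dgg unfolding A_def by (metis nonneg_int_cases of_nat_less_iff)
  let ?I = "\<lambda>k (s' :: store). itab s' ''h'' [] = int k \<and> (\<forall>a. a \<noteq> ''dg'' \<longrightarrow> a \<noteq> ''h'' \<longrightarrow> itab s' a = itab s a) \<and>
    (\<forall>c y. itab s' ''dg'' [c, y] = itab s ''dg'' [c, y] + (if c = int b \<and> y \<in> A ` {..<k} then 1 else 0))"
  have "wp W (While (ILess (V ''h'') (IGet ''deg'' [IGet ''gg'' [IConst (int x)]])) (nbr_body x))
    (\<lambda>N s'. ?I (deg g) s' \<and> N \<le> deg g) (iupdate ''h'' [] 0 s)"
  proof (rule wp_for[where I = ?I])
    fix k s' assume k: "k < deg g" and I: "?I k s'"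
    obtain y where y: "y \<in> nbrs g" "A k = int y" using A[OF k] by blast
    have ym: "y \<in> {1..m}" using y nbrs_subset by blast
    have new: "A k \<notin> A ` {..<k}"
    proof
      assume "A k \<in> A ` {..<k}"
      then obtain i where "i < k" "A k = A i" by blast
      then show False using Ainj[of k i] k by simp
    qed
    have "itab s ''dg'' [int b, A k] = int (deg_in E (D b) y)" using dg b(1) ym y by (simp add: degrees_ok_def)
    then have bnd: "\<bar>itab s ''dg'' [int b, A k] + 1\<bar> \<le> int W" "\<bar>int k + 1\<bar> \<le> int W"
      using deg_in_le_deg[of "D b" y] deg_less[OF ym] deg_less[OF g] k W by auto
    have Ak: "itab s ''adj'' [int g, int k] = A k" by (simp add: A_def)
    have same: "itab s' ''h'' [] = int k" "itab s' ''gg'' = itab s ''gg''" "itab s' ''bun'' = itab s ''bun''"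
       "itab s' ''adj'' = itab s ''adj''"
      and oth: "\<And>a. a \<noteq> ''dg'' \<Longrightarrow> a \<noteq> ''h'' \<Longrightarrow> itab s' a = itab s a"
      and dgs: "\<And>c y. itab s' ''dg'' [c, y] = itab s ''dg'' [c, y] + (if c = int b \<and> y \<in> A ` {..<k} then 1 else 0)"
      using I by simp_all
    show "vc W (nbr_body x) (?I (Suc k)) s'"
      unfolding nbr_body_def using bnd new
      by (auto simp: same x b Ak oth dgs lessThan_Suc)
  next
    fix k s' assume "k \<le> deg g" "?I k s'"
    then show "bval s' (ILess (V ''h'') (IGet ''deg'' [IGet ''gg'' [IConst (int x)]])) \<longleftrightarrow> k < deg g"
      by (simp add: x dgg)
  qed simp
  then have "wp W (nbr_loop x) (\<lambda>N s'. ?I (deg g) s' \<and> N \<le> deg g) s"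
    unfolding nbr_loop_def by (intro wp_Set_Seq) simp_all
  then show ?thesis
  proof (rule wp_mono)
    fix N s' assume I: "?I (deg g) s' \<and> N \<le> deg g"
    have mem: "int y \<in> A ` {..<deg g} \<longleftrightarrow> y \<in> nbrs g" for y
    proof
      assume "int y \<in> A ` {..<deg g}"
      then obtain i where i: "i < deg g" "int y = A i" by blast
      then show "y \<in> nbrs g" using A[OF i(1)] by auto
    next
      assume "y \<in> nbrs g"
      then obtain i where "i < deg g" "A i = int y" using Aex by blast
      then show "int y \<in> A ` {..<deg g}" by (metis imageI lessThan_iff)
    qed
    have "deg_in E (insert g (D b)) y = deg_in E (D b) y + (if y \<in> nbrs g then 1 else 0)" for y
    proof -
      have "insert g (D b) \<inter> nbrs y = (if y \<in> nbrs g then insert g (D b \<inter> nbrs y) else D b \<inter> nbrs y)"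
        using nbrs_sym by auto
      then show ?thesis unfolding deg_in_nbrs using b(3) by simp
    qed
    then have "degrees_ok (D(b := insert g (D b))) s'"
      using I dg unfolding degrees_ok_def by (auto simp: mem)
    then show "degrees_ok (D(b := insert g (D b))) s' \<and> N \<le> deg g" using I by blast
  qed
qed

lemma vc_sig_steps:
  assumes "n \<le> W" "\<sigma>' permutes {1..n}"
    and "\<And>s'. \<lbrakk>owners_ok \<sigma>' s'; \<And>a. a \<noteq> ''sig'' \<Longrightarrow> itab s' a = itab s a; rtab s' = rtab s;
       out s' = out s @ map (\<lambda>i. int (\<sigma>' i)) [1..<Suc n]\<rbrakk> \<Longrightarrow> Q s'"
  shows "vc W (seqs (map (sig_step \<sigma>') [1..<Suc n])) Q s"
proof -
  let ?I = "\<lambda>l (s' :: store). (\<forall>i\<in>{1..l}. itab s' ''sig'' [int i] = int (\<sigma>' i)) \<and>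
    (\<forall>a. a \<noteq> ''sig'' \<longrightarrow> itab s' a = itab s a) \<and> rtab s' = rtab s \<and>
    out s' = out s @ map (\<lambda>i. int (\<sigma>' i)) [1..<Suc l]"
  have "vc W (seqs (map (sig_step \<sigma>') [1..<Suc n])) (?I (length [1..<Suc n])) s"
  proof (rule vc_seqs_map)
    fix l s' assume l: "l < length [1..<Suc n]" and I: "?I l s'"
    then have x: "[1..<Suc n] ! l = Suc l" "Suc l \<in> {1..n}" by (auto simp del: upt_Suc)
    then have "\<sigma>' (Suc l) \<in> {1..n}" using permutes_in_image[OF assms(2)] by blast
    then have "int (\<sigma>' (Suc l)) \<le> int W" using assms(1) by simp
    moreover have "(\<forall>i\<in>{1..Suc l}. P i) \<longleftrightarrow> (\<forall>i\<in>{1..l}. P i) \<and> P (Suc l)" for P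
      using atLeastAtMostSuc_conv[of 1 l] by auto
    ultimately show "vc W (sig_step \<sigma>' ([1..<Suc n] ! l)) (?I (Suc l)) s'"
      unfolding x using I by (auto simp: sig_step_def simp del: of_nat_Suc)
  qed simp
  then show ?thesis
    by (rule vc_mono) (use assms(2) in \<open>auto intro!: assms(3) simp: owners_ok_def simp del: upt_Suc\<close>)
qed

lemma vc_emits:
  assumes "Q (s\<lparr>out := out s @ map (\<lambda>j. int (f j)) xs\<rparr>)"
  shows "vc W (seqs (map (\<lambda>j. Emit (IConst (int (f j)))) xs)) Q s"
  using assms by (induction xs arbitrary: s) simp_all

lemma vc_u_steps:
  assumes "\<And>s'. \<lbrakk>itab s' = itab s; \<And>a. a \<noteq> ''u'' \<Longrightarrow> rtab s' a = rtab s a; out s' = out s;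
     \<And>i c. i \<in> {1..n} \<Longrightarrow> rtab s' ''u'' [int i, int c] = rtab s ''u'' [int i, int c] +
       (if c = b then rtab s ''v'' [int i, itab s ''gg'' [int x]] else 0)\<rbrakk> \<Longrightarrow> Q s'"
  shows "vc W (seqs (map (u_step b x) [1..<Suc n])) Q s"
proof -
  let ?I = "\<lambda>l (s' :: store). itab s' = itab s \<and> (\<forall>a. a \<noteq> ''u'' \<longrightarrow> rtab s' a = rtab s a) \<and> out s' = out s \<and>
    (\<forall>i c. rtab s' ''u'' [int i, int c] = rtab s ''u'' [int i, int c] +
       (if c = b \<and> i \<in> {1..l} then rtab s ''v'' [int i, itab s ''gg'' [int x]] else 0))"
  have "vc W (seqs (map (u_step b x) [1..<Suc n])) (?I (length [1..<Suc n])) s"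
  proof (rule vc_seqs_map)
    fix l s' assume l: "l < length [1..<Suc n]" and I: "?I l s'"
    then have x: "[1..<Suc n] ! l = Suc l" by (auto simp del: upt_Suc)
    show "vc W (u_step b x ([1..<Suc n] ! l)) (?I (Suc l)) s'"
      unfolding x using I by (auto simp: u_step_def le_Suc_eq simp del: of_nat_Suc)
  qed simp
  then show ?thesis
    by (rule vc_mono) (auto intro!: assms simp del: upt_Suc)
qed

lemma vc_pick_steps:
  assumes vals: "values_ok s" and gs: "goods_ok gs s" and bij: "bij_betw gs {0..<n} C"
    and C: "C \<subseteq> unalloc s" and \<kappa>: "bij_betw \<kappa> {1..n} {0..<n}"
    and \<beta>: "\<And>j. j \<in> {1..n} \<Longrightarrow> \<beta> j \<in> {1..n}" and bun: "bundles_ok B s" and "n \<le> W"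
    and Q: "\<And>s'. \<lbrakk>bundles_ok (\<lambda>b. B b \<union> (gs \<circ> \<kappa>) ` {j \<in> {1..n}. \<beta> j = b}) s'; unalloc s' = unalloc s - C;
      \<And>a. a \<noteq> ''bun'' \<Longrightarrow> itab s' a = itab s a; \<And>a. a \<noteq> ''u'' \<Longrightarrow> rtab s' a = rtab s a;
      out s' = out s @ map (\<lambda>j. int ((gs \<circ> \<kappa>) j)) [1..<Suc n]\<rbrakk> \<Longrightarrow> Q s'"
  shows "vc W (seqs (map (pick_step n \<beta> \<kappa>) [1..<Suc n])) Q s"
proof -
  define c where "c = gs \<circ> \<kappa>"
  have c: "bij_betw c {1..n} C" unfolding c_def using \<kappa> bij by (rule bij_betw_trans)
  define D where "D l b = B b \<union> c ` {j \<in> {1..l}. \<beta> j = b}" for l b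
  let ?I = "\<lambda>l (s' :: store). bundles_ok (D l) s' \<and> unalloc s' = unalloc s - c ` {1..l} \<and>
    (\<forall>a. a \<noteq> ''bun'' \<longrightarrow> itab s' a = itab s a) \<and> (\<forall>a. a \<noteq> ''u'' \<longrightarrow> rtab s' a = rtab s a) \<and>
    out s' = out s @ map (\<lambda>j. int (c j)) [1..<Suc l]"
  have "vc W (seqs (map (pick_step n \<beta> \<kappa>) [1..<Suc n])) (?I (length [1..<Suc n])) s"
  proof (rule vc_seqs_map)
    show "?I 0 s" using bun by (simp add: D_def bundles_ok_def)
    fix l s' assume l: "l < length [1..<Suc n]" and I: "?I l s'"
    then have x: "[1..<Suc n] ! l = Suc l" and l1: "Suc l \<in> {1..n}" by (auto simp del: upt_Suc)
    have "\<kappa> (Suc l) < n" using \<kappa> l1 by (auto simp: bij_betw_def)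
    then have gg: "itab s' ''gg'' [int (\<kappa> (Suc l))] = int (c (Suc l))"
      using I gs by (simp add: goods_ok_def c_def)
    let ?g = "c (Suc l)" and ?b = "\<beta> (Suc l)"
    have b: "?b \<in> {1..n}" using \<beta>[OF l1] .
    have new: "?g \<notin> c ` {1..l}"
    proof
      assume "?g \<in> c ` {1..l}"
      then obtain j where "j \<in> {1..l}" and eq: "c (Suc l) = c j" by blast
      then have "j \<in> {1..n}" using l1 by auto
      then have "Suc l = j" by (rule inj_onD[OF bij_betw_imp_inj_on[OF c] eq l1])
      then show False using \<open>j \<in> {1..l}\<close> by simp
    qed
    have gC: "?g \<in> C" using c l1 by (auto simp: bij_betw_def)
    then have gun: "?g \<in> unalloc s'" using I C new by blast
    then have gm: "?g \<in> {1..m}" "itab s' ''bun'' [int ?g] = 0" by (auto simp: unalloc_def)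
    have J: "{j \<in> {1..Suc l}. \<beta> j = b} =
       (if b = ?b then insert (Suc l) {j \<in> {1..l}. \<beta> j = b} else {j \<in> {1..l}. \<beta> j = b})" for b
      unfolding atLeastAtMostSuc_conv[of 1 l, simplified, folded One_nat_def] by auto
    have DS: "D (Suc l) b = (if b = ?b then insert ?g (D l b) else D l b)" for b
      unfolding D_def J by (cases "b = ?b") (simp_all only: if_True if_False simp_thms image_insert Un_insert_right)
    have bD: "bundles_ok (D l) s'" using I by (rule conjunct1)
    have Dl: "D l b = {g \<in> {1..m}. itab s' ''bun'' [int g] = int b}" if "b \<in> {1..n}" for b
      by (rule bspec[OF conjunct1[OF conjunct2[OF bD[unfolded bundles_ok_def]]] that])
    have u: "rtab s' ''u'' [int i, int b] = v i (D l b)" if "i \<in> {1..n}" "b \<in> {1..n}" for i b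
      by (rule bspec[OF bspec[OF conjunct2[OF conjunct2[OF bD[unfolded bundles_ok_def]]] that(1)] that(2)])
    have gD: "?g \<notin> D l ?b" using Dl[OF b] gm b by auto
    have vi: "v i (insert ?g (D l ?b)) = v i (D l ?b) + v i {?g}" if "i \<in> {1..n}" for i
      by (rule additive_insert[OF additive that _ gm(1) gD]) (use Dl[OF b] in auto)
    have vv: "rtab s' ''v'' [int i, int ?g] = v i {?g}" if "i \<in> {1..n}" for i
      using vals I gm that unfolding values_ok_def by simp
    have W: "int ?b \<le> int W" using b \<open>n \<le> W\<close> by simp
    let ?s1 = "iupdate ''bun'' [int ?g] (int ?b) (s'\<lparr>out := out s' @ [int ?g]\<rparr>)"
    have "vc W (seqs (map (u_step ?b (\<kappa> (Suc l))) [1..<Suc n])) (?I (Suc l)) ?s1"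
    proof (rule vc_u_steps)
      fix s2 :: store assume s2: "itab s2 = itab ?s1" "\<And>a. a \<noteq> ''u'' \<Longrightarrow> rtab s2 a = rtab ?s1 a" "out s2 = out ?s1"
       and u2: "\<And>i c. i \<in> {1..n} \<Longrightarrow> rtab s2 ''u'' [int i, int c] = rtab ?s1 ''u'' [int i, int c] +
         (if c = ?b then rtab ?s1 ''v'' [int i, itab ?s1 ''gg'' [int (\<kappa> (Suc l))]] else 0)"
      have "bundles_ok (D (Suc l)) s2"
        unfolding bundles_ok_def
      proof (intro conjI ballI)
        fix g assume "g \<in> {1..m}"
        then show "itab s2 ''bun'' [int g] \<in> {0..int n}" using I b by (auto simp: s2(1) bundles_ok_def)
      next
        fix b' assume "b' \<in> {1..n}"
        then show "D (Suc l) b' = {g \<in> {1..m}. itab s2 ''bun'' [int g] = int b'}"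
          using Dl[of b'] gm unfolding DS s2(1) by auto
      next
        fix i b' assume "i \<in> {1..n}" "b' \<in> {1..n}"
        then show "rtab s2 ''u'' [int i, int b'] = v i (D (Suc l) b')"
          using u2[of i b'] u[of i b'] vi[of i] vv[of i] gg unfolding DS by auto
      qed
      moreover have "unalloc s2 = unalloc s - c ` {1..Suc l}"
      proof -
        have "unalloc s2 = unalloc s' - {?g}" using b by (auto simp: unalloc_def s2(1))
        moreover have "c ` {1..Suc l} = insert ?g (c ` {1..l})" by (simp add: atLeastAtMostSuc_conv)
        ultimately show ?thesis using I by auto
      qed
      ultimately show "?I (Suc l) s2" using I s2 by auto
    qed
    then show "vc W (pick_step n \<beta> \<kappa> ([1..<Suc n] ! l)) (?I (Suc l)) s'"
      unfolding x pick_step_def using W gg by (simp del: upt_Suc)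
  qed
  then show ?thesis
  proof (rule vc_mono)
    fix s' assume I: "?I (length [1..<Suc n]) s'"
    have len: "length [1..<Suc n] = n" by simp
    have "c ` {1..n} = C" using c by (simp add: bij_betw_def)
    moreover have "D n = (\<lambda>b. B b \<union> (gs \<circ> \<kappa>) ` {j \<in> {1..n}. \<beta> j = b})" by (simp add: D_def c_def fun_eq_iff)
    ultimately show "Q s'" using I unfolding len c_def by (intro Q) simp_all
  qed
qed

lemma wp_nbr_loops:
  assumes adj: "adj_ok s" and gs: "goods_ok gs s" and inj: "inj_on gs {0..<n}"
    and new: "\<And>x. x < n \<Longrightarrow> gs x \<in> {1..m}" "\<And>x b. x < n \<Longrightarrow> b \<in> {1..n} \<Longrightarrow> gs x \<notin> B b"
    and \<gamma>: "\<And>x. x < n \<Longrightarrow> \<gamma> x \<in> {1..n} \<and> itab s ''bun'' [int (gs x)] = int (\<gamma> x)"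
    and dg: "degrees_ok B s"
  shows "wp W (seqs (map nbr_loop [0..<n])) (\<lambda>N s'. degrees_ok (\<lambda>b. B b \<union> gs ` {x \<in> {0..<n}. \<gamma> x = b}) s' \<and>
    (\<forall>a. a \<noteq> ''dg'' \<longrightarrow> a \<noteq> ''h'' \<longrightarrow> itab s' a = itab s a) \<and> rtab s' = rtab s \<and> out s' = out s \<and>
    N \<le> (\<Sum>x<n. deg (gs x))) s"
proof -
  define D where "D l b = B b \<union> gs ` {x \<in> {0..<l}. \<gamma> x = b}" for l b
  let ?I = "\<lambda>l N (s' :: store). degrees_ok (D l) s' \<and>
    (\<forall>a. a \<noteq> ''dg'' \<longrightarrow> a \<noteq> ''h'' \<longrightarrow> itab s' a = itab s a) \<and> rtab s' = rtab s \<and> out s' = out s \<and>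
    N \<le> (\<Sum>x<l. deg (gs x))"
  have "wp W (seqs (map nbr_loop [0..<n])) (?I (length [0..<n])) s"
  proof (rule wp_seqs_map)
    have "D 0 = B" by (simp add: D_def fun_eq_iff)
    then show "?I 0 0 s" using dg by simp
    fix l N s' assume "l < length [0..<n]" and I: "?I l N s'"
    then have l: "l < n" "[0..<n] ! l = l" by auto
    have "adj_ok s'" using adj I by (simp add: adj_ok_def)
    moreover have "itab s' ''gg'' [int l] = int (gs l)" using gs l I by (simp add: goods_ok_def)
    moreover have "itab s' ''bun'' [int (gs l)] = int (\<gamma> l)" using \<gamma>[OF l(1)] I by simp
    moreover have "gs l \<notin> D l (\<gamma> l)"
    proof
      assume "gs l \<in> D l (\<gamma> l)"
      then obtain x where "x < l" "gs l = gs x" using new(2)[OF l(1)] \<gamma>[OF l(1)] by (auto simp: D_def)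
      then show False using inj_onD[OF inj, of l x] l by auto
    qed
    moreover have "degrees_ok (D l) s'" using I by blast
    ultimately have "wp W (nbr_loop l) (\<lambda>N s'. degrees_ok ((D l)(\<gamma> l := insert (gs l) (D l (\<gamma> l)))) s' \<and> N \<le> deg (gs l)) s'"
      using new(1)[OF l(1)] \<gamma>[OF l(1)] by (intro wp_nbr_loop) auto
    moreover have "(D l)(\<gamma> l := insert (gs l) (D l (\<gamma> l))) = D (Suc l)"
      by (auto simp: D_def fun_eq_iff less_Suc_eq image_iff)
    ultimately have "wp W (nbr_loop l) (\<lambda>N s'. degrees_ok (D (Suc l)) s' \<and> N \<le> deg (gs l)) s'" by simp
    from wp_frame[OF this] show "wp W (nbr_loop ([0..<n] ! l)) (\<lambda>N'. ?I (Suc l) (N + N')) s'"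
      unfolding l by (rule wp_mono) (use I in \<open>auto simp: framed_def nbr_loop_def nbr_body_def\<close>)
  qed
  moreover have "D n = (\<lambda>b. B b \<union> gs ` {x \<in> {0..<n}. \<gamma> x = b})" by (simp add: D_def fun_eq_iff)
  ultimately show ?thesis by simp
qed

lemma vc_apply_round:
  assumes vals: "values_ok s" and rep: "represents k (\<sigma>, B) s" and gs: "goods_ok gs s"
    and bij: "bij_betw gs {0..<n} C" and C: "C \<subseteq> unalloc s"
    and choice: "round_choice n (lt_of n s) (pr_of n s) \<sigma> (\<sigma>', \<pi>, \<kappa>)"
    and B': "B' = (\<lambda>b. B b \<union> (gs \<circ> \<kappa>) ` {j \<in> {1..n}. \<sigma>' (\<pi> j) = b})"
  shows "vc W (apply_round n (\<sigma>', \<pi>, \<kappa>)) (\<lambda>s'. owners_ok \<sigma>' s' \<and> bundles_ok B' s' \<and>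
    unalloc s' = unalloc s - C \<and> (\<forall>a. a \<noteq> ''sig'' \<longrightarrow> a \<noteq> ''bun'' \<longrightarrow> itab s' a = itab s a) \<and>
    (\<forall>a. a \<noteq> ''u'' \<longrightarrow> rtab s' a = rtab s a) \<and> out s' = out s @ log_round n (\<sigma>', \<pi>, gs \<circ> \<kappa>)) s"
proof -
  have \<sigma>: "\<sigma> permutes {1..n}" and bun: "bundles_ok B s"
    using rep by (auto simp: represents_def owners_ok_def)
  have "n \<le> W" using W m3 by simp
  have \<sigma>': "\<sigma>' permutes {1..n}" using choice rotations_permute[OF _ \<sigma>] by auto
  have \<kappa>: "bij_betw \<kappa> {1..n} {0..<n}" and "bij_betw \<pi> {1..n} {1..n}"
    using choice by (auto simp: topological_order_def)
  then have \<beta>: "\<sigma>' (\<pi> j) \<in> {1..n}" if "j \<in> {1..n}" for j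
    using that permutes_in_image[OF \<sigma>'] by (meson bij_betw_apply)
  show ?thesis
    unfolding apply_round.simps vc.simps
  proof (rule vc_sig_steps[OF \<open>n \<le> W\<close> \<sigma>'], rule vc_emits, rule vc_pick_steps[OF _ _ bij _ \<kappa> \<beta> _ \<open>n \<le> W\<close>])
    fix s1 :: store assume s1: "owners_ok \<sigma>' s1" "\<And>a. a \<noteq> ''sig'' \<Longrightarrow> itab s1 a = itab s a" "rtab s1 = rtab s"
       "out s1 = out s @ map (\<lambda>i. int (\<sigma>' i)) [1..<Suc n]"
    let ?s2 = "s1\<lparr>out := out s1 @ map (\<lambda>j. int (\<pi> j)) [1..<Suc n]\<rparr>"
    show "values_ok ?s2" using vals s1 by (simp add: values_ok_def)
    show "goods_ok gs ?s2" using gs s1 by (simp add: goods_ok_def)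
    have un: "unalloc ?s2 = unalloc s" using s1 by (simp add: unalloc_def)
    then show "C \<subseteq> unalloc ?s2" using C by simp
    show "bundles_ok B ?s2" using bun s1 by (simp add: bundles_ok_def)
    fix s3 :: store assume s3: "bundles_ok (\<lambda>b. B b \<union> (gs \<circ> \<kappa>) ` {j \<in> {1..n}. \<sigma>' (\<pi> j) = b}) s3"
      "unalloc s3 = unalloc ?s2 - C" "\<And>a. a \<noteq> ''bun'' \<Longrightarrow> itab s3 a = itab ?s2 a"
      "\<And>a. a \<noteq> ''u'' \<Longrightarrow> rtab s3 a = rtab ?s2 a"
      "out s3 = out ?s2 @ map (\<lambda>j. int ((gs \<circ> \<kappa>) j)) [1..<Suc n]"
    show "owners_ok \<sigma>' s3 \<and> bundles_ok B' s3 \<and>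
      unalloc s3 = unalloc s - C \<and> (\<forall>a. a \<noteq> ''sig'' \<longrightarrow> a \<noteq> ''bun'' \<longrightarrow> itab s3 a = itab s a) \<and>
      (\<forall>a. a \<noteq> ''u'' \<longrightarrow> rtab s3 a = rtab s a) \<and> out s3 = out s @ log_round n (\<sigma>', \<pi>, gs \<circ> \<kappa>)"
      using s1 s3 un by (simp add: owners_ok_def B' del: upt_Suc)
  qed
qed

text \<open>Besides correctness it provides the two facts on which the amortisation rests: the loops
  run at most as often as the assigned goods have neighbours, and the degree counters of all
  non-neighbours stay the same.\<close>

lemma round_prog_correct:
  assumes adj: "adj_ok s" and vals: "values_ok s" and rep: "represents k (\<sigma>, B) s" and gs: "goods_ok gs s"
    and bij: "bij_betw gs {0..<n} C" and C: "C \<subseteq> unalloc s"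
  shows "wp W (round_prog n) (\<lambda>N s'. (\<exists>\<rho> \<sigma>' B'. bb_round n v C (\<sigma>, B) \<rho> (\<sigma>', B') \<and>
      represents (Suc k) (\<sigma>', B') s' \<and> out s' = out s @ log_round n \<rho>) \<and> unalloc s' = unalloc s - C \<and>
      (\<forall>b\<in>{1..n}. \<forall>x\<in>{1..m} - (\<Union>g\<in>C. nbrs g). itab s' ''dg'' [int b, int x] = itab s ''dg'' [int b, int x]) \<and>
      N \<le> (\<Sum>g\<in>C. deg g)) s"
proof -
  have \<sigma>: "\<sigma> permutes {1..n}" and own: "owners_ok \<sigma> s" and bun: "bundles_ok B s" and ef: "EF1 n v (B \<circ> \<sigma>)"
    and dg: "degrees_ok B s" and card: "\<And>b. b \<in> {1..n} \<Longrightarrow> card (B b) = k"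
    using rep by (auto simp: represents_def owners_ok_def)
  have Bb: "B b = {g \<in> {1..m}. itab s ''bun'' [int g] = int b}" if "b \<in> {1..n}" for b
    using bun that by (simp add: bundles_ok_def)
  have BC: "B b \<subseteq> {1..m} - C" if "b \<in> {1..n}" for b
    using Bb[OF that] C that by (auto simp: unalloc_def)
  have Cm: "C \<subseteq> {1..m}" using C by (auto simp: unalloc_def)
  have gsm: "gs x \<in> C" if "x < n" for x using bij that by (auto simp: bij_betw_def)
  have lt: "lt_of n s i b c \<longleftrightarrow> v i (B b) < v i (B c)" if "i \<in> {1..n}" "b \<in> {1..n}" "c \<in> {1..n}" for i b c
    using that bun by (simp add: lt_of_def bundles_ok_def)
  have pr: "pr_of n s i x y \<longleftrightarrow> v i {gs x} < v i {gs y}" if "i \<in> {1..n}" "x < n" "y < n" for i x y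
  proof -
    have "gs x \<in> {1..m}" "gs y \<in> {1..m}" using gsm that Cm by blast+
    then show ?thesis using that gs vals unfolding pr_of_def goods_ok_def values_ok_def by simp
  qed
  let ?\<rho> = "chosen_round n (map (bval s) (comparisons n))"
  obtain \<sigma>' \<pi> \<kappa> where \<rho>: "?\<rho> = (\<sigma>', \<pi>, \<kappa>)" by (metis prod_cases3)
  obtain \<rho>0 where "round_choice n (lt_of n s) (pr_of n s) \<sigma> \<rho>0"
    using round_choice_exists[where lt = "lt_of n s" and pr = "pr_of n s" and u = "\<lambda>i b. v i (B b)"
      and w = "\<lambda>i x. v i {gs x}", OF \<sigma> lt pr] by blast
  then have choice: "round_choice n (lt_of n s) (pr_of n s) \<sigma> (\<sigma>', \<pi>, \<kappa>)"
    using chosen_round[of n s \<rho>0] sig_of_eq[OF own] \<rho> by simp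
  define B' where "B' = (\<lambda>b. B b \<union> (gs \<circ> \<kappa>) ` {j \<in> {1..n}. \<sigma>' (\<pi> j) = b})"
  note corr = round_choice_correct[where v = v and gs = gs, OF choice additive \<sigma> ef BC Cm lt pr bij B'_def]
  have "vc W (decide (comparisons n) (\<lambda>t. apply_round n (chosen_round n t))) (\<lambda>s'. owners_ok \<sigma>' s' \<and> bundles_ok B' s' \<and>
    unalloc s' = unalloc s - C \<and> (\<forall>a. a \<noteq> ''sig'' \<longrightarrow> a \<noteq> ''bun'' \<longrightarrow> itab s' a = itab s a) \<and>
    (\<forall>a. a \<noteq> ''u'' \<longrightarrow> rtab s' a = rtab s a) \<and> out s' = out s @ log_round n (\<sigma>', \<pi>, gs \<circ> \<kappa>)) s"
    unfolding vc_decide \<rho> by (rule vc_apply_round[OF vals rep gs bij C choice B'_def])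
  from wp_vc[OF this] show ?thesis
    unfolding round_prog_def
  proof (rule wp_SeqI, elim conjE)
    fix N and s1 :: store assume N: "N = (0::nat)" and s1: "owners_ok \<sigma>' s1" "bundles_ok B' s1" "unalloc s1 = unalloc s - C"
      "\<forall>a. a \<noteq> ''sig'' \<longrightarrow> a \<noteq> ''bun'' \<longrightarrow> itab s1 a = itab s a"
      "\<forall>a. a \<noteq> ''u'' \<longrightarrow> rtab s1 a = rtab s a" "out s1 = out s @ log_round n (\<sigma>', \<pi>, gs \<circ> \<kappa>)"
    \<comment> \<open>The leaf has recorded the bundle of each good in \<open>bun\<close>. Reading
      it back lets the degree loops work without knowing which leaf was taken.\<close>
    define \<gamma> where "\<gamma> x = nat (itab s1 ''bun'' [int (gs x)])" for x
    have \<gamma>: "\<gamma> x \<in> {1..n} \<and> itab s1 ''bun'' [int (gs x)] = int (\<gamma> x)" if "x < n" for x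
    proof -
      have g: "gs x \<in> {1..m}" "gs x \<notin> unalloc s1" using gsm[OF that] Cm s1(3) by blast+
      then have "itab s1 ''bun'' [int (gs x)] \<in> {0..int n}" "itab s1 ''bun'' [int (gs x)] \<noteq> 0"
        using s1(2) by (auto simp: bundles_ok_def unalloc_def)
      then show ?thesis by (auto simp: \<gamma>_def)
    qed
    have B'b: "B' b = {g \<in> {1..m}. itab s1 ''bun'' [int g] = int b}" if "b \<in> {1..n}" for b
      using s1(2) that by (simp add: bundles_ok_def)
    have \<kappa>: "bij_betw \<kappa> {1..n} {0..<n}" and \<pi>: "bij_betw \<pi> {1..n} {1..n}"
      using choice by (auto simp: topological_order_def)
    have c: "bij_betw (gs \<circ> \<kappa>) {1..n} C" using \<kappa> bij by (rule bij_betw_trans)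
    have B'\<gamma>: "B b \<union> gs ` {x \<in> {0..<n}. \<gamma> x = b} = B' b" if b: "b \<in> {1..n}" for b
    proof (intro equalityI subsetI)
      fix g assume "g \<in> B b \<union> gs ` {x \<in> {0..<n}. \<gamma> x = b}"
      then show "g \<in> B' b"
      proof
        assume "g \<in> gs ` {x \<in> {0..<n}. \<gamma> x = b}"
        then obtain x where "x < n" "\<gamma> x = b" "g = gs x" by auto
        then show ?thesis unfolding B'b[OF b] using \<gamma>[of x] gsm[of x] Cm by auto
      qed (simp add: B'_def)
    next
      fix g assume g: "g \<in> B' b"
      show "g \<in> B b \<union> gs ` {x \<in> {0..<n}. \<gamma> x = b}"
      proof (cases "g \<in> B b")
        case False
        then have "g \<in> C" using g c by (auto simp: B'_def bij_betw_def)
        then obtain x where x: "x \<in> {0..<n}" "g = gs x" using bij by (auto simp: bij_betw_def)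
        then have "\<gamma> x = b" using g \<gamma>[of x] unfolding B'b[OF b] by auto
        then show ?thesis using x by auto
      qed simp
    qed
    \<comment> \<open>The composition of \<sigma>' with \<pi> permutes {1..n}, so every bundle
      receives exactly one good.\<close>
    have card': "card (B' b) = Suc k" if b: "b \<in> {1..n}" for b
    proof -
      have "bij_betw (\<sigma>' \<circ> \<pi>) {1..n} {1..n}"
        using \<pi> permutes_imp_bij[OF corr(3)] by (rule bij_betw_trans)
      then have "b \<in> (\<sigma>' \<circ> \<pi>) ` {1..n}" and inj: "inj_on (\<sigma>' \<circ> \<pi>) {1..n}"
        using b by (simp_all only: bij_betw_def)
      then obtain j where j: "j \<in> {1..n}" "\<sigma>' (\<pi> j) = b" by auto
      moreover have "x = j" if "x \<in> {1..n}" "\<sigma>' (\<pi> x) = b" for x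
        by (rule inj_onD[OF inj _ that(1) j(1)]) (simp add: that j)
      ultimately have "{j \<in> {1..n}. \<sigma>' (\<pi> j) = b} = {j}" by blast
      then have "B' b = insert ((gs \<circ> \<kappa>) j) (B b)" by (simp add: B'_def)
      moreover have "(gs \<circ> \<kappa>) j \<in> C" using c j(1) by (meson bij_betw_apply)
      then have "(gs \<circ> \<kappa>) j \<notin> B b" using BC[OF b] by blast
      moreover have "finite (B b)" using BC[OF b] finite_subset by blast
      ultimately show ?thesis using card[OF b] by simp
    qed
    have "wp W (seqs (map nbr_loop [0..<n])) (\<lambda>N s'. degrees_ok (\<lambda>b. B b \<union> gs ` {x \<in> {0..<n}. \<gamma> x = b}) s' \<and>
      (\<forall>a. a \<noteq> ''dg'' \<longrightarrow> a \<noteq> ''h'' \<longrightarrow> itab s' a = itab s1 a) \<and> rtab s' = rtab s1 \<and> out s' = out s1 \<and>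
      N \<le> (\<Sum>x<n. deg (gs x))) s1"
    proof (rule wp_nbr_loops)
      show "adj_ok s1" using adj s1(4) by (simp add: adj_ok_def)
      show "goods_ok gs s1" using gs s1(4) by (simp add: goods_ok_def)
      show "inj_on gs {0..<n}" using bij by (simp add: bij_betw_def)
      show "degrees_ok B s1" using dg s1(4) by (simp add: degrees_ok_def)
      show "gs x \<in> {1..m}" if "x < n" for x using gsm[OF that] Cm by blast
      show "gs x \<notin> B b" if "x < n" "b \<in> {1..n}" for x b using gsm[OF that(1)] BC[OF that(2)] by blast
      show "\<gamma> x \<in> {1..n} \<and> itab s1 ''bun'' [int (gs x)] = int (\<gamma> x)" if "x < n" for x using \<gamma>[OF that] .
    qed
    then show "wp W (seqs (map nbr_loop [0..<n])) (\<lambda>N' s'. (\<exists>\<rho> \<sigma>' B'. bb_round n v C (\<sigma>, B) \<rho> (\<sigma>', B') \<and>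
      represents (Suc k) (\<sigma>', B') s' \<and> out s' = out s @ log_round n \<rho>) \<and> unalloc s' = unalloc s - C \<and>
      (\<forall>b\<in>{1..n}. \<forall>x\<in>{1..m} - (\<Union>g\<in>C. nbrs g). itab s' ''dg'' [int b, int x] = itab s ''dg'' [int b, int x]) \<and>
      N + N' \<le> (\<Sum>g\<in>C. deg g)) s1"
    proof (rule wp_mono, elim conjE)
      fix N' and s' :: store assume s': "degrees_ok (\<lambda>b. B b \<union> gs ` {x \<in> {0..<n}. \<gamma> x = b}) s'"
        "\<forall>a. a \<noteq> ''dg'' \<longrightarrow> a \<noteq> ''h'' \<longrightarrow> itab s' a = itab s1 a" "rtab s' = rtab s1" "out s' = out s1"
        "N' \<le> (\<Sum>x<n. deg (gs x))"
      have dg': "degrees_ok B' s'" using s'(1) B'\<gamma> by (simp add: degrees_ok_def)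
      have "owners_ok \<sigma>' s'" using s1(1) s'(2) by (simp add: owners_ok_def)
      moreover have "bundles_ok B' s'" using s1(2) s'(2,3) by (simp add: bundles_ok_def)
      ultimately have rep': "represents (Suc k) (\<sigma>', B') s'"
        using dg' corr(2) card' by (simp add: represents_def)
      have "(\<Sum>x<n. deg (gs x)) = (\<Sum>g\<in>C. deg g)"
        using sum.reindex_bij_betw[OF bij, of deg] by (simp add: lessThan_atLeast0)
      then have "N + N' \<le> (\<Sum>g\<in>C. deg g)" using N s'(5) by simp
      moreover have "itab s' ''dg'' [int b, int x] = itab s ''dg'' [int b, int x]"
        if b: "b \<in> {1..n}" and x: "x \<in> {1..m} - (\<Union>g\<in>C. nbrs g)" for b x
      proof -
        have "C \<inter> nbrs x = {}" using x nbrs_sym by blast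
        moreover have "B' b \<subseteq> B b \<union> C" using c by (auto simp: B'_def bij_betw_def)
        moreover have "B b \<subseteq> B' b" by (auto simp: B'_def)
        ultimately have "B' b \<inter> nbrs x = B b \<inter> nbrs x" by blast
        then show ?thesis using dg dg' b x by (simp add: degrees_ok_def deg_in_nbrs)
      qed
      moreover have "unalloc s' = unalloc s - C" using s1(3) s'(2) by (simp add: unalloc_def)
      moreover have "bb_round n v C (\<sigma>, B) (\<sigma>', \<pi>, gs \<circ> \<kappa>) (\<sigma>', B') \<and>
        represents (Suc k) (\<sigma>', B') s' \<and> out s' = out s @ log_round n (\<sigma>', \<pi>, gs \<circ> \<kappa>)"
        using corr(1) rep' s'(4) s1(6) by (simp only: simp_thms)
      ultimately show "(\<exists>\<rho> \<sigma>' B'. bb_round n v C (\<sigma>, B) \<rho> (\<sigma>', B') \<and>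
        represents (Suc k) (\<sigma>', B') s' \<and> out s' = out s @ log_round n \<rho>) \<and> unalloc s' = unalloc s - C \<and>
        (\<forall>b\<in>{1..n}. \<forall>x\<in>{1..m} - (\<Union>g\<in>C. nbrs g). itab s' ''dg'' [int b, int x] = itab s ''dg'' [int b, int x]) \<and>
        N + N' \<le> (\<Sum>g\<in>C. deg g)"
        by blast
    qed
  qed
qed

end

section \<open>The program: the rounds of a phase\<close>

text \<open>The factor \<open>sc\<close> brings a coordinate of the profile vector to the scale of
  the shared table, whose entry is an interval of the finest grid; \<open>w\<close> is the number of
  fine intervals per interval of the current grid, so dividing by it coarsens the index.\<close>

definition cell :: "nat \<Rightarrow> iexp \<Rightarrow> iexp list" where
  "cell n x = map (\<lambda>j. IDiv (IGet ''pt'' [V ''kind'', IMul (V ''sc'')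
     (ISub (IGet ''dg'' [IConst (int j), x]) (IGet ''dg'' [IConst 1, x]))]) (V ''w'')) [2..<Suc n]"

definition push_prog :: "nat \<Rightarrow> com" where
  "push_prog n =
    ''pc'' ::= ISub (V ''pc'') (IConst 1) ;;
    ''g'' ::= IGet ''stk'' [V ''pc''] ;;
    ''c'' ::= IGet ''bc'' (V ''ep'' # cell n (V ''g'')) ;;
    ISet ''bk'' (V ''c'' # V ''ep'' # cell n (V ''g'')) (V ''g'') ;;
    ISet ''bc'' (V ''ep'' # cell n (V ''g'')) (IAdd (V ''c'') (IConst 1))"

definition collect_prog :: "nat \<Rightarrow> com" where
  "collect_prog n =
    ISet ''bc'' (V ''ep'' # cell n (V ''g'')) (IConst 0) ;;
    seqs (map (\<lambda>x. ISet ''gg'' [IConst (int x)] (IGet ''bk'' (IConst (int x) # V ''ep'' # cell n (V ''g'')))) [0..<n])"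

definition same_cell :: "nat \<Rightarrow> bexp" where
  "same_cell n = conj_all (concat (map (\<lambda>x.
     map (\<lambda>(e, f). IEq e f) (zip (cell n (IGet ''gg'' [IConst (int x)])) (cell n (V ''g'')))) [0..<n]))"

definition return_prog :: "nat \<Rightarrow> com" where
  "return_prog n =
    seqs (map (\<lambda>x. ISet ''stk'' [IAdd (V ''pc'') (IConst (int x))] (IGet ''gg'' [IConst (int x)])) [0..<n]) ;;
    ''pc'' ::= IAdd (V ''pc'') (IConst (int n))"

text \<open>A good is put into the bucket of the cell of its profile vector, but not moved when the
  profile vector changes later. A full bucket is used for a round if all its goods are still in
  the right cell; otherwise its goods become pending again.\<close>

definition inner_body :: "nat \<Rightarrow> com" where
  "inner_body n = push_prog n ;;
    Cond (IEq (V ''c'') (IConst (int n - 1)))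
      (collect_prog n ;;
       Cond (same_cell n) (round_prog n ;; ''k'' ::= ISub (V ''k'') (IConst 1)) (return_prog n))
      Skip"

definition inner_loop :: "nat \<Rightarrow> com" where
  "inner_loop n = While (ile (ipow (V ''q'') (n - 1)) (V ''k'')) (inner_body n)"

definition cellv :: "nat \<Rightarrow> store \<Rightarrow> int \<Rightarrow> int list" where
  "cellv n s g = map (\<lambda>j. itab s ''pt'' [itab s ''kind'' [], itab s ''sc'' [] *
     (itab s ''dg'' [int j, g] - itab s ''dg'' [1, g])] div itab s ''w'' []) [2..<Suc n]"

lemma ival_cell [simp]: "map (ival s) (cell n x) = cellv n s (ival s x)"
  by (simp add: cell_def cellv_def del: upt_Suc)

lemma length_cellv [simp]: "length (cellv n s g) = n - 1"
  by (simp add: cellv_def del: upt_Suc)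

lemma cellv_cong:
  assumes "\<And>a. a \<in> {''pt'', ''kind'', ''sc'', ''w'', ''dg''} \<Longrightarrow> itab s' a = itab s a"
  shows "cellv n s' g = cellv n s g"
  using assms by (simp add: cellv_def)

lemma cellv_update [simp]:
  "a \<notin> {''pt'', ''kind'', ''sc'', ''w'', ''dg''} \<Longrightarrow> cellv n (iupdate a ks y s) g = cellv n s g"
  by (rule cellv_cong) auto

lemma bval_same_cell: "bval s (same_cell n) \<longleftrightarrow> (\<forall>x<n. cellv n s (itab s ''gg'' [int x]) = cellv n s (itab s ''g'' []))"
proof -
  have zip: "(\<forall>b\<in>set (map (\<lambda>(e, f). IEq e f) (zip es fs)). bval s b) \<longleftrightarrow> map (ival s) es = map (ival s) fs"
    if "length es = length fs" for es fs
    using that by (induction es fs rule: list_induct2) auto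
  have len: "length (cell n x) = length (cell n y)" for x y by (simp add: cell_def)
  have cm: "(\<forall>b\<in>set (concat (map F xs)). bval s b) \<longleftrightarrow> (\<forall>x\<in>set xs. \<forall>b\<in>set (F x). bval s b)"
    for F :: "nat \<Rightarrow> bexp list" and xs by auto
  have "bval s (same_cell n) \<longleftrightarrow> (\<forall>x\<in>{0..<n}. \<forall>b\<in>set (map (\<lambda>(e, f). IEq e f)
      (zip (cell n (IGet ''gg'' [IConst (int x)])) (cell n (V ''g'')))). bval s b)"
    unfolding same_cell_def bval_conj_all cm set_upt ..
  also have "\<dots> \<longleftrightarrow> (\<forall>x<n. cellv n s (itab s ''gg'' [int x]) = cellv n s (itab s ''g'' []))"
    unfolding zip[OF len] by auto
  finally show ?thesis .
qed

section \<open>Dyadic grids and the pigeonhole principle\<close>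

text \<open>An interval of the coarse grid is a union of w consecutive intervals of the fine one,
  and scaling by c maps grids to grids. The closed last interval needs care: y can reach \<Delta>
  only if T is the last fine interval, and then T div w is the last coarse one.\<close>

lemma piece_coarsen:
  assumes "0 \<le> \<Delta>" "0 < c" "0 < q" "0 < w" "T < q * w" "y * c \<in> piece (\<Delta> * c) (q * w) T"
  shows "y \<in> piece \<Delta> q (T div w)" "T div w < q"
proof -
  let ?D = "T div w"
  show D: "?D < q" using assms(4,5) by (simp add: less_mult_imp_div_less)
  have pos: "0 < real (q * w)" using assms by simp
  have scale: "(- (\<Delta> * c) + 2 * (\<Delta> * c) * t / real (q * w) \<le> y * c \<longleftrightarrow> - \<Delta> + 2 * \<Delta> * t / real (q * w) \<le> y)"
     "(y * c < - (\<Delta> * c) + 2 * (\<Delta> * c) * t / real (q * w) \<longleftrightarrow> y < - \<Delta> + 2 * \<Delta> * t / real (q * w))" for t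
  proof -
    have "- (\<Delta> * c) + 2 * (\<Delta> * c) * t / real (q * w) = (- \<Delta> + 2 * \<Delta> * t / real (q * w)) * c"
      by (simp add: algebra_simps)
    then show "(- (\<Delta> * c) + 2 * (\<Delta> * c) * t / real (q * w) \<le> y * c \<longleftrightarrow> - \<Delta> + 2 * \<Delta> * t / real (q * w) \<le> y)"
      "(y * c < - (\<Delta> * c) + 2 * (\<Delta> * c) * t / real (q * w) \<longleftrightarrow> y < - \<Delta> + 2 * \<Delta> * t / real (q * w))"
      using assms(2) by simp_all
  qed
  have mono: "2 * \<Delta> * real a / real q \<le> 2 * \<Delta> * real b / real (q * w)" if "a * w \<le> b" for a b
  proof -
    have "2 * \<Delta> * real a / real q = 2 * \<Delta> * real (a * w) / real (q * w)" using assms(3,4) by simp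
    also have "\<dots> \<le> 2 * \<Delta> * real b / real (q * w)"
      using that assms(1) pos by (intro divide_right_mono mult_left_mono) (simp_all del: of_nat_mult)
    finally show ?thesis .
  qed
  have mono': "2 * \<Delta> * real b / real (q * w) \<le> 2 * \<Delta> * real a / real q" if "b \<le> a * w" for a b
  proof -
    have "2 * \<Delta> * real b / real (q * w) \<le> 2 * \<Delta> * real (a * w) / real (q * w)"
      using that assms(1) pos by (intro divide_right_mono mult_left_mono) (simp_all del: of_nat_mult)
    also have "\<dots> = 2 * \<Delta> * real a / real q" using assms(3,4) by simp
    finally show ?thesis .
  qed
  have low: "- \<Delta> + 2 * \<Delta> * real T / real (q * w) \<le> y"
    using assms(6) scale(1)[of "real T"] by (simp add: piece_def)
  have 1: "- \<Delta> + 2 * \<Delta> * real ?D / real q \<le> y" using low mono[of ?D T] by simp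
  have "Suc T \<le> Suc ?D * w" using assms(4) by (simp add: Suc_le_eq dividend_less_div_times)
  have 2: "y \<le> \<Delta>" "Suc ?D \<noteq> q \<Longrightarrow> y < - \<Delta> + 2 * \<Delta> * real (Suc ?D) / real q"
  proof -
    consider "Suc T = q * w" | "Suc T \<noteq> q * w" by blast
    then have "y \<le> \<Delta> \<and> (Suc ?D \<noteq> q \<longrightarrow> y < - \<Delta> + 2 * \<Delta> * real (Suc ?D) / real q)"
    proof cases
      case 1
      then have "y * c \<le> \<Delta> * c" using assms(6) by (simp add: piece_def)
      moreover have "q * w \<le> Suc ?D * w" using \<open>Suc T \<le> Suc ?D * w\<close> 1 by simp
      then have "q \<le> Suc ?D" using assms(4) by (simp only: mult_le_cancel2)
      ultimately show ?thesis using assms(2) D by simp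
    next
      case 2
      then have "y < - \<Delta> + 2 * \<Delta> * real (Suc T) / real (q * w)"
        using assms(6) scale(2)[of "real (Suc T)"] by (simp add: piece_def)
      then have "y < - \<Delta> + 2 * \<Delta> * real (Suc ?D) / real q"
        using mono'[OF \<open>Suc T \<le> Suc ?D * w\<close>] by linarith
      moreover have "2 * \<Delta> * real (Suc ?D) / real q \<le> 2 * \<Delta> * real q / real q"
        using D assms(1) by (intro divide_right_mono mult_left_mono) auto
      ultimately show ?thesis using assms(3) by simp
    qed
    then show "y \<le> \<Delta>" "Suc ?D \<noteq> q \<Longrightarrow> y < - \<Delta> + 2 * \<Delta> * real (Suc ?D) / real q" by blast+
  qed
  show "y \<in> piece \<Delta> q ?D" using 1 2 by (simp add: piece_def)
qed

text \<open>Logarithms turn the assumptions into a \<le> log 2 k / d < a + 1. The program can thus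
  recognise the prescribed q by comparing integer powers with k.\<close>

lemma grid_exponent:
  assumes "0 < d" "(2 ^ a) ^ d \<le> k" "k < (2 * 2 ^ a) ^ d"
  shows "2 ^ nat \<lfloor>log 2 (real k powr (1 / real d))\<rfloor> = (2 :: nat) ^ a"
proof -
  have k: "0 < k" using assms(2) by (metis gr0I le_zero_eq power_not_zero zero_neq_numeral)
  have log: "log 2 (real k powr (1 / real d)) = log 2 (real k) / real d"
    using k by (simp add: log_powr)
  have "real (2 ^ (a * d)) \<le> real k" using assms(2) by (simp only: of_nat_le_iff power_mult)
  then have "log 2 (2 ^ (a * d)) \<le> log 2 (real k)" by (subst log_le_cancel_iff) (use k in auto)
  then have 1: "real a \<le> log 2 (real k) / real d"
    using assms(1) by (simp add: log_nat_power field_simps)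
  have "real k < real (2 ^ (Suc a * d))" using assms(3) by (simp only: of_nat_less_iff power_mult power_Suc)
  then have "log 2 (real k) < log 2 (2 ^ (Suc a * d))" by (subst log_less_cancel_iff) (use k in auto)
  then have 2: "log 2 (real k) / real d < real a + 1"
    using assms(1) by (simp add: log_nat_power field_simps)
  have "\<lfloor>log 2 (real k) / real d\<rfloor> = int a" using 1 2 by (intro floor_unique) auto
  then show ?thesis by (simp add: log)
qed

definition cells :: "nat \<Rightarrow> nat \<Rightarrow> int list set" where
  "cells d q = {\<kappa>. set \<kappa> \<subseteq> {0..<int q} \<and> length \<kappa> = d}"

lemma finite_cells [simp]: "finite (cells d q)"
  unfolding cells_def by (rule finite_lists_length_eq) simp

lemma card_cells: "card (cells d q) = q ^ d"
  unfolding cells_def by (subst card_lists_length_eq) simp_all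

lemma pigeonhole_cells:
  assumes "finite R" "\<And>g. g \<in> R \<Longrightarrow> \<exists>\<kappa>\<in>cells d q. f g = Some \<kappa>"
    and "\<And>\<kappa>. card {g \<in> R. f g = Some \<kappa>} \<le> b"
  shows "card R \<le> b * q ^ d"
proof -
  have "R = (\<Union>\<kappa>\<in>cells d q. {g \<in> R. f g = Some \<kappa>})" using assms(2) by auto
  then have "card R \<le> (\<Sum>\<kappa>\<in>cells d q. card {g \<in> R. f g = Some \<kappa>})" by (metis card_UN_le finite_cells)
  also have "\<dots> \<le> (\<Sum>\<kappa>\<in>cells d q. b)" using assms(3) by (rule sum_mono)
  finally show ?thesis by (simp add: card_cells mult.commute)
qed

section \<open>A single phase: scaling, cells and subcubes\<close>

context instance_data
begin

text \<open>Truncated subtraction gives phases 0 and 1 the same scale 1; after that the scale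
  doubles.\<close>

definition phase_scale :: "nat \<Rightarrow> nat" where "phase_scale i = 2 ^ (i - 1)"

definition base_delta :: "nat \<Rightarrow> real" where "base_delta i = (if i = 0 then real rt else \<Delta>\<^sub>1)"

text \<open>From phase 1 on the half-width is halved whenever the scale doubles, so their product
  does not change. This is why a single table serves all these phases.\<close>

lemma phase_delta_scale: "phase_delta n E i * real (phase_scale i) = base_delta i"
proof (cases "i = 0")
  case False
  then obtain i' where i: "i = Suc i'" by (cases i) auto
  have "(2::real) powi (int i - 2) * 2 = 2 ^ i'"
    unfolding i by (simp add: power_int_diff)
  then show ?thesis using n3 i by (simp add: phase_delta_def phase_scale_def base_delta_def \<Delta>\<^sub>1_def field_simps)
qed (simp add: phase_delta_def phase_scale_def base_delta_def rt_bounds(4))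

definition static :: "store \<Rightarrow> bool" where
  "static s \<longleftrightarrow> adj_ok s \<and> values_ok s \<and> ord_ok s \<and> pieces_ok s 0 (real rt) \<and> pieces_ok s 1 \<Delta>\<^sub>1 \<and>
    itab s ''Q'' [] = 2 ^ lgQ \<and> itab s ''m'' [] = int m \<and> itab s ''r'' [] = int rt"

lemma static_cong:
  assumes "static s" "\<And>a. a \<in> {''adj'', ''deg'', ''ord'', ''pt'', ''Q'', ''m'', ''r''} \<Longrightarrow> itab s' a = itab s a"
    and "rtab s' ''v'' = rtab s ''v''"
  shows "static s'"
  using assms by (simp add: static_def adj_ok_def values_ok_def ord_ok_def pieces_ok_def)

definition grid :: "nat \<Rightarrow> nat \<Rightarrow> store \<Rightarrow> bool" where
  "grid i a s \<longleftrightarrow> a \<le> lgQ \<and> itab s ''kind'' [] = (if i = 0 then 0 else 1) \<and>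
    itab s ''sc'' [] = int (phase_scale i) \<and> itab s ''q'' [] = 2 ^ a \<and> itab s ''w'' [] = 2 ^ (lgQ - a)"

lemma grid_cong:
  assumes "grid i a s" "\<And>b. b \<in> {''kind'', ''sc'', ''q'', ''w''} \<Longrightarrow> itab s' b = itab s b"
  shows "grid i a s'"
  using assms by (simp add: grid_def)

end

text \<open>L is the set of goods of phase i, U the goods left to later phases, nx the number of
  goods allocated when the phase ends; \<open>st0\<close> and \<open>out0\<close> are state and log
  at its start. The bound keeps all profile vectors in the cube: in any bundle a good has at most
  \<open>deg g\<close> neighbours, and also at most nx div n, the final size of the bundle in this
  phase.\<close>

locale phase_data = instance_data +
  fixes i nx :: nat and L U :: "nat set" and st0 :: state and out0 :: "int list"
  assumes L: "L \<subseteq> {1..m}" and LU: "L \<inter> U = {}"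
    and bound: "\<And>g. g \<in> L \<Longrightarrow> real (min (deg g) (nx div n)) * real (phase_scale i) \<le> base_delta i"
begin

abbreviation cv :: "store \<Rightarrow> nat \<Rightarrow> int list" where "cv s g \<equiv> cellv n s (int g)"

text \<open>Both degrees in a coordinate lie between 0 and min (deg g) (nx div n), so the scaled
  difference is within the range of the table; coarsening the interval found there gives the piece
  in the current grid.\<close>

lemma cell_correct:
  assumes st: "static s" and gr: "grid i a s" and rep: "represents k (\<sigma>, B) s" and k: "k \<le> nx div n" and g: "g \<in> L"
  shows "cv s g \<in> cells (n - 1) (2 ^ a)"
    "\<And>j. j \<in> {2..n} \<Longrightarrow> real_of_int (profile E B g j) \<in> piece (phase_delta n E i) (2 ^ a) (nat (cv s g ! (j - 2)))"
proof -
  have gm: "g \<in> {1..m}" using g L by blast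
  let ?c = "real (phase_scale i)"
  have c: "0 < ?c" by (simp add: phase_scale_def)
  have base: "0 \<le> base_delta i" by (simp add: base_delta_def \<Delta>\<^sub>1_def)
  have delta: "0 \<le> phase_delta n E i"
    using phase_delta_scale[of i] base c by (metis mult_less_0_iff not_le)
  have "piece_j": "\<exists>T. itab s ''pt'' [itab s ''kind'' [], itab s ''sc'' [] * (itab s ''dg'' [int j, int g] - itab s ''dg'' [1, int g])] = int T
     \<and> T < 2 ^ lgQ \<and> real_of_int (profile E B g j) * ?c \<in> piece (phase_delta n E i * ?c) (2 ^ lgQ) T"
    if j: "j \<in> {2..n}" for j
  proof -
    have jn: "j \<in> {1..n}" "1 \<in> {1..n}" using j n3 by auto
    have dgb: "itab s ''dg'' [int b, int g] = int (deg_in E (B b) g)" if "b \<in> {1..n}" for b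
      using rep that gm unfolding represents_def degrees_ok_def by simp
    have dg: "itab s ''dg'' [int j, int g] = int (deg_in E (B j) g)" "itab s ''dg'' [1, int g] = int (deg_in E (B 1) g)"
      using dgb[OF jn(1)] dgb[OF jn(2)] by simp_all
    have le: "deg_in E (B b) g \<le> min (deg g) (nx div n)" if "b \<in> {1..n}" for b
    proof -
      have "card (B b) = k" "B b \<subseteq> {1..m}" using rep that unfolding represents_def bundles_ok_def by auto
      then show ?thesis
        using deg_in_le_deg[of "B b" g] deg_in_le_card[of "B b" g] k finite_subset[of "B b" "{1..m}"] by auto
    qed
    let ?p = "profile E B g j"
    have "\<bar>?p\<bar> \<le> int (min (deg g) (nx div n))"
      using le[OF jn(1)] le[OF jn(2)] unfolding profile_def by linarith
    then have "\<bar>real_of_int ?p\<bar> \<le> real (min (deg g) (nx div n))"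
      by (metis of_int_abs of_int_le_iff of_int_of_nat_eq)
    then have "\<bar>real_of_int ?p\<bar> * ?c \<le> real (min (deg g) (nx div n)) * ?c" using c by (intro mult_right_mono) auto
    then have "\<bar>real_of_int (int (phase_scale i) * ?p)\<bar> \<le> base_delta i"
      using bound[OF g] by (simp add: abs_mult mult.commute)
    moreover have "pieces_ok s (itab s ''kind'' []) (base_delta i)"
      using st gr by (simp add: static_def grid_def base_delta_def)
    ultimately obtain T where "T < 2 ^ lgQ" "itab s ''pt'' [itab s ''kind'' [], int (phase_scale i) * ?p] = int T"
      "real_of_int (int (phase_scale i) * ?p) \<in> piece (base_delta i) (2 ^ lgQ) T"
      unfolding pieces_ok_def by blast
    then show ?thesis using gr dg phase_delta_scale[of i]
      by (intro exI[of _ T]) (simp add: grid_def profile_def mult.commute)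
  qed
  have nth: "cv s g ! (j - 2) = itab s ''pt'' [itab s ''kind'' [], itab s ''sc'' [] *
      (itab s ''dg'' [int j, int g] - itab s ''dg'' [1, int g])] div 2 ^ (lgQ - a)" if "j \<in> {2..n}" for j
    using that gr by (auto simp: cellv_def grid_def simp del: upt_Suc)
  have Q: "(2::nat) ^ lgQ = 2 ^ a * 2 ^ (lgQ - a)" using gr by (simp add: grid_def flip: power_add)
  have main: "\<exists>T. cv s g ! (j - 2) = int T \<and> T < 2 ^ a \<and> real_of_int (profile E B g j) \<in> piece (phase_delta n E i) (2 ^ a) T"
    if j: "j \<in> {2..n}" for j
  proof -
    obtain T where T: "itab s ''pt'' [itab s ''kind'' [], itab s ''sc'' [] * (itab s ''dg'' [int j, int g] - itab s ''dg'' [1, int g])] = int T"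
      "T < 2 ^ lgQ" "real_of_int (profile E B g j) * ?c \<in> piece (phase_delta n E i * ?c) (2 ^ lgQ) T"
      using piece_j[OF j] by blast
    have "cv s g ! (j - 2) = int (T div 2 ^ (lgQ - a))" using nth[OF j] T(1) by (simp add: zdiv_int)
    then show ?thesis
      using piece_coarsen[OF delta c _ _ T(2)[unfolded Q] T(3)[unfolded Q]] by auto
  qed
  show "real_of_int (profile E B g j) \<in> piece (phase_delta n E i) (2 ^ a) (nat (cv s g ! (j - 2)))"
    if "j \<in> {2..n}" for j using main[OF that] by force
  have "0 \<le> cv s g ! l \<and> cv s g ! l < 2 ^ a" if "l < n - 1" for l
  proof -
    have "l + 2 \<in> {2..n}" using that by (simp; linarith)
    from main[OF this] obtain T where "cv s g ! l = int T" "T < 2 ^ a" by auto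
    then show ?thesis by (metis of_nat_0_le_iff of_nat_less_iff of_nat_numeral of_nat_power)
  qed
  then show "cv s g \<in> cells (n - 1) (2 ^ a)" by (auto simp: cells_def in_set_conv_nth)
qed

lemma subcube_of_cell:
  assumes "\<kappa> \<in> cells (n - 1) q"
  shows "{x. \<forall>j\<in>{2..n}. x j \<in> piece \<Delta> q (nat (\<kappa> ! (j - 2)))} \<in> subcubes n \<Delta> q"
proof -
  have "nat (\<kappa> ! (j - 2)) < q" if "j \<in> {2..n}" for j
  proof -
    have "\<kappa> ! (j - 2) \<in> set \<kappa>" using assms that by (intro nth_mem) (auto simp: cells_def)
    then have "\<kappa> ! (j - 2) \<in> {0..<int q}" using assms by (auto simp: cells_def)
    then show ?thesis by auto
  qed
  then show ?thesis unfolding subcubes_def by (intro CollectI exI[of _ "\<lambda>j. nat (\<kappa> ! (j - 2))"]) auto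
qed

text \<open>\<open>degree_ef1\<close> unfolds a run from its first round, but the program appends rounds. A partial run
  \<open>tr\<close> is therefore described by its continuations.\<close>

definition ran :: "nat set \<Rightarrow> state \<Rightarrow> round list \<Rightarrow> bool" where
  "ran R st tr \<longleftrightarrow> (\<forall>tr' st'. degree_ef1 n v E (phase_delta n E i) R st tr' st' \<longrightarrow>
     degree_ef1 n v E (phase_delta n E i) L st0 (tr @ tr') st')"

section \<open>Invariant and potential of the bucket loop\<close>

definition progress :: "nat set \<Rightarrow> nat \<Rightarrow> nat \<Rightarrow> state \<Rightarrow> store \<Rightarrow> bool" where
  "progress R k rd st s \<longleftrightarrow> static s \<and> represents rd st s \<and> R \<subseteq> L \<and> unalloc s = R \<union> U \<and>
    card R = k * n \<and> (rd + k) * n = nx \<and> itab s ''k'' [] = int k \<and>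
    (\<exists>tr. out s = out0 @ concat (map (log_round n) tr) \<and> ran R st tr)"

text \<open>\<open>f g\<close> is the bucket of the good \<open>g\<close>, or \<open>None\<close> if \<open>g\<close> is pending. This ghost function makes the
  buckets and the stack of pending goods disjoint by construction.\<close>

definition bins :: "nat set \<Rightarrow> (nat \<Rightarrow> int list option) \<Rightarrow> store \<Rightarrow> bool" where
  "bins R f s \<longleftrightarrow> enum (\<lambda>x. itab s ''stk'' [x]) (itab s ''pc'' []) {g \<in> R. f g = None} \<and>
    (\<forall>\<kappa>. enum (\<lambda>x. itab s ''bk'' (x # itab s ''ep'' [] # \<kappa>)) (itab s ''bc'' (itab s ''ep'' [] # \<kappa>))
      {g \<in> R. f g = Some \<kappa>})"

definition stale :: "nat set \<Rightarrow> (nat \<Rightarrow> int list option) \<Rightarrow> store \<Rightarrow> nat set" where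
  "stale R f s = {g \<in> R. \<exists>\<kappa>. f g = Some \<kappa> \<and> \<kappa> \<noteq> cv s g}"

text \<open>The counts of later epochs vanish because their keys have not been used yet. The last
  conjunct is one half of the condition that identifies q; the other half is the guard of the
  loop.\<close>

definition inner_inv :: "nat \<Rightarrow> nat set \<Rightarrow> (nat \<Rightarrow> int list option) \<Rightarrow> nat \<Rightarrow> nat \<Rightarrow> state \<Rightarrow> store \<Rightarrow> bool" where
  "inner_inv a R f k rd st s \<longleftrightarrow> progress R k rd st s \<and> grid i a s \<and> bins R f s \<and>
    (\<forall>\<kappa>. card {g \<in> R. f g = Some \<kappa>} < n) \<and> (\<forall>g\<in>R. \<forall>\<kappa>. f g = Some \<kappa> \<longrightarrow> \<kappa> \<in> cells (n - 1) (2 ^ a)) \<and>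
    (\<forall>e \<kappa>. itab s ''ep'' [] < e \<longrightarrow> itab s ''bc'' (e # \<kappa>) = 0) \<and> k < (2 * 2 ^ a) ^ (n - 1)"

text \<open>Returning a full bucket makes \<open>n\<close> goods pending but repairs a stale one. A round makes at most as
  many goods stale as the goods it assigns have neighbours.\<close>

definition inner_pot :: "nat set \<Rightarrow> (nat \<Rightarrow> int list option) \<Rightarrow> store \<Rightarrow> nat" where
  "inner_pot R f s = nat (itab s ''pc'' []) + n * card (stale R f s) + (n + 1) * (\<Sum>g\<in>R. deg g)"

lemma progress_cong:
  assumes "progress R k rd st s" "out s' = out s" "rtab s' = rtab s"
    and "\<And>a. a \<in> {''adj'', ''deg'', ''ord'', ''pt'', ''Q'', ''m'', ''r'', ''sig'', ''bun'', ''dg'', ''k''} \<Longrightarrow>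
      itab s' a = itab s a"
  shows "progress R k rd st s'"
proof -
  have eq: "itab s' ''sig'' = itab s ''sig''" "itab s' ''bun'' = itab s ''bun''" "itab s' ''dg'' = itab s ''dg''"
    "itab s' ''k'' = itab s ''k''" using assms(4) by simp_all
  have "static s" using assms(1) unfolding progress_def by blast
  then have "static s'" by (rule static_cong) (auto intro!: assms(4) simp: assms(3))
  moreover have "represents rd st s' \<longleftrightarrow> represents rd st s"
    by (simp only: represents_def owners_ok_def bundles_ok_def degrees_ok_def eq assms(3))
  moreover have "unalloc s' = unalloc s" by (simp only: unalloc_def eq)
  ultimately show ?thesis using assms(1) unfolding progress_def eq assms(2) by (simp only: simp_thms)
qed

lemma progress_cell:
  assumes "progress R k rd st s" "grid i a s" "g \<in> R"
  shows "cv s g \<in> cells (n - 1) (2 ^ a)"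
    "\<And>j. j \<in> {2..n} \<Longrightarrow> real_of_int (profile E (snd st) g j) \<in> piece (phase_delta n E i) (2 ^ a) (nat (cv s g ! (j - 2)))"
proof -
  have *: "static s" "represents rd (fst st, snd st) s" "g \<in> L" using assms by (auto simp: progress_def)
  have "rd \<le> nx div n"
    using assms(1) n3 by (auto simp: progress_def less_eq_div_iff_mult_less_eq)
  note cell_correct[OF *(1) assms(2) *(2) this *(3)]
  then show "cv s g \<in> cells (n - 1) (2 ^ a)"
    "\<And>j. j \<in> {2..n} \<Longrightarrow> real_of_int (profile E (snd st) g j) \<in> piece (phase_delta n E i) (2 ^ a) (nat (cv s g ! (j - 2)))"
    by blast+
qed

lemma card_R_le:
  assumes "progress R k rd st s"
  shows "finite R" "card R \<le> m" "R \<subseteq> {1..m}"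
proof -
  show "R \<subseteq> {1..m}" using assms L by (auto simp: progress_def)
  then show "finite R" "card R \<le> m" using finite_subset card_mono[of "{1..m}" R] by auto
qed

lemma vc_push:
  assumes inv: "inner_inv a R f k rd st s" and cond: "(2 ^ a) ^ (n - 1) \<le> k"
  shows "vc W (push_prog n) (\<lambda>s'. \<exists>g\<in>R. f g = None \<and> itab s' ''g'' [] = int g \<and>
    itab s' ''pc'' [] = itab s ''pc'' [] - 1 \<and> 0 < itab s ''pc'' [] \<and>
    bins R (f(g := Some (cv s g))) s' \<and> itab s' ''c'' [] = int (card {h \<in> R. f h = Some (cv s g)}) \<and>
    (\<forall>e \<kappa>. e \<noteq> itab s ''ep'' [] \<longrightarrow> itab s' ''bc'' (e # \<kappa>) = itab s ''bc'' (e # \<kappa>))) s"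
proof -
  let ?ep = "itab s ''ep'' []" and ?pc = "itab s ''pc'' []"
  have prog: "progress R k rd st s" and gr: "grid i a s"
    and none: "enum (\<lambda>x. itab s ''stk'' [x]) ?pc {g \<in> R. f g = None}"
    and bin: "\<And>\<kappa>. enum (\<lambda>x. itab s ''bk'' (x # ?ep # \<kappa>)) (itab s ''bc'' (?ep # \<kappa>)) {g \<in> R. f g = Some \<kappa>}"
    and small: "\<And>\<kappa>. card {g \<in> R. f g = Some \<kappa>} < n"
    and rng: "\<And>g \<kappa>. g \<in> R \<Longrightarrow> f g = Some \<kappa> \<Longrightarrow> \<kappa> \<in> cells (n - 1) (2 ^ a)"
    using inv by (auto simp: inner_inv_def bins_def)
  note R = card_R_le[OF prog]
  have k: "0 < k" using cond by (metis gr0I le_zero_eq power_not_zero zero_neq_numeral)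
  \<comment> \<open>Otherwise all of R lies in buckets of fewer than n goods, and |R| \<le> (n - 1)
    * q ^ (n - 1) \<le> (n - 1) * k < k * n = |R|.\<close>
  have "{g \<in> R. f g = None} \<noteq> {}"
  proof
    assume empty: "{g \<in> R. f g = None} = {}"
    have "card R \<le> (n - 1) * (2 ^ a) ^ (n - 1)"
    proof (rule pigeonhole_cells[OF R(1)])
      show "\<exists>\<kappa>\<in>cells (n - 1) (2 ^ a). f g = Some \<kappa>" if "g \<in> R" for g
        using that empty rng[of g] by (cases "f g") auto
      show "card {g \<in> R. f g = Some \<kappa>} \<le> n - 1" for \<kappa> using small[of \<kappa>] by simp
    qed
    also have "\<dots> \<le> (n - 1) * k" using cond by simp
    also have "\<dots> < k * n" using k n3 by (cases n) auto
    also have "\<dots> = card R" using prog by (simp add: progress_def)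
    finally show False by simp
  qed
  then have pc: "0 < ?pc" "?pc \<le> int m"
    using enum_card[OF none] R card_mono[of R "{g \<in> R. f g = None}"] card_gt_0_iff[of "{g \<in> R. f g = None}"] by auto
  obtain g where g: "g \<in> R" "f g = None" "itab s ''stk'' [?pc - 1] = int g"
    "enum (\<lambda>x. itab s ''stk'' [x]) (?pc - 1) ({g \<in> R. f g = None} - {g})"
    using enum_pop[OF none pc(1)] by blast
  let ?\<kappa> = "cv s g"
  have bc: "itab s ''bc'' (?ep # ?\<kappa>) = int (card {h \<in> R. f h = Some ?\<kappa>})" using enum_card(2)[OF bin] .
  have nW: "int n \<le> int W" using W m3 by simp
  then have bnd: "int (card {h \<in> R. f h = Some ?\<kappa>}) \<le> int W" "int (card {h \<in> R. f h = Some ?\<kappa>}) + 1 \<le> int W"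
    using small[of ?\<kappa>] by linarith+
  have bnd': "\<bar>?pc - 1\<bar> \<le> int W" "int g \<le> int W" using pc W g(1) R(3) by auto
  have bin': "enum (\<lambda>x. itab s'' ''bk'' (x # ?ep # \<kappa>')) (itab s'' ''bc'' (?ep # \<kappa>')) {h \<in> R. (f(g := Some ?\<kappa>)) h = Some \<kappa>'}"
    if bk: "itab s'' ''bk'' = (itab s ''bk'')(int (card {h \<in> R. f h = Some ?\<kappa>}) # ?ep # ?\<kappa> := int g)"
     and bc': "itab s'' ''bc'' = (itab s ''bc'')(?ep # ?\<kappa> := int (card {h \<in> R. f h = Some ?\<kappa>}) + 1)"
    for s'' :: store and \<kappa>'
  proof (cases "\<kappa>' = ?\<kappa>")
    case True
    have "{h \<in> R. (f(g := Some ?\<kappa>)) h = Some ?\<kappa>} = insert g {h \<in> R. f h = Some ?\<kappa>}" using g by auto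
    moreover have "enum (\<lambda>x. itab s'' ''bk'' (x # ?ep # ?\<kappa>)) (itab s ''bc'' (?ep # ?\<kappa>) + 1) (insert g {h \<in> R. f h = Some ?\<kappa>})"
      by (rule enum_push[OF bin]) (use g(2) in \<open>auto simp: bk bc\<close>)
    ultimately show ?thesis using True bc by (simp add: bc')
  next
    case False
    then have "{h \<in> R. (f(g := Some ?\<kappa>)) h = Some \<kappa>'} = {h \<in> R. f h = Some \<kappa>'}" using g by auto
    then show ?thesis using bin[of \<kappa>'] False by (simp add: bk bc')
  qed
  have none': "{h \<in> R. (f(g := Some ?\<kappa>)) h = None} = {g \<in> R. f g = None} - {g}" by auto
  have upd: "vc W (push_prog n) Q s"
    if "\<And>s''. \<lbrakk>\<And>a. a \<notin> {''pc'', ''g'', ''c'', ''bk'', ''bc''} \<Longrightarrow> itab s'' a = itab s a;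
        itab s'' ''bk'' = (itab s ''bk'')(int (card {h \<in> R. f h = Some ?\<kappa>}) # ?ep # ?\<kappa> := int g);
        itab s'' ''bc'' = (itab s ''bc'')(?ep # ?\<kappa> := int (card {h \<in> R. f h = Some ?\<kappa>}) + 1);
        itab s'' ''pc'' [] = ?pc - 1; itab s'' ''g'' [] = int g;
        itab s'' ''c'' [] = int (card {h \<in> R. f h = Some ?\<kappa>})\<rbrakk> \<Longrightarrow> Q s''" for Q
    unfolding push_prog_def using bnd bnd'
    by (simp add: g(3) bc) (rule that; simp add: bc)
  show ?thesis
  proof (rule upd)
    fix s'' :: store assume s'': "\<And>a. a \<notin> {''pc'', ''g'', ''c'', ''bk'', ''bc''} \<Longrightarrow> itab s'' a = itab s a"
        "itab s'' ''bk'' = (itab s ''bk'')(int (card {h \<in> R. f h = Some ?\<kappa>}) # ?ep # ?\<kappa> := int g)"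
        "itab s'' ''bc'' = (itab s ''bc'')(?ep # ?\<kappa> := int (card {h \<in> R. f h = Some ?\<kappa>}) + 1)"
        "itab s'' ''pc'' [] = ?pc - 1" "itab s'' ''g'' [] = int g"
        "itab s'' ''c'' [] = int (card {h \<in> R. f h = Some ?\<kappa>})"
    have same: "itab s'' ''ep'' = itab s ''ep''" "itab s'' ''stk'' = itab s ''stk''" by (simp_all add: s''(1))
    have "bins R (f(g := Some ?\<kappa>)) s''"
      unfolding bins_def same none' s''(4) using g(4) bin'[OF s''(2,3)] by blast
    moreover have "\<forall>e \<kappa>. e \<noteq> ?ep \<longrightarrow> itab s'' ''bc'' (e # \<kappa>) = itab s ''bc'' (e # \<kappa>)"
      by (simp add: s''(3))
    ultimately show "\<exists>g\<in>R. f g = None \<and> itab s'' ''g'' [] = int g \<and> itab s'' ''pc'' [] = ?pc - 1 \<and> 0 < ?pc \<and>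
      bins R (f(g := Some (cv s g))) s'' \<and> itab s'' ''c'' [] = int (card {h \<in> R. f h = Some (cv s g)}) \<and>
      (\<forall>e \<kappa>. e \<noteq> ?ep \<longrightarrow> itab s'' ''bc'' (e # \<kappa>) = itab s ''bc'' (e # \<kappa>))"
      using g(1,2) s''(4-6) pc(1) by blast
  qed
qed

text \<open>Resetting the count empties the bucket, but its entries remain in \<open>bk\<close> and
  can still be copied to \<open>gg\<close> afterwards.\<close>

lemma vc_collect:
  assumes bin: "\<And>\<kappa>. enum (\<lambda>x. itab s ''bk'' (x # itab s ''ep'' [] # \<kappa>)) (itab s ''bc'' (itab s ''ep'' [] # \<kappa>))
      {h \<in> R. f h = Some \<kappa>}"
    and C: "C = {h \<in> R. f h = Some (cellv n s (itab s ''g'' []))}" "card C = n" "C \<subseteq> {1..m}"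
  shows "vc W (collect_prog n) (\<lambda>s'. (\<forall>a. a \<notin> {''bc'', ''gg''} \<longrightarrow> itab s' a = itab s a) \<and> rtab s' = rtab s \<and> out s' = out s \<and>
    itab s' ''bc'' = (itab s ''bc'')(itab s ''ep'' [] # cellv n s (itab s ''g'' []) := 0) \<and>
    (\<exists>gs. goods_ok gs s' \<and> bij_betw gs {0..<n} C)) s"
proof -
  let ?ep = "itab s ''ep'' []" and ?\<kappa> = "cellv n s (itab s ''g'' [])"
  let ?A = "\<lambda>x. itab s ''bk'' (x # ?ep # ?\<kappa>)"
  define gs where "gs x = nat (?A (int x))" for x
  have en: "enum ?A (int n) C" using bin[of ?\<kappa>] enum_card(2)[OF bin[of ?\<kappa>]] C(1,2) by simp
  have A: "?A (int x) = int (gs x)" "gs x \<in> C" if "x < n" for x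
    using enum_mem[OF en, of "int x"] that by (auto simp: gs_def)
  have bij: "bij_betw gs {0..<n} C"
    unfolding bij_betw_def
  proof
    show "inj_on gs {0..<n}"
    proof (rule inj_onI)
      fix x y assume "x \<in> {0..<n}" "y \<in> {0..<n}" "gs x = gs y"
      then show "x = y" using enum_inj[OF en, of "int x" "int y"] A(1)[of x] A(1)[of y] by simp
    qed
    then have "card (gs ` {0..<n}) = n" by (simp add: card_image)
    moreover have "gs ` {0..<n} \<subseteq> C" using A(2) by auto
    moreover have "finite C" using C(3) finite_subset by blast
    ultimately show "gs ` {0..<n} = C" using C(2) by (metis card_subset_eq)
  qed
  let ?I = "\<lambda>l (s' :: store). (\<forall>a. a \<notin> {''bc'', ''gg''} \<longrightarrow> itab s' a = itab s a) \<and> rtab s' = rtab s \<and> out s' = out s \<and>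
    itab s' ''bc'' = (itab s ''bc'')(?ep # ?\<kappa> := 0) \<and> (\<forall>x<l. itab s' ''gg'' [int x] = int (gs x))"
  have "vc W (seqs (map (\<lambda>x. ISet ''gg'' [IConst (int x)] (IGet ''bk'' (IConst (int x) # V ''ep'' # cell n (V ''g'')))) [0..<n]))
    (?I (length [0..<n])) (iupdate ''bc'' (?ep # ?\<kappa>) 0 s)"
  proof (rule vc_seqs_map)
    fix l s' assume "l < length [0..<n]" and I: "?I l s'"
    then have l: "l < n" "[0..<n] ! l = l" by auto
    have oth: "itab s' a = itab s a" if "a \<notin> {''bc'', ''gg''}" for a using I that by blast
    have ggs: "itab s' ''gg'' [int x] = int (gs x)" if "x < l" for x using I that by blast
    have cell: "cellv n s' x = cellv n s x" for x by (rule cellv_cong, rule oth) auto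
    have same: "itab s' ''bk'' = itab s ''bk''" "itab s' ''g'' = itab s ''g''" "itab s' ''ep'' = itab s ''ep''"
      by (simp_all add: oth)
    have bcs: "itab s' ''bc'' = (itab s ''bc'')(?ep # ?\<kappa> := 0)" and rest: "rtab s' = rtab s" "out s' = out s" using I by blast+
    have "gs l \<in> {1..m}" using A(2)[OF l(1)] C(3) by blast
    then have "int (gs l) \<le> int W" using W by auto
    then show "vc W (ISet ''gg'' [IConst (int ([0..<n] ! l))] (IGet ''bk'' (IConst (int ([0..<n] ! l)) # V ''ep'' # cell n (V ''g''))))
      (?I (Suc l)) s'"
      unfolding l using A(1)[OF l(1)] by (auto simp: cell same oth ggs bcs rest less_Suc_eq simp del: of_nat_Suc)
  qed simp
  then have "vc W (collect_prog n) (?I n) s" by (simp add: collect_prog_def)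
  then show ?thesis
  proof (rule vc_mono)
    fix s' assume I: "?I n s'"
    then have "goods_ok gs s'" by (simp add: goods_ok_def)
    then show "(\<forall>a. a \<notin> {''bc'', ''gg''} \<longrightarrow> itab s' a = itab s a) \<and> rtab s' = rtab s \<and> out s' = out s \<and>
      itab s' ''bc'' = (itab s ''bc'')(?ep # ?\<kappa> := 0) \<and> (\<exists>gs. goods_ok gs s' \<and> bij_betw gs {0..<n} C)"
      using I bij by blast
  qed
qed

lemma vc_return:
  assumes en: "enum (\<lambda>x. itab s ''stk'' [x]) (itab s ''pc'' []) S" and gs: "goods_ok gs s"
    and bij: "bij_betw gs {0..<n} C" and "S \<inter> C = {}" "C \<subseteq> {1..m}" "S \<subseteq> {1..m}"
  shows "vc W (return_prog n) (\<lambda>s'. (\<forall>a. a \<notin> {''stk'', ''pc''} \<longrightarrow> itab s' a = itab s a) \<and> rtab s' = rtab s \<and> out s' = out s \<and>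
    itab s' ''pc'' [] = itab s ''pc'' [] + int n \<and> enum (\<lambda>x. itab s' ''stk'' [x]) (itab s' ''pc'' []) (S \<union> C)) s"
proof -
  let ?pc = "itab s ''pc'' []"
  have mem: "gs x \<in> C" if "x < n" for x using bij that by (auto simp: bij_betw_def)
  let ?I = "\<lambda>l (s' :: store). (\<forall>a. a \<noteq> ''stk'' \<longrightarrow> itab s' a = itab s a) \<and> rtab s' = rtab s \<and> out s' = out s \<and>
    enum (\<lambda>x. itab s' ''stk'' [x]) (?pc + int l) (S \<union> gs ` {0..<l})"
  have "vc W (seqs (map (\<lambda>x. ISet ''stk'' [IAdd (V ''pc'') (IConst (int x))] (IGet ''gg'' [IConst (int x)])) [0..<n]))
    (?I (length [0..<n])) s"
  proof (rule vc_seqs_map)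
    show "?I 0 s" using en by simp
    fix l s' assume "l < length [0..<n]" and I: "?I l s'"
    then have l: "l < n" "[0..<n] ! l = l" by auto
    have "gs l \<in> {1..m}" using mem[OF l(1)] assms(5) by blast
    then have gW: "int (gs l) \<le> int W" using W by auto
    have new: "gs l \<notin> S \<union> gs ` {0..<l}"
    proof
      assume "gs l \<in> S \<union> gs ` {0..<l}"
      then obtain x where x: "x < l" "gs l = gs x" using mem[OF l(1)] assms(4) by auto
      have "l = x" by (rule inj_onD[OF bij_betw_imp_inj_on[OF bij] x(2)]) (use l x in auto)
      then show False using x by simp
    qed
    have set: "S \<union> gs ` {0..<Suc l} = insert (gs l) (S \<union> gs ` {0..<l})" by (auto simp: less_Suc_eq)
    have gg: "itab s ''gg'' [int l] = int (gs l)" "itab s' ''gg'' [int l] = int (gs l)" "itab s' ''pc'' [] = ?pc"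
      using I gs l by (auto simp: goods_ok_def)
    have "enum (\<lambda>x. if x = ?pc + int l then int (gs l) else itab s' ''stk'' [x]) (?pc + int l + 1) (insert (gs l) (S \<union> gs ` {0..<l}))"
      by (rule enum_push[OF _ new]) (use I in auto)
    then show "vc W (ISet ''stk'' [IAdd (V ''pc'') (IConst (int ([0..<n] ! l)))] (IGet ''gg'' [IConst (int ([0..<n] ! l))])) (?I (Suc l)) s'"
      unfolding l set using I gW by (simp add: gg algebra_simps)
  qed
  then have *: "vc W (seqs (map (\<lambda>x. ISet ''stk'' [IAdd (V ''pc'') (IConst (int x))] (IGet ''gg'' [IConst (int x)])) [0..<n]))
    (?I n) s" by simp
  have SC: "S \<union> gs ` {0..<n} = S \<union> C" using bij by (auto simp: bij_betw_def)
  show ?thesis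
    unfolding return_prog_def vc.simps
  proof (rule vc_mono[OF *])
    fix s' assume I: "?I n s'"
    then have en': "enum (\<lambda>x. itab s' ''stk'' [x]) (?pc + int n) (S \<union> C)" by (simp add: SC)
    have "finite (S \<union> C)" "S \<union> C \<subseteq> {1..m}" using assms(5,6) finite_subset by auto
    then have "card (S \<union> C) \<le> m" using card_mono[of "{1..m}" "S \<union> C"] by simp
    then have "?pc + int n \<le> int W" "0 \<le> ?pc + int n" using enum_card(2)[OF en'] W by auto
    then show "\<bar>ival s' (IAdd (V ''pc'') (IConst (int n)))\<bar> \<le> int W \<and>
      (\<lambda>s'. (\<forall>a. a \<notin> {''stk'', ''pc''} \<longrightarrow> itab s' a = itab s a) \<and> rtab s' = rtab s \<and> out s' = out s \<and>
        itab s' ''pc'' [] = ?pc + int n \<and> enum (\<lambda>x. itab s' ''stk'' [x]) (itab s' ''pc'' []) (S \<union> C))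
       (iupdate ''pc'' (map (ival s') []) (ival s' (IAdd (V ''pc'') (IConst (int n)))) s')"
      using I en' by simp
  qed
qed

lemma represents_cong:
  assumes "itab s' ''sig'' = itab s ''sig''" "itab s' ''bun'' = itab s ''bun''" "itab s' ''dg'' = itab s ''dg''"
    "rtab s' ''u'' = rtab s ''u''"
  shows "represents rd st s' \<longleftrightarrow> represents rd st s"
  by (simp only: represents_def owners_ok_def bundles_ok_def degrees_ok_def assms)

text \<open>The cell of a good reads only degree counters of that good, so updates at other goods
  leave it alone.\<close>

lemma cellv_local:
  assumes "\<And>a. a \<in> {''pt'', ''kind'', ''sc'', ''w''} \<Longrightarrow> itab s' a = itab s a"
    and "\<And>b. b \<in> {1..n} \<Longrightarrow> itab s' ''dg'' [int b, g] = itab s ''dg'' [int b, g]"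
  shows "cellv n s' g = cellv n s g"
proof -
  have "itab s' ''dg'' [1, g] = itab s ''dg'' [1, g]" using assms(2)[of 1] n3 by simp
  moreover have "itab s' ''dg'' [int j, g] = itab s ''dg'' [int j, g]" if "j \<in> set [2..<Suc n]" for j
    by (rule assms(2)) (use that in \<open>auto simp del: upt_Suc\<close>)
  ultimately show ?thesis
    unfolding cellv_def using assms(1) by (intro map_cong) (simp_all del: upt_Suc)
qed

text \<open>The common cell of the goods in C supplies the subcube, and the two bounds on k identify
  2 ^ a with the q prescribed for |R| = k * n goods. The new round is appended by handing it to the
  continuation.\<close>

lemma ran_step:
  assumes ran: "ran R st tr" and prog: "progress R k rd st s" and gr: "grid i a s"
    and k: "(2 ^ a) ^ (n - 1) \<le> k" "k < (2 * 2 ^ a) ^ (n - 1)"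
    and C: "C \<subseteq> R" "card C = n" "\<And>h. h \<in> C \<Longrightarrow> cv s h = \<kappa>" and bb: "bb_round n v C st \<rho> st'"
  shows "ran (R - C) st' (tr @ [\<rho>])"
  unfolding ran_def
proof (intro allI impI)
  fix tr' st2 assume run: "degree_ef1 n v E (phase_delta n E i) (R - C) st' tr' st2"
  have "C \<noteq> {}" using C(2) n3 by auto
  then obtain h where h: "h \<in> C" by blast
  then have "\<kappa> \<in> cells (n - 1) (2 ^ a)" using progress_cell(1)[OF prog gr, of h] C by auto
  note sub = subcube_of_cell[OF this]
  have q: "2 ^ a = (2::nat) ^ nat \<lfloor>log 2 (real k powr (1 / real (n - 1)))\<rfloor>"
    using grid_exponent[OF _ k] n3 by simp
  have "degree_ef1 n v E (phase_delta n E i) R st (\<rho> # tr') st2"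
  proof (rule degree_ef1.step[OF _ _ q C(1,2) sub _ bb run])
    show "R \<noteq> {}" using h C(1) by blast
    show "k * n = card R" using prog by (simp add: progress_def)
    have "real_of_int (profile E (snd st) g j) \<in> piece (phase_delta n E i) (2 ^ a) (nat (\<kappa> ! (j - 2)))"
      if "g \<in> C" "j \<in> {2..n}" for g j
      using progress_cell(2)[OF prog gr subsetD[OF C(1) that(1)] that(2)] unfolding C(3)[OF that(1)] .
    then show "\<forall>g\<in>C. (\<lambda>j. real_of_int (profile E (snd st) g j)) \<in>
      {x. \<forall>j\<in>{2..n}. x j \<in> piece (phase_delta n E i) (2 ^ a) (nat (\<kappa> ! (j - 2)))}" by blast
  qed
  then have "degree_ef1 n v E (phase_delta n E i) L st0 (tr @ \<rho> # tr') st2"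
    using ran unfolding ran_def by blast
  then show "degree_ef1 n v E (phase_delta n E i) L st0 ((tr @ [\<rho>]) @ tr') st2" by simp
qed

abbreviation inner_post :: "nat \<Rightarrow> nat set \<Rightarrow> nat \<Rightarrow> nat \<Rightarrow> store \<Rightarrow> bool" where
  "inner_post a R \<phi> N s' \<equiv> \<exists>R' f' k' rd' st'. inner_inv a R' f' k' rd' st' s' \<and> R' \<subseteq> R \<and>
    inner_pot R' f' s' + N + 1 \<le> \<phi>"

text \<open>The situation right after a bucket has been filled and emptied again into \<open>gg\<close>: \<open>C\<close> is the set of
  its goods, \<open>f\<close> still assigns them to the bucket \<open>\<kappa>\<close>.\<close>

definition emptied :: "nat \<Rightarrow> nat set \<Rightarrow> (nat \<Rightarrow> int list option) \<Rightarrow> nat \<Rightarrow> nat \<Rightarrow> state \<Rightarrow> int list \<Rightarrow> nat set \<Rightarrow> store \<Rightarrow> bool" where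
  "emptied a R f k rd st \<kappa> C s \<longleftrightarrow> progress R k rd st s \<and> grid i a s \<and>
    enum (\<lambda>x. itab s ''stk'' [x]) (itab s ''pc'' []) {g \<in> R. f g = None} \<and>
    (\<forall>\<kappa>'. enum (\<lambda>x. itab s ''bk'' (x # itab s ''ep'' [] # \<kappa>')) (itab s ''bc'' (itab s ''ep'' [] # \<kappa>'))
      {g \<in> R - C. f g = Some \<kappa>'}) \<and>
    (\<forall>\<kappa>'. card {g \<in> R - C. f g = Some \<kappa>'} < n) \<and> (\<forall>g\<in>R. \<forall>\<kappa>. f g = Some \<kappa> \<longrightarrow> \<kappa> \<in> cells (n - 1) (2 ^ a)) \<and>
    (\<forall>e \<kappa>. itab s ''ep'' [] < e \<longrightarrow> itab s ''bc'' (e # \<kappa>) = 0) \<and>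
    (2 ^ a) ^ (n - 1) \<le> k \<and> k < (2 * 2 ^ a) ^ (n - 1) \<and>
    C = {g \<in> R. f g = Some \<kappa>} \<and> card C = n \<and> cellv n s (itab s ''g'' []) = \<kappa> \<and>
    (\<exists>gs. goods_ok gs s \<and> bij_betw gs {0..<n} C)"

text \<open>The n goods that become pending again are paid for by y, which is no longer stale and so
  releases n units. The unit on top of the potential was released by the preceding push; it pays for
  the iteration.\<close>

lemma wp_return:
  assumes em: "emptied a R f k rd st \<kappa> C s" and y: "y \<in> C" "cv s y \<noteq> \<kappa>"
  shows "wp W (return_prog n) (inner_post a R (inner_pot R f s + 1)) s"
proof -
  obtain gs where gs: "goods_ok gs s" "bij_betw gs {0..<n} C" using em by (auto simp: emptied_def)
  have prog: "progress R k rd st s" and gr: "grid i a s" and C: "C = {g \<in> R. f g = Some \<kappa>}"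
    and en: "enum (\<lambda>x. itab s ''stk'' [x]) (itab s ''pc'' []) {g \<in> R. f g = None}"
    and bin: "\<And>\<kappa>'. enum (\<lambda>x. itab s ''bk'' (x # itab s ''ep'' [] # \<kappa>')) (itab s ''bc'' (itab s ''ep'' [] # \<kappa>')) {g \<in> R - C. f g = Some \<kappa>'}"
    and small: "\<And>\<kappa>'. card {g \<in> R - C. f g = Some \<kappa>'} < n"
    and rng: "\<And>g \<kappa>. g \<in> R \<Longrightarrow> f g = Some \<kappa> \<Longrightarrow> \<kappa> \<in> cells (n - 1) (2 ^ a)"
    and fresh: "\<And>e \<kappa>. itab s ''ep'' [] < e \<Longrightarrow> itab s ''bc'' (e # \<kappa>) = 0" and k: "k < (2 * 2 ^ a) ^ (n - 1)"
    using em unfolding emptied_def by blast+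
  note R = card_R_le[OF prog]
  define f' where "f' h = (if h \<in> C then None else f h)" for h
  have S: "{g \<in> R. f' g = None} = {g \<in> R. f g = None} \<union> C" "\<And>\<kappa>'. {g \<in> R. f' g = Some \<kappa>'} = {g \<in> R - C. f g = Some \<kappa>'}"
    using C by (auto simp: f'_def)
  have disj: "{g \<in> R. f g = None} \<inter> C = {}" and Cm: "C \<subseteq> {1..m}" and Sm: "{g \<in> R. f g = None} \<subseteq> {1..m}"
    using C R(3) by auto
  show ?thesis
  proof (rule wp_mono[OF wp_vc[OF vc_return[OF en gs disj Cm Sm]]], elim conjE)
    fix N and s' :: store
    assume N: "N = (0::nat)" and same: "\<forall>a. a \<notin> {''stk'', ''pc''} \<longrightarrow> itab s' a = itab s a" "rtab s' = rtab s" "out s' = out s"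
      and pc: "itab s' ''pc'' [] = itab s ''pc'' [] + int n"
      and en': "enum (\<lambda>x. itab s' ''stk'' [x]) (itab s' ''pc'' []) ({g \<in> R. f g = None} \<union> C)"
    have oth: "itab s' a = itab s a" if "a \<notin> {''stk'', ''pc''}" for a using same(1) that by blast
    have cv: "cv s' h = cv s h" for h by (rule cellv_cong, rule oth) auto
    have prog': "progress R k rd st s'" by (rule progress_cong[OF prog same(3,2)], rule oth) auto
    have gr': "grid i a s'" by (rule grid_cong[OF gr], rule oth) auto
    have eqs: "itab s' ''ep'' = itab s ''ep''" "itab s' ''bk'' = itab s ''bk''" "itab s' ''bc'' = itab s ''bc''"
      by (simp_all add: oth)
    have "bins R f' s'" unfolding bins_def S eqs using en' bin by blast
    then have "inner_inv a R f' k rd st s'"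
      unfolding inner_inv_def S eqs using prog' gr' small fresh k rng
      by (auto simp: f'_def split: if_splits)
    moreover have "inner_pot R f' s' + 1 \<le> inner_pot R f s + 1"
    proof -
      have "stale R f' s' \<subseteq> stale R f s - {y}" using y(1) unfolding stale_def cv by (auto simp: f'_def split: if_splits)
      moreover have ys: "y \<in> stale R f s" using y C by (auto simp: stale_def)
      moreover have fin: "finite (stale R f s)" using R(1) by (simp add: stale_def)
      ultimately have "card (stale R f' s') \<le> card (stale R f s - {y})" by (intro card_mono) auto
      also have "\<dots> = card (stale R f s) - 1" using ys fin by simp
      finally have "card (stale R f' s') + 1 \<le> card (stale R f s)" using ys fin card_gt_0_iff[of "stale R f s"] by fastforce
      then have "n * (card (stale R f' s') + 1) \<le> n * card (stale R f s)" by (rule mult_le_mono2)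
      moreover have "0 \<le> itab s ''pc'' []" using en by (simp add: enum_def)
      ultimately show ?thesis unfolding inner_pot_def pc by (simp add: nat_add_distrib)
    qed
    ultimately show "inner_post a R (inner_pot R f s + 1) N s'" using N
      by (intro exI[of _ R] exI[of _ f'] exI[of _ k] exI[of _ rd] exI[of _ st]) simp
  qed
qed

text \<open>Only neighbours of C can change their cells. The degrees of C leave the potential with
  weight n + 1: per edge end, n units for a good that may have become stale and one for the update
  of a counter.\<close>

lemma wp_round:
  assumes em: "emptied a R f k rd st \<kappa> C s" and good: "\<And>y. y \<in> C \<Longrightarrow> cv s y = \<kappa>"
  shows "wp W (round_prog n ;; ''k'' ::= ISub (V ''k'') (IConst 1)) (inner_post a R (inner_pot R f s + 1)) s"
proof -
  obtain gs where gs: "goods_ok gs s" "bij_betw gs {0..<n} C" using em by (auto simp: emptied_def)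
  have prog: "progress R k rd st s" and gr: "grid i a s" and C: "C = {g \<in> R. f g = Some \<kappa>}" and Cn: "card C = n"
    and en: "enum (\<lambda>x. itab s ''stk'' [x]) (itab s ''pc'' []) {g \<in> R. f g = None}"
    and bin: "\<And>\<kappa>'. enum (\<lambda>x. itab s ''bk'' (x # itab s ''ep'' [] # \<kappa>')) (itab s ''bc'' (itab s ''ep'' [] # \<kappa>')) {g \<in> R - C. f g = Some \<kappa>'}"
    and small: "\<And>\<kappa>'. card {g \<in> R - C. f g = Some \<kappa>'} < n"
    and rng: "\<And>g \<kappa>. g \<in> R \<Longrightarrow> f g = Some \<kappa> \<Longrightarrow> \<kappa> \<in> cells (n - 1) (2 ^ a)"
    and fresh: "\<And>e \<kappa>. itab s ''ep'' [] < e \<Longrightarrow> itab s ''bc'' (e # \<kappa>) = 0"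
    and k: "(2 ^ a) ^ (n - 1) \<le> k" "k < (2 * 2 ^ a) ^ (n - 1)"
    using em unfolding emptied_def by blast+
  note R = card_R_le[OF prog]
  have st: "static s" and rep: "represents rd (fst st, snd st) s" and un: "unalloc s = R \<union> U" and "R \<subseteq> L"
    and cardR: "card R = k * n" and nx: "(rd + k) * n = nx" and kk: "itab s ''k'' [] = int k"
    using prog by (auto simp: progress_def)
  obtain tr where tr: "out s = out0 @ concat (map (log_round n) tr)" "ran R st tr" using prog by (auto simp: progress_def)
  have CR: "C \<subseteq> R" "C \<inter> U = {}" using C \<open>R \<subseteq> L\<close> LU by auto
  have k0: "0 < k" using k(1) by (metis gr0I le_zero_eq power_not_zero zero_neq_numeral)
  then obtain k' where k': "k = Suc k'" by (cases k) auto
  have "adj_ok s" "values_ok s" using st by (simp_all add: static_def)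
  note round = round_prog_correct[OF this rep gs]
  have CU: "C \<subseteq> unalloc s" using CR un by blast
  show ?thesis
  proof (rule wp_SeqI[OF wp_frame[OF round[OF CU]]], elim conjE exE)
    fix N and s1 :: store and \<rho> \<sigma>' B'
    assume fr: "framed (round_prog n) s s1" and bb: "bb_round n v C (fst st, snd st) \<rho> (\<sigma>', B')"
      and rep1: "represents (Suc rd) (\<sigma>', B') s1" and out1: "out s1 = out s @ log_round n \<rho>" and un1: "unalloc s1 = unalloc s - C"
      and dg1: "\<forall>b\<in>{1..n}. \<forall>x\<in>{1..m} - (\<Union>g\<in>C. nbrs g). itab s1 ''dg'' [int b, int x] = itab s ''dg'' [int b, int x]"
      and N: "N \<le> (\<Sum>g\<in>C. deg g)"
    have oth: "itab s1 a = itab s a" if "a \<notin> {''sig'', ''bun'', ''dg'', ''h''}" for a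
      using fr that writes_round_prog(1)[of n] unfolding framed_def by blast
    have "''v'' \<notin> rwrites (round_prog n)" using writes_round_prog(2)[of n] by auto
    then have v1: "rtab s1 ''v'' = rtab s ''v''" using fr unfolding framed_def by blast
    let ?s2 = "iupdate ''k'' [] (int k') s1"
    have oth2: "itab ?s2 a = itab s a" if "a \<notin> {''sig'', ''bun'', ''dg'', ''h'', ''k''}" for a
      using oth that by auto
    have st2: "static ?s2" by (rule static_cong[OF st], rule oth2) (use v1 in auto)
    have gr2: "grid i a ?s2" by (rule grid_cong[OF gr], rule oth2) auto
    have rep2: "represents (Suc rd) (\<sigma>', B') ?s2"
      using rep1 by (subst represents_cong[of _ s1]) simp_all
    have un2: "unalloc ?s2 = (R - C) \<union> U" using un1 un CR by (auto simp: unalloc_def)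
    have card2: "card (R - C) = k' * n"
      using card_Diff_subset[of C R] CR finite_subset[OF CR(1) R(1)] cardR Cn k' by simp
    have ran2: "ran (R - C) (\<sigma>', B') (tr @ [\<rho>])"
      by (rule ran_step[OF tr(2) prog gr k CR(1) Cn good]) (use bb in auto)
    have out2: "out ?s2 = out0 @ concat (map (log_round n) (tr @ [\<rho>]))" using out1 tr(1) by simp
    have prog2: "progress (R - C) k' (Suc rd) (\<sigma>', B') ?s2"
      unfolding progress_def
    proof (intro conjI exI[of _ "tr @ [\<rho>]"])
      show "(Suc rd + k') * n = nx" using nx k' by simp
    qed (use st2 rep2 un2 card2 ran2 out2 \<open>R \<subseteq> L\<close> in \<open>auto simp del: concat_append map_append\<close>)
    have S: "{g \<in> R - C. f g = None} = {g \<in> R. f g = None}" using C by auto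
    have eqs: "itab ?s2 ''ep'' = itab s ''ep''" "itab ?s2 ''bk'' = itab s ''bk''" "itab ?s2 ''bc'' = itab s ''bc''"
      "itab ?s2 ''stk'' = itab s ''stk''" "itab ?s2 ''pc'' = itab s ''pc''"
      by (simp_all add: oth)
    have "bins (R - C) f ?s2" unfolding bins_def S eqs using en bin by blast
    then have inv2: "inner_inv a (R - C) f k' (Suc rd) (\<sigma>', B') ?s2"
      unfolding inner_inv_def eqs using prog2 gr2 small fresh k k' rng by auto
    let ?D = "\<Sum>g\<in>C. deg g"
    have cv2: "cv ?s2 h = cv s h" if "h \<in> R - (\<Union>g\<in>C. nbrs g)" for h
    proof (rule cellv_local)
      show "itab ?s2 a = itab s a" if "a \<in> {''pt'', ''kind'', ''sc'', ''w''}" for a by (rule oth2) (use that in auto)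
      have "h \<in> {1..m} - (\<Union>g\<in>C. nbrs g)" using that R(3) by blast
      then show "itab ?s2 ''dg'' [int b, int h] = itab s ''dg'' [int b, int h]" if "b \<in> {1..n}" for b
        using dg1 that by simp
    qed
    have finC: "finite C" using CR(1) R(1) finite_subset by blast
    have "stale (R - C) f ?s2 \<subseteq> stale R f s \<union> (\<Union>g\<in>C. nbrs g)" using cv2 by (fastforce simp: stale_def)
    then have "card (stale (R - C) f ?s2) \<le> card (stale R f s \<union> (\<Union>g\<in>C. nbrs g))"
      using R(1) finC by (intro card_mono) (auto simp: stale_def)
    also have "\<dots> \<le> card (stale R f s) + card (\<Union>g\<in>C. nbrs g)" by (rule card_Un_le)
    also have "\<dots> \<le> card (stale R f s) + ?D" using card_UN_le[OF finC, of nbrs] by simp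
    finally have "n * card (stale (R - C) f ?s2) \<le> n * (card (stale R f s) + ?D)" by (rule mult_le_mono2)
    moreover have "(\<Sum>g\<in>R. deg g) = (\<Sum>g\<in>R - C. deg g) + ?D" using sum.subset_diff[OF CR(1) R(1)] by blast
    ultimately have pot: "inner_pot (R - C) f ?s2 + N \<le> inner_pot R f s"
      unfolding inner_pot_def eqs using N by (simp add: algebra_simps)
    have "int k' \<le> int W"
    proof -
      have "k * 1 \<le> k * n" using n3 by (intro mult_le_mono2) simp
      then show ?thesis using cardR R(2) k' W by simp
    qed
    then show "wp W (''k'' ::= ISub (V ''k'') (IConst 1)) (\<lambda>N'. inner_post a R (inner_pot R f s + 1) (N + N')) s1"
    proof (intro wp_straight)
      have "inner_inv a (R - C) f k' (Suc rd) (\<sigma>', B') ?s2 \<and> R - C \<subseteq> R \<and>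
        inner_pot (R - C) f ?s2 + (N + 0) + 1 \<le> inner_pot R f s + 1" using inv2 pot by auto
      then have "inner_post a R (inner_pot R f s + 1) (N + 0) ?s2" by blast
      moreover have "\<bar>ival s1 (ISub (V ''k'') (IConst 1))\<bar> \<le> int W" "ival s1 (ISub (V ''k'') (IConst 1)) = int k'"
        using \<open>int k' \<le> int W\<close> oth[of "''k''"] kk k' by simp_all
      ultimately show "vc W (''k'' ::= ISub (V ''k'') (IConst 1)) (inner_post a R (inner_pot R f s + 1) (N + 0)) s1"
        by (simp only: vc.simps list.map simp_thms)
    qed
  qed
qed

text \<open>The pushed good leaves the stack and enters its current cell, so it is not stale, and
  one unit of potential is released. As every bucket had fewer than n goods, only the bucket just
  used can have become full.\<close>

lemma inner_step:
  assumes inv: "inner_inv a R f k rd st s" and cond: "(2 ^ a) ^ (n - 1) \<le> k"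
  shows "wp W (inner_body n) (inner_post a R (inner_pot R f s)) s"
  unfolding inner_body_def
proof (rule wp_SeqI[OF wp_frame[OF wp_vc[OF vc_push[OF inv cond]]]], elim conjE bexE)
  let ?ep = "itab s ''ep'' []" and ?pc = "itab s ''pc'' []"
  fix N and s1 :: store and g
  assume N: "N = (0::nat)" and fr: "framed (push_prog n) s s1" and g: "g \<in> R" "f g = None" "itab s1 ''g'' [] = int g"
    and pc: "itab s1 ''pc'' [] = ?pc - 1" "0 < ?pc" and bins1: "bins R (f(g := Some (cv s g))) s1"
    and c1: "itab s1 ''c'' [] = int (card {h \<in> R. f h = Some (cv s g)})"
    and fresh1: "\<forall>e \<kappa>. e \<noteq> ?ep \<longrightarrow> itab s1 ''bc'' (e # \<kappa>) = itab s ''bc'' (e # \<kappa>)"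
  let ?\<kappa> = "cv s g"
  let ?f = "f(g := Some ?\<kappa>)"
  have prog: "progress R k rd st s" and gr: "grid i a s"
    and small: "\<And>\<kappa>. card {g \<in> R. f g = Some \<kappa>} < n"
    and rng: "\<And>g \<kappa>. g \<in> R \<Longrightarrow> f g = Some \<kappa> \<Longrightarrow> \<kappa> \<in> cells (n - 1) (2 ^ a)"
    and fresh: "\<And>e \<kappa>. ?ep < e \<Longrightarrow> itab s ''bc'' (e # \<kappa>) = 0" and k: "k < (2 * 2 ^ a) ^ (n - 1)"
    using inv unfolding inner_inv_def by blast+
  note R = card_R_le[OF prog]
  have oth: "itab s1 a = itab s a" if "a \<notin> {''pc'', ''g'', ''c'', ''bk'', ''bc''}" for a
    using fr that by (auto simp: framed_def push_prog_def)
  have same: "rtab s1 = rtab s" "out s1 = out s" using fr by (auto simp: framed_def push_prog_def)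
  have cv: "cellv n s1 h = cellv n s h" for h by (rule cellv_cong, rule oth) auto
  have ep1: "itab s1 ''ep'' [] = ?ep" by (simp add: oth)
  have prog1: "progress R k rd st s1" by (rule progress_cong[OF prog same(2,1)], rule oth) auto
  have gr1: "grid i a s1" by (rule grid_cong[OF gr], rule oth) auto
  have rng1: "\<kappa> \<in> cells (n - 1) (2 ^ a)" if "h \<in> R" "?f h = Some \<kappa>" for h \<kappa>
    using that rng progress_cell(1)[OF prog gr g(1)] by (auto split: if_splits)
  have fresh': "itab s1 ''bc'' (e # \<kappa>) = 0" if "itab s1 ''ep'' [] < e" for e \<kappa>
    using that fresh[of e \<kappa>] fresh1 unfolding ep1 by auto
  have stale1: "stale R ?f s1 = stale R f s" using g(1,2) unfolding stale_def cv by auto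
  have "nat (?pc - 1) + 1 = nat ?pc" using pc(2) by simp
  then have pot1: "inner_pot R ?f s1 + 1 = inner_pot R f s" unfolding inner_pot_def pc(1) stale1 by simp
  have set: "{h \<in> R. ?f h = Some \<kappa>'} = (if \<kappa>' = ?\<kappa> then insert g {h \<in> R. f h = Some ?\<kappa>} else {h \<in> R. f h = Some \<kappa>'})" for \<kappa>'
    using g(1,2) by auto
  have cardg: "card (insert g {h \<in> R. f h = Some ?\<kappa>}) = Suc (card {h \<in> R. f h = Some ?\<kappa>})"
    using g(2) R(1) by simp
  show "wp W (Cond (IEq (V ''c'') (IConst (int n - 1)))
      (collect_prog n ;; Cond (same_cell n) (round_prog n ;; ''k'' ::= ISub (V ''k'') (IConst 1)) (return_prog n)) Skip)
    (\<lambda>N'. inner_post a R (inner_pot R f s) (N + N')) s1"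
  proof (rule wp_Cond)
    assume "\<not> bval s1 (IEq (V ''c'') (IConst (int n - 1)))"
    then have "card {h \<in> R. f h = Some ?\<kappa>} + 1 \<noteq> n" using c1 by auto
    then have "card {h \<in> R. ?f h = Some \<kappa>'} < n" for \<kappa>'
      using small[of \<kappa>'] small[of ?\<kappa>] cardg unfolding set by auto
    then have "inner_inv a R ?f k rd st s1"
      unfolding inner_inv_def using prog1 gr1 bins1 rng1 fresh' k by blast
    then have "inner_post a R (inner_pot R f s) 0 s1" using pot1
      by (intro exI[of _ R] exI[of _ ?f] exI[of _ k] exI[of _ rd] exI[of _ st]) simp
    then show "wp W Skip (\<lambda>N'. inner_post a R (inner_pot R f s) (N + N')) s1"
      by (intro wp_straight) (simp add: N)
  next
    assume "bval s1 (IEq (V ''c'') (IConst (int n - 1)))"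
    then have full: "card {h \<in> R. f h = Some ?\<kappa>} + 1 = n" using c1 by auto
    define C where "C = {h \<in> R. ?f h = Some ?\<kappa>}"
    have \<kappa>1: "cellv n s1 (itab s1 ''g'' []) = ?\<kappa>" by (simp add: g(3) cv)
    have Cn: "card C = n" unfolding C_def set using full cardg by simp
    have Cm: "C \<subseteq> {1..m}" using R(3) by (auto simp: C_def)
    have bin1: "\<And>\<kappa>. enum (\<lambda>x. itab s1 ''bk'' (x # itab s1 ''ep'' [] # \<kappa>)) (itab s1 ''bc'' (itab s1 ''ep'' [] # \<kappa>)) {h \<in> R. ?f h = Some \<kappa>}"
      and none1: "enum (\<lambda>x. itab s1 ''stk'' [x]) (itab s1 ''pc'' []) {h \<in> R. ?f h = None}"
      using bins1 unfolding bins_def by blast+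
    have C1: "C = {h \<in> R. ?f h = Some (cellv n s1 (itab s1 ''g'' []))}" by (simp only: C_def \<kappa>1)
    show "wp W (collect_prog n ;; Cond (same_cell n) (round_prog n ;; ''k'' ::= ISub (V ''k'') (IConst 1)) (return_prog n))
      (\<lambda>N'. inner_post a R (inner_pot R f s) (N + N')) s1"
    proof (rule wp_SeqI[OF wp_vc[OF vc_collect[OF bin1 C1 Cn Cm]]], elim conjE exE)
      fix N2 and s2 :: store and gs
      assume N2: "N2 = (0::nat)" and o2: "\<forall>a. a \<notin> {''bc'', ''gg''} \<longrightarrow> itab s2 a = itab s1 a" "rtab s2 = rtab s1" "out s2 = out s1"
        and bc2: "itab s2 ''bc'' = (itab s1 ''bc'')(itab s1 ''ep'' [] # cellv n s1 (itab s1 ''g'' []) := 0)"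
        and gs: "goods_ok gs s2" "bij_betw gs {0..<n} C"
      have oth2: "itab s2 a = itab s1 a" if "a \<notin> {''bc'', ''gg''}" for a using o2(1) that by blast
      have eq2: "itab s2 ''ep'' = itab s1 ''ep''" "itab s2 ''bk'' = itab s1 ''bk''" "itab s2 ''stk'' = itab s1 ''stk''"
        "itab s2 ''pc'' = itab s1 ''pc''" "itab s2 ''g'' = itab s1 ''g''" by (simp_all add: oth2)
      have cv2: "cellv n s2 h = cellv n s1 h" for h by (rule cellv_cong, rule oth2) auto
      have set2: "{h \<in> R - C. ?f h = Some \<kappa>'} = (if \<kappa>' = ?\<kappa> then {} else {h \<in> R. f h = Some \<kappa>'})" for \<kappa>'
        using g(1,2) by (auto simp: C_def)
      have bin2: "enum (\<lambda>x. itab s2 ''bk'' (x # itab s2 ''ep'' [] # \<kappa>')) (itab s2 ''bc'' (itab s2 ''ep'' [] # \<kappa>')) {h \<in> R - C. ?f h = Some \<kappa>'}" for \<kappa>'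
      proof (cases "\<kappa>' = ?\<kappa>")
        case False
        then show ?thesis using bin1[of \<kappa>'] unfolding set2 set eq2 bc2 \<kappa>1 by simp
      next
        case True
        then show ?thesis unfolding set2 eq2 bc2 \<kappa>1 by simp
      qed
      have small2: "card {h \<in> R - C. ?f h = Some \<kappa>'} < n" for \<kappa>' using small[of \<kappa>'] n3 unfolding set2 by simp
      have "progress R k rd st s2" by (rule progress_cong[OF prog1 o2(3,2)], rule oth2) auto
      moreover have "grid i a s2" by (rule grid_cong[OF gr1], rule oth2) auto
      moreover have "itab s2 ''bc'' (e # \<kappa>) = 0" if "itab s2 ''ep'' [] < e" for e \<kappa>
        using that fresh'[of e \<kappa>] unfolding eq2 bc2 by simp
      moreover have "cellv n s2 (itab s1 ''g'' []) = ?\<kappa>" by (simp only: cv2 \<kappa>1)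
      ultimately have em: "emptied a R ?f k rd st ?\<kappa> C s2"
        unfolding emptied_def using none1 bin2 small2 rng1 cond k C_def Cn gs unfolding eq2 by blast
      have "inner_pot R ?f s2 = inner_pot R ?f s1"
        by (simp add: inner_pot_def stale_def cv2 eq2)
      then have pot2: "inner_pot R ?f s2 + 1 = inner_pot R f s" using pot1 by simp
      have ggC: "(\<forall>x<n. P (itab s2 ''gg'' [int x])) \<longleftrightarrow> (\<forall>y\<in>C. P (int y))" for P
        using gs by (auto simp: goods_ok_def bij_betw_def)
      have sc: "bval s2 (same_cell n) \<longleftrightarrow> (\<forall>y\<in>C. cv s2 y = ?\<kappa>)"
        unfolding bval_same_cell eq2 cv2 \<kappa>1 by (rule ggC[of "\<lambda>z. cellv n s1 z = ?\<kappa>"])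
      have "wp W (Cond (same_cell n) (round_prog n ;; ''k'' ::= ISub (V ''k'') (IConst 1)) (return_prog n))
        (inner_post a R (inner_pot R ?f s2 + 1)) s2"
      proof (rule wp_Cond)
        show "wp W (round_prog n ;; ''k'' ::= ISub (V ''k'') (IConst 1)) (inner_post a R (inner_pot R ?f s2 + 1)) s2"
          if "bval s2 (same_cell n)" using wp_round[OF em] that sc by blast
        show "wp W (return_prog n) (inner_post a R (inner_pot R ?f s2 + 1)) s2"
          if "\<not> bval s2 (same_cell n)" using wp_return[OF em] that sc by blast
      qed
      then show "wp W (Cond (same_cell n) (round_prog n ;; ''k'' ::= ISub (V ''k'') (IConst 1)) (return_prog n))
        (\<lambda>N'. inner_post a R (inner_pot R f s) (N + (N2 + N'))) s2" unfolding pot2 N N2 add_0 .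
    qed
  qed
qed

lemma inner_loop_correct:
  assumes "inner_inv a R f k rd st s"
  shows "wp W (inner_loop n) (\<lambda>N s'. \<exists>R' f' k' rd' st'. inner_inv a R' f' k' rd' st' s' \<and> R' \<subseteq> R \<and>
    k' < (2 ^ a) ^ (n - 1) \<and> inner_pot R' f' s' + N \<le> inner_pot R f s) s"
proof -
  let ?b = "ile (ipow (V ''q'') (n - 1)) (V ''k'')"
  let ?I = "\<lambda>\<phi> (s' :: store). \<exists>R' f' k' rd' st'. inner_inv a R' f' k' rd' st' s' \<and> R' \<subseteq> R \<and> \<phi> = inner_pot R' f' s'"
  have b: "bval s' ?b \<longleftrightarrow> (2 ^ a) ^ (n - 1) \<le> k'" if "inner_inv a R' f' k' rd' st' s'" for s' R' f' k' rd' st'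
  proof -
    have "itab s' ''q'' [] = 2 ^ a" "itab s' ''k'' [] = int k'"
      using that by (auto simp: inner_inv_def grid_def progress_def)
    moreover have "((2::int) ^ a) ^ (n - 1) \<le> int k' \<longleftrightarrow> (2 ^ a) ^ (n - 1) \<le> k'"
      by (metis of_nat_le_iff of_nat_numeral of_nat_power)
    ultimately show ?thesis by (simp add: not_less)
  qed
  have I0: "?I (inner_pot R f s) s" using assms by blast
  have "wp W (While ?b (inner_body n)) (\<lambda>N s'. \<exists>\<phi>'. ?I \<phi>' s' \<and> \<not> bval s' ?b \<and> \<phi>' + N \<le> inner_pot R f s) s"
  proof (rule wp_While[where I = ?I, OF I0])
    fix \<phi> s assume "?I \<phi> s" and bv: "bval s ?b"
    then obtain R' f' k' rd' st' where *: "inner_inv a R' f' k' rd' st' s" "R' \<subseteq> R" "\<phi> = inner_pot R' f' s" by blast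
    show "wp W (inner_body n) (\<lambda>N s'. \<exists>\<phi>'. ?I \<phi>' s' \<and> \<phi>' + N + 1 \<le> \<phi>) s"
      by (rule wp_mono[OF inner_step[OF *(1)]]) (use b[OF *(1)] bv *(2,3) in blast)+
  qed
  then show ?thesis
    unfolding inner_loop_def
  proof (rule wp_mono, elim exE conjE)
    fix N and s' :: store and \<phi> R' f' k' rd' st'
    assume *: "inner_inv a R' f' k' rd' st' s'" "R' \<subseteq> R" "\<phi> = inner_pot R' f' s'" "\<not> bval s' ?b" "\<phi> + N \<le> inner_pot R f s"
    then have "k' < (2 ^ a) ^ (n - 1)" using b[OF *(1)] by (simp add: not_le)
    then show "\<exists>R' f' k' rd' st'. inner_inv a R' f' k' rd' st' s' \<and> R' \<subseteq> R \<and>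
      k' < (2 ^ a) ^ (n - 1) \<and> inner_pot R' f' s' + N \<le> inner_pot R f s" using * by blast
  qed
qed

end

section \<open>The program: phases\<close>

text \<open>Rounds do not delete their goods from the list of the epoch. Allocated goods are
  recognised by a nonzero entry in \<open>bun\<close> and dropped when the list of the next epoch is
  made.\<close>

definition filter_body :: com where
  "filter_body =
    ''g'' ::= IGet ''cur'' [V ''ep'', V ''j''] ;;
    Cond (IEq (IGet ''bun'' [V ''g'']) (IConst 0))
      (ISet ''stk'' [V ''pc''] (V ''g'') ;; ISet ''cur'' [IAdd (V ''ep'') (IConst 1), V ''pc''] (V ''g'') ;;
       incr ''pc'' [])
      Skip ;;
    incr ''j'' []"

text \<open>The buckets are indexed by an epoch number \<open>ep\<close>, so that they need not be emptied when the
  grid changes.\<close>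

definition epoch_body :: "nat \<Rightarrow> com" where
  "epoch_body n =
    ''w'' ::= IDiv (V ''Q'') (V ''q'') ;; ''j'' ::= IConst 0 ;; ''pc'' ::= IConst 0 ;;
    While (ILess (V ''j'') (V ''cn'')) filter_body ;;
    incr ''ep'' [] ;; ''cn'' ::= V ''pc'' ;;
    inner_loop n ;;
    ''q'' ::= IDiv (V ''q'') (IConst 2)"

definition grid_prog :: "nat \<Rightarrow> com" where
  "grid_prog n = ''k'' ::= IDiv (V ''cn'') (IConst (int n)) ;; ''q'' ::= IConst 1 ;;
    While (ile (ipow (IMul (IConst 2) (V ''q'')) (n - 1)) (V ''k'')) (''q'' ::= IMul (IConst 2) (V ''q''))"

definition take_body :: com where
  "take_body = ISet ''cur'' [V ''ep'', V ''cn''] (IGet ''ord'' [V ''pos'']) ;; incr ''cn'' [] ;; incr ''pos'' []"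

definition take_prog :: "nat \<Rightarrow> com" where
  "take_prog n =
    Cond (ILess (IAdd (V ''pos'') (IMul (V ''sc'') (IMul (IConst (int n)) (V ''r'')))) (V ''m''))
      (''nx'' ::= IAdd (V ''pos'') (IMul (V ''sc'') (IMul (IConst (int n)) (V ''r''))))
      (''nx'' ::= V ''m'') ;;
    ''cn'' ::= IConst 0 ;;
    While (ILess (V ''pos'') (V ''nx'')) take_body"

definition phase_body :: "nat \<Rightarrow> com" where
  "phase_body n =
    take_prog n ;; grid_prog n ;;
    While (ILess (IConst 0) (V ''k'')) (epoch_body n) ;;
    Cond (IEq (V ''kind'') (IConst 0)) (''kind'' ::= IConst 1) (''sc'' ::= IMul (V ''sc'') (IConst 2))"

lemma writes_inner_loop:
  "iwrites (inner_loop n) \<subseteq> {''pc'', ''g'', ''c'', ''bk'', ''bc'', ''gg'', ''stk'', ''k'', ''sig'', ''bun'', ''dg'', ''h''}"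
  (is "_ \<subseteq> ?A")
proof -
  have "iwrites (push_prog n) \<subseteq> ?A" by (simp add: push_prog_def)
  moreover have "iwrites (collect_prog n) \<subseteq> ?A" by (simp add: collect_prog_def)
  moreover have "iwrites (return_prog n) \<subseteq> ?A" by (simp add: return_prog_def)
  moreover have "iwrites (round_prog n) \<subseteq> ?A" by (rule order.trans[OF writes_round_prog(1)]) simp
  ultimately show ?thesis by (simp only: inner_loop_def inner_body_def iwrites.simps Un_subset_iff) simp
qed

section \<open>Epochs: halving the number of intervals\<close>

text \<open>An epoch with q intervals filters at most n * (4 q) ^ (n - 1) list entries and makes at
  most n * (2 q) ^ (n - 1) goods pending; the 1 is for the epoch itself. The factor 2 sums the
  geometric series, as halving q divides q ^ (n - 1) by at least 2.\<close>

definition epoch_const :: "nat \<Rightarrow> nat" where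
  "epoch_const n = 2 * (n * 4 ^ (n - 1) + n * 2 ^ (n - 1) + 1)"

context phase_data
begin

lemma pow_le_W:
  assumes "a \<le> lgQ"
  shows "(2::int) ^ a \<le> int W"
proof -
  have "(2::int) ^ a \<le> 2 ^ lgQ" using assms by (intro power_increasing) auto
  moreover have "int (2 ^ lgQ) < int (2 * m)" using lgQ_bounds(2) by (simp only: of_nat_less_iff)
  then have "(2::int) ^ lgQ < 2 * int m" by simp
  ultimately show ?thesis using W_int by linarith
qed

lemma wp_filter:
  assumes cur: "enum (\<lambda>x. itab s ''cur'' [itab s ''ep'' [], x]) (itab s ''cn'' []) S" and S: "S \<subseteq> L" "R \<subseteq> S"
    and un: "unalloc s = R \<union> U" and j: "itab s ''j'' [] = 0" and pc: "itab s ''pc'' [] = 0"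
  shows "wp W (While (ILess (V ''j'') (V ''cn'')) filter_body) (\<lambda>N s'.
    enum (\<lambda>x. itab s' ''stk'' [x]) (itab s' ''pc'' []) R \<and>
    enum (\<lambda>x. itab s' ''cur'' [itab s ''ep'' [] + 1, x]) (itab s' ''pc'' []) R \<and> N \<le> card S) s"
proof -
  let ?ep = "itab s ''ep'' []"
  define A where "A x = itab s ''cur'' [?ep, int x]" for x
  define K where "K = card S"
  have cn: "itab s ''cn'' [] = int K" using enum_card(2)[OF cur] by (simp add: K_def)
  have A: "\<exists>g\<in>S. A x = int g" if "x < K" for x
    using enum_mem[OF cur, of "int x"] that cn by (simp add: A_def)
  have Ainj: "x = y" if "x < K" "y < K" "A x = A y" for x y
    using enum_inj[OF cur, of "int x" "int y"] that cn by (simp add: A_def)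
  have Aex: "\<exists>x<K. A x = int g" if "g \<in> S" for g
    using enum_ex[OF cur that] cn unfolding A_def by (metis nonneg_int_cases of_nat_less_iff)
  have Sm: "S \<subseteq> {1..m}" using S L by blast
  define P where "P l = {g \<in> R. \<exists>x<l. A x = int g}" for l
  let ?I = "\<lambda>l (s' :: store). itab s' ''j'' [] = int l \<and>
    (\<forall>a. a \<notin> {''g'', ''stk'', ''cur'', ''pc'', ''j''} \<longrightarrow> itab s' a = itab s a) \<and>
    (\<forall>x. itab s' ''cur'' [?ep, x] = itab s ''cur'' [?ep, x]) \<and>
    enum (\<lambda>x. itab s' ''stk'' [x]) (itab s' ''pc'' []) (P l) \<and>
    enum (\<lambda>x. itab s' ''cur'' [?ep + 1, x]) (itab s' ''pc'' []) (P l)"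
  have "wp W (While (ILess (V ''j'') (V ''cn'')) filter_body) (\<lambda>N s'. ?I K s' \<and> N \<le> K) s"
  proof (rule wp_for[where I = ?I])
    show "?I 0 s" by (simp add: j pc P_def)
    fix l and s' :: store assume I: "?I l s'"
    then have oth: "itab s' a = itab s a" if "a \<notin> {''g'', ''stk'', ''cur'', ''pc'', ''j''}" for a using that by blast
    have j': "itab s' ''j'' [] = int l" and cur': "\<And>x. itab s' ''cur'' [?ep, x] = itab s ''cur'' [?ep, x]"
      and en: "enum (\<lambda>x. itab s' ''stk'' [x]) (itab s' ''pc'' []) (P l)"
        "enum (\<lambda>x. itab s' ''cur'' [?ep + 1, x]) (itab s' ''pc'' []) (P l)" using I by blast+
    show "bval s' (ILess (V ''j'') (V ''cn'')) \<longleftrightarrow> l < K" if "l \<le> K" by (simp add: j' oth cn)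
    assume l: "l < K"
    obtain g where g: "g \<in> S" "A l = int g" using A[OF l] by blast
    have gm: "g \<in> {1..m}" using g(1) Sm by blast
    have gR: "g \<in> R \<longleftrightarrow> itab s ''bun'' [int g] = 0"
    proof -
      have "g \<in> R \<longleftrightarrow> g \<in> unalloc s" using un g(1) S LU by auto
      then show ?thesis using gm by (simp add: unalloc_def)
    qed
    have "P l \<subseteq> {1..m}" using S Sm by (auto simp: P_def)
    then have "card (P l) \<le> m" using card_mono[of "{1..m}" "P l"] by simp
    then have pcW: "\<bar>itab s' ''pc'' [] + 1\<bar> \<le> int W" "0 \<le> itab s' ''pc'' []"
      using enum_card(2)[OF en(1)] W_int m3 by linarith+
    have "K \<le> m" unfolding K_def using card_mono[of "{1..m}" S] Sm by simp
    then have bnd: "\<bar>int l + 1\<bar> \<le> int W" "int g \<le> int W" using l W gm by auto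
    have Al: "itab s ''cur'' [?ep, int l] = int g" using g(2) by (simp add: A_def)
    have ep: "itab s' ''ep'' [] = ?ep" "itab s' ''bun'' = itab s ''bun''" by (simp_all add: oth)
    have new: "g \<notin> P l"
    proof
      assume "g \<in> P l"
      then obtain x where "x < l" "A x = A l" using g(2) by (auto simp: P_def)
      then show False using Ainj[of x l] l by simp
    qed
    have PS: "P (Suc l) = (if g \<in> R then insert g (P l) else P l)"
      using g(2) by (auto simp: P_def less_Suc_eq)
    show "vc W filter_body (?I (Suc l)) s'"
    proof (cases "g \<in> R")
      case True
      have e1: "enum (\<lambda>x. if x = itab s' ''pc'' [] then int g else itab s' ''stk'' [x]) (itab s' ''pc'' [] + 1) (insert g (P l))"
        by (rule enum_push[OF en(1) new]) auto
      have e2: "enum (\<lambda>x. if x = itab s' ''pc'' [] then int g else itab s' ''cur'' [?ep + 1, x]) (itab s' ''pc'' [] + 1) (insert g (P l))"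
        by (rule enum_push[OF en(2) new]) auto
      have "itab s ''bun'' [int g] = 0" using True gR by simp
      then show ?thesis
        unfolding filter_body_def PS using True bnd pcW e1 e2
        by (simp add: j' ep cur' Al oth)
    next
      case False
      then have "itab s ''bun'' [int g] \<noteq> 0" using gR by simp
      then show ?thesis
        unfolding filter_body_def PS using False bnd en
        by (simp add: j' ep cur' Al oth)
    qed
  qed
  moreover have "P K = R"
  proof -
    have "\<exists>x<K. A x = int g" if "g \<in> R" for g using Aex S(2) that by blast
    then show ?thesis by (auto simp: P_def)
  qed
  ultimately show ?thesis unfolding K_def by (elim wp_mono) auto
qed

text \<open>S is the list of the preceding epoch, or L at first. In the preceding epoch q was twice
  as large, whence the 4 in the bound on S. The bound on \<open>ep\<close> reserves a number for
  each of the a + 1 epochs that may still come. The claims about the grid assume 0 < k, because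
  halving q = 1 leaves 0.\<close>

definition epoch_inv :: "nat \<Rightarrow> nat set \<Rightarrow> nat set \<Rightarrow> nat \<Rightarrow> nat \<Rightarrow> state \<Rightarrow> store \<Rightarrow> bool" where
  "epoch_inv a S R k rd st s \<longleftrightarrow> progress R k rd st s \<and> a \<le> lgQ \<and>
    itab s ''kind'' [] = (if i = 0 then 0 else 1) \<and> itab s ''sc'' [] = int (phase_scale i) \<and>
    (0 < k \<longrightarrow> itab s ''q'' [] = 2 ^ a) \<and>
    enum (\<lambda>x. itab s ''cur'' [itab s ''ep'' [], x]) (itab s ''cn'' []) S \<and> R \<subseteq> S \<and> S \<subseteq> L \<and>
    (0 < k \<longrightarrow> card S \<le> n * (4 * 2 ^ a) ^ (n - 1) \<and> k < (2 * 2 ^ a) ^ (n - 1)) \<and>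
    (\<forall>e \<kappa>. itab s ''ep'' [] < e \<longrightarrow> itab s ''bc'' (e # \<kappa>) = 0) \<and>
    0 \<le> itab s ''ep'' [] \<and> itab s ''ep'' [] + (if 0 < k then int a + 1 else 0) \<le> int (rd + k)"

definition epoch_pot :: "nat \<Rightarrow> nat set \<Rightarrow> nat \<Rightarrow> nat" where
  "epoch_pot a R k = (if 0 < k then epoch_const n * (2 ^ a) ^ (n - 1) else 0) + (n + 1) * (\<Sum>g\<in>R. deg g)"

text \<open>With X = q ^ (n - 1), the budget 2 * (c + 1) * X splits into c * X + X for the current
  epoch and (c + 1) * X for all later ones.\<close>

lemma epoch_pot_decreases:
  assumes "card S \<le> n * (4 * 2 ^ a) ^ (n - 1)" "k < (2 * 2 ^ a) ^ (n - 1)"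
    and "N1 \<le> card S" "(n + 1) * (\<Sum>g\<in>R'. deg g) + N2 \<le> k * n + (n + 1) * (\<Sum>g\<in>R. deg g)" "0 < k"
    and "0 < k' \<Longrightarrow> a = Suc a'"
  shows "epoch_pot a' R' k' + (N1 + N2) + 1 \<le> epoch_pot a R k"
proof -
  define X where "X = ((2::nat) ^ a) ^ (n - 1)"
  define c where "c = n * 4 ^ (n - 1) + n * 2 ^ (n - 1)"
  have X1: "1 \<le> X" by (simp add: X_def)
  have ec: "epoch_const n = (c + 1) * 2" by (simp add: epoch_const_def c_def)
  have "N1 \<le> n * 4 ^ (n - 1) * X" using assms(1,3) by (simp add: power_mult_distrib X_def)
  moreover have "k * n \<le> n * 2 ^ (n - 1) * X"
    using mult_le_mono1[OF less_imp_le[OF assms(2)], of n] by (simp add: power_mult_distrib X_def mult.commute)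
  moreover have "c * X = n * 4 ^ (n - 1) * X + n * 2 ^ (n - 1) * X" by (simp only: c_def distrib_right)
  ultimately have 1: "N1 + k * n \<le> c * X" by linarith
  have 2: "(if 0 < k' then epoch_const n * (2 ^ a') ^ (n - 1) else 0) \<le> (c + 1) * X"
  proof (cases "0 < k'")
    case True
    then have a: "a = Suc a'" using assms(6) by simp
    have "(2::nat) ^ 1 \<le> 2 ^ (n - 1)" using n3 by (intro power_increasing) auto
    then have "2 * (2 ^ a') ^ (n - 1) \<le> X"
      using mult_le_mono1[of 2 "2 ^ (n - 1)" "((2::nat) ^ a') ^ (n - 1)"] by (simp add: X_def a power_mult_distrib)
    then have "(c + 1) * (2 * (2 ^ a') ^ (n - 1)) \<le> (c + 1) * X" by (rule mult_le_mono2)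
    then show ?thesis using True by (simp only: ec mult.assoc if_True)
  qed simp
  have "epoch_const n * X = c * X + (c + 1) * X + X" by (simp add: ec algebra_simps)
  then have "(if 0 < k' then epoch_const n * (2 ^ a') ^ (n - 1) else 0) + (N1 + k * n) + 1 \<le> epoch_const n * X"
    using 1 2 X1 by linarith
  then show ?thesis using assms(4,5) unfolding epoch_pot_def X_def by simp
qed

lemma epoch_step:
  assumes inv: "epoch_inv a S R k rd st s" and k: "0 < k"
  shows "wp W (epoch_body n) (\<lambda>N s'. \<exists>a' S' R' k' rd' st'. epoch_inv a' S' R' k' rd' st' s' \<and>
    epoch_pot a' R' k' + N + 1 \<le> epoch_pot a R k) s"
proof -
  let ?ep = "itab s ''ep'' []"
  have prog: "progress R k rd st s" and a: "a \<le> lgQ" and kind: "itab s ''kind'' [] = (if i = 0 then 0 else 1)"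
    and sc: "itab s ''sc'' [] = int (phase_scale i)" and q: "itab s ''q'' [] = 2 ^ a"
    and cur: "enum (\<lambda>x. itab s ''cur'' [?ep, x]) (itab s ''cn'' []) S" and S: "R \<subseteq> S" "S \<subseteq> L"
    and cS: "card S \<le> n * (4 * 2 ^ a) ^ (n - 1)" and k2: "k < (2 * 2 ^ a) ^ (n - 1)"
    and fresh: "\<And>e \<kappa>. ?ep < e \<Longrightarrow> itab s ''bc'' (e # \<kappa>) = 0"
    and ep: "0 \<le> ?ep" "?ep + (int a + 1) \<le> int (rd + k)"
    using inv k unfolding epoch_inv_def by auto
  note R = card_R_le[OF prog]
  have Q: "itab s ''Q'' [] = 2 ^ lgQ" and un: "unalloc s = R \<union> U" and cardR: "card R = k * n" and nx: "(rd + k) * n = nx"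
    using prog by (auto simp: progress_def static_def)
  have wW: "(2::int) ^ (lgQ - a) \<le> int W" by (rule pow_le_W) simp
  have wdef: "(2::int) ^ lgQ div 2 ^ a = 2 ^ (lgQ - a)" using a by (simp add: power_diff)
  let ?s1 = "iupdate ''pc'' [] 0 (iupdate ''j'' [] 0 (iupdate ''w'' [] (2 ^ (lgQ - a)) s))"
  \<comment> \<open>Epoch numbers have to fit into words. They are bounded by rd + k, and this by m:
    n * rd goods are in bundles and n * k are in R.\<close>
  have rkm: "int (rd + k) \<le> int m"
  proof -
    have "n * rd + card (unalloc s) \<le> m"
    proof -
      have rep: "represents rd st s" using prog by (simp add: progress_def)
      have Bb: "snd st b = {g \<in> {1..m}. itab s ''bun'' [int g] = int b}" "card (snd st b) = rd" if "b \<in> {1..n}" for b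
        using rep that by (auto simp: represents_def bundles_ok_def)
      have "card ((\<Union>b\<in>{1..n}. snd st b) \<union> unalloc s) = card (\<Union>b\<in>{1..n}. snd st b) + card (unalloc s)"
        by (rule card_Un_disjoint) (auto simp: Bb(1) unalloc_def)
      also have "card (\<Union>b\<in>{1..n}. snd st b) = (\<Sum>b\<in>{1..n}. card (snd st b))"
        by (rule card_UN_disjoint) (auto simp: Bb(1))
      also have "\<dots> = n * rd" using Bb(2) by simp
      finally have "n * rd + card (unalloc s) = card ((\<Union>b\<in>{1..n}. snd st b) \<union> unalloc s)" by simp
      also have "\<dots> \<le> card {1..m}" by (rule card_mono) (auto simp: Bb(1) unalloc_def)
      finally show ?thesis by simp
    qed
    moreover have "finite (unalloc s)" by (simp add: unalloc_def)
    then have "card R \<le> card (unalloc s)" by (rule card_mono) (simp add: un)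
    ultimately have "n * (rd + k) \<le> m" using cardR by (simp add: algebra_simps)
    moreover have "rd + k \<le> n * (rd + k)" using n3 by simp
    ultimately show ?thesis by linarith
  qed
  have filter: "wp W (While (ILess (V ''j'') (V ''cn'')) filter_body) (\<lambda>N s'.
    enum (\<lambda>x. itab s' ''stk'' [x]) (itab s' ''pc'' []) R \<and>
    enum (\<lambda>x. itab s' ''cur'' [itab ?s1 ''ep'' [] + 1, x]) (itab s' ''pc'' []) R \<and> N \<le> card S) ?s1"
    by (rule wp_filter) (use cur S un in \<open>auto simp: unalloc_def\<close>)
  have "wp W (While (ILess (V ''j'') (V ''cn'')) filter_body ;;
    incr ''ep'' [] ;; ''cn'' ::= V ''pc'' ;; inner_loop n ;; ''q'' ::= IDiv (V ''q'') (IConst 2))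
    (\<lambda>N s'. \<exists>a' S' R' k' rd' st'. epoch_inv a' S' R' k' rd' st' s' \<and>
      epoch_pot a' R' k' + N + 1 \<le> epoch_pot a R k) ?s1"
  proof (rule wp_SeqI[OF wp_frame[OF filter]])
    fix N1 and s2 :: store
    assume s2: "(enum (\<lambda>x. itab s2 ''stk'' [x]) (itab s2 ''pc'' []) R \<and>
       enum (\<lambda>x. itab s2 ''cur'' [itab ?s1 ''ep'' [] + 1, x]) (itab s2 ''pc'' []) R \<and> N1 \<le> card S) \<and>
       framed (While (ILess (V ''j'') (V ''cn'')) filter_body) ?s1 s2"
    have ep1: "itab ?s1 ''ep'' [] = ?ep" by simp
    note s2 = s2[unfolded ep1]
    have oth2: "itab s2 b = itab ?s1 b" if "b \<notin> {''g'', ''stk'', ''cur'', ''pc'', ''j''}" for b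
      using s2 that by (auto simp: framed_def filter_body_def)
    have same2: "rtab s2 = rtab s" "out s2 = out s" using s2 by (auto simp: framed_def filter_body_def)
    let ?s3 = "iupdate ''cn'' [] (itab s2 ''pc'' []) (iupdate ''ep'' [] (?ep + 1) s2)"
    have oth3: "itab ?s3 b = itab s b" if "b \<notin> {''g'', ''stk'', ''cur'', ''pc'', ''j'', ''cn'', ''ep'', ''w''}" for b
      using oth2[of b] that by auto
    have prog3: "progress R k rd st ?s3"
      by (rule progress_cong[OF prog _ _ oth3]) (use same2 in auto)
    have w3: "itab ?s3 ''w'' [] = 2 ^ (lgQ - a)" "itab ?s3 ''bc'' = itab s ''bc''" "itab ?s3 ''kind'' = itab s ''kind''"
      "itab ?s3 ''sc'' = itab s ''sc''" "itab ?s3 ''q'' = itab s ''q''" "itab ?s3 ''ep'' [] = ?ep + 1"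
      "itab ?s3 ''pc'' = itab s2 ''pc''" "itab ?s3 ''cur'' = itab s2 ''cur''" "itab ?s3 ''stk'' = itab s2 ''stk''"
      "itab ?s3 ''cn'' [] = itab s2 ''pc'' []"
      by (simp_all add: oth2)
    have grid3: "grid i a ?s3" unfolding grid_def w3 using a kind sc q by simp
    have bins3: "bins R (\<lambda>_. None) ?s3"
      unfolding bins_def w3 using s2 fresh by simp
    have inner: "inner_inv a R (\<lambda>_. None) k rd st ?s3"
      unfolding inner_inv_def w3 using prog3 grid3 bins3 n3 k2 fresh by simp
    have pot3: "inner_pot R (\<lambda>_. None) ?s3 = k * n + (n + 1) * (\<Sum>g\<in>R. deg g)"
    proof -
      have "itab s2 ''pc'' [] = int (card R)" using s2 enum_card(2) by blast
      then have "nat (itab s2 ''pc'' []) = k * n" by (simp only: nat_int cardR)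
      then show ?thesis unfolding inner_pot_def w3 by (simp add: stale_def)
    qed
    have bnd: "\<bar>?ep + 1\<bar> \<le> int W" using ep rkm W_int by linarith
    have pcW: "\<bar>itab s2 ''pc'' []\<bar> \<le> int W"
    proof -
      have "itab s2 ''pc'' [] = int (card R)" using s2 enum_card(2) by blast
      then show ?thesis using R(2) W by simp
    qed
    have ep2: "itab s2 ''ep'' [] = ?ep" by (simp add: oth2)
    have main: "wp W (inner_loop n ;; ''q'' ::= IDiv (V ''q'') (IConst 2))
      (\<lambda>N2 s'. \<exists>a' S' R' k' rd' st'. epoch_inv a' S' R' k' rd' st' s' \<and>
        epoch_pot a' R' k' + (N1 + N2) + 1 \<le> epoch_pot a R k) ?s3"
    proof (rule wp_SeqI[OF wp_frame[OF inner_loop_correct[OF inner]]], elim conjE exE)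
      fix N2 and s4 :: store and R' f' k' rd' st'
      assume fr: "framed (inner_loop n) ?s3 s4" and inv4: "inner_inv a R' f' k' rd' st' s4" and R': "R' \<subseteq> R"
        and k': "k' < (2 ^ a) ^ (n - 1)" and pot4: "inner_pot R' f' s4 + N2 \<le> inner_pot R (\<lambda>_. None) ?s3"
      have oth4: "itab s4 b = itab ?s3 b"
        if "b \<notin> {''pc'', ''g'', ''c'', ''bk'', ''bc'', ''gg'', ''stk'', ''k'', ''sig'', ''bun'', ''dg'', ''h''}" for b
        using fr contra_subsetD[OF writes_inner_loop that] unfolding framed_def by blast
      have eq4: "itab s4 ''ep'' [] = ?ep + 1" "itab s4 ''kind'' = itab s ''kind''" "itab s4 ''sc'' = itab s ''sc''"
        "itab s4 ''q'' = itab s ''q''" "itab s4 ''cur'' = itab s2 ''cur''" "itab s4 ''cn'' [] = itab s2 ''pc'' []"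
        using oth4[of "''ep''"] oth4[of "''kind''"] oth4[of "''sc''"] oth4[of "''q''"] oth4[of "''cur''"] oth4[of "''cn''"] w3
        by simp_all
      let ?s5 = "iupdate ''q'' [] (2 ^ a div 2) s4"
      have prog4: "progress R' k' rd' st' s4" and fresh4: "\<And>e \<kappa>. ?ep + 1 < e \<Longrightarrow> itab s4 ''bc'' (e # \<kappa>) = 0"
        using inv4 unfolding inner_inv_def eq4 by blast+
      have prog5: "progress R' k' rd' st' ?s5" by (rule progress_cong[OF prog4]) auto
      have "(rd' + k') * n = (rd + k) * n" using prog4 nx by (simp add: progress_def)
      then have rk: "rd' + k' = rd + k" using n3 by simp
      \<comment> \<open>For a = 0 the loop ends only with k' < 1. As long as goods remain, the
        number of intervals can therefore be halved.\<close>
      have apos: "a = Suc (a - 1)" if "0 < k'"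
        using that k' by (cases a) auto
      have cR: "card R \<le> n * (4 * 2 ^ (a - 1)) ^ (n - 1)" if kp: "0 < k'"
      proof -
        obtain b where "a = Suc b" using apos[OF kp] by blast
        then have e4: "4 * 2 ^ (a - 1) = 2 * (2::nat) ^ a" by simp
        have "k \<le> (4 * 2 ^ (a - 1)) ^ (n - 1)" unfolding e4 using k2 by (rule less_imp_le)
        then show ?thesis unfolding cardR mult.commute[of n] by (rule mult_le_mono1)
      qed
      have k5: "k' < (2 * 2 ^ (a - 1)) ^ (n - 1)" if "0 < k'"
        using k' apos[OF that] by (metis power_Suc)
      have q5: "(2::int) ^ a div 2 = 2 ^ (a - 1)" if kp: "0 < k'"
      proof -
        obtain b where "a = Suc b" using apos[OF kp] by blast
        then show ?thesis by simp
      qed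
      have inv5: "epoch_inv (a - 1) R R' k' rd' st' ?s5"
        unfolding epoch_inv_def
      proof (intro conjI)
        show "0 < k' \<longrightarrow> itab ?s5 ''q'' [] = 2 ^ (a - 1)" using q5 by simp
        show "enum (\<lambda>x. itab ?s5 ''cur'' [itab ?s5 ''ep'' [], x]) (itab ?s5 ''cn'' []) R"
          using s2 by (simp add: eq4)
        show "itab ?s5 ''ep'' [] + (if 0 < k' then int (a - 1) + 1 else 0) \<le> int (rd' + k')"
        proof -
          have "int (a - 1) + 1 \<le> int a" if "0 < k'" using apos[OF that] by linarith
          then show ?thesis using ep(2) unfolding rk by (auto simp: eq4)
        qed
        show "\<forall>e \<kappa>. itab ?s5 ''ep'' [] < e \<longrightarrow> itab ?s5 ''bc'' (e # \<kappa>) = 0" using fresh4 by (simp add: eq4)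
      qed (use prog5 a kind sc R' S cR k5 ep(1) in \<open>auto simp: eq4\<close>)
      have "(n + 1) * (\<Sum>g\<in>R'. deg g) + N2 \<le> k * n + (n + 1) * (\<Sum>g\<in>R. deg g)"
        using pot4 unfolding pot3 by (simp add: inner_pot_def)
      then have "epoch_pot (a - 1) R' k' + (N1 + N2) + 1 \<le> epoch_pot a R k"
        using epoch_pot_decreases[OF cS k2 _ _ k apos] s2 by blast
      then have post: "\<exists>a' S' R' k' rd' st'. epoch_inv a' S' R' k' rd' st' ?s5 \<and>
        epoch_pot a' R' k' + (N1 + (N2 + 0)) + 1 \<le> epoch_pot a R k"
        using inv5 unfolding add_0_right by blast
      have "(2::int) ^ a \<le> int W" using a by (rule pow_le_W)
      moreover have "0 \<le> (2::int) ^ a" by simp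
      ultimately have "\<bar>(2::int) ^ a div 2\<bar> \<le> int W" by linarith
      then show "wp W (''q'' ::= IDiv (V ''q'') (IConst 2)) (\<lambda>N'. \<lambda>s'. \<exists>a' S' R' k' rd' st'. epoch_inv a' S' R' k' rd' st' s' \<and>
        epoch_pot a' R' k' + (N1 + (N2 + N')) + 1 \<le> epoch_pot a R k) s4"
      proof (intro wp_straight)
        have "ival s4 (IDiv (V ''q'') (IConst 2)) = 2 ^ a div 2" using q by (simp add: eq4)
        then show "vc W (''q'' ::= IDiv (V ''q'') (IConst 2)) (\<lambda>s'. \<exists>a' S' R' k' rd' st'. epoch_inv a' S' R' k' rd' st' s' \<and>
          epoch_pot a' R' k' + (N1 + (N2 + 0)) + 1 \<le> epoch_pot a R k) s4"
          using post \<open>\<bar>(2::int) ^ a div 2\<bar> \<le> int W\<close> by (simp only: vc.simps list.map simp_thms)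
      qed
    qed
    then show "wp W (incr ''ep'' [] ;; ''cn'' ::= V ''pc'' ;; inner_loop n ;; ''q'' ::= IDiv (V ''q'') (IConst 2))
      (\<lambda>N2 s'. \<exists>a' S' R' k' rd' st'. epoch_inv a' S' R' k' rd' st' s' \<and>
        epoch_pot a' R' k' + (N1 + N2) + 1 \<le> epoch_pot a R k) s2"
      by (intro wp_Set_Seq) (use bnd pcW in \<open>simp_all add: ep2\<close>)
  qed
  then show ?thesis
    unfolding epoch_body_def by (intro wp_Set_Seq) (use wW in \<open>simp_all add: wdef Q q\<close>)
qed

lemma epochs_correct:
  assumes "epoch_inv a S R k rd st s"
  shows "wp W (While (ILess (IConst 0) (V ''k'')) (epoch_body n)) (\<lambda>N s'. (\<exists>a' S' rd' st'. epoch_inv a' S' {} 0 rd' st' s') \<and>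
    N \<le> epoch_pot a R k) s"
proof -
  let ?b = "ILess (IConst 0) (V ''k'')"
  let ?I = "\<lambda>\<phi> (s' :: store). \<exists>a' S' R' k' rd' st'. epoch_inv a' S' R' k' rd' st' s' \<and> \<phi> = epoch_pot a' R' k'"
  have kk: "itab s' ''k'' [] = int k'" if "epoch_inv a' S' R' k' rd' st' s'" for a' S' R' k' rd' st' s'
    using that by (simp add: epoch_inv_def progress_def)
  have I0: "?I (epoch_pot a R k) s" using assms by blast
  have "wp W (While ?b (epoch_body n)) (\<lambda>N s'. \<exists>\<phi>'. ?I \<phi>' s' \<and> \<not> bval s' ?b \<and> \<phi>' + N \<le> epoch_pot a R k) s"
  proof (rule wp_While[where I = ?I, OF I0])
    fix \<phi> and s :: store assume "?I \<phi> s" and bv: "bval s ?b"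
    then obtain a' S' R' k' rd' st' where *: "epoch_inv a' S' R' k' rd' st' s" "\<phi> = epoch_pot a' R' k'" by blast
    then have "0 < k'" using bv kk by fastforce
    show "wp W (epoch_body n) (\<lambda>N s'. \<exists>\<phi>'. ?I \<phi>' s' \<and> \<phi>' + N + 1 \<le> \<phi>) s"
      by (rule wp_mono[OF epoch_step[OF *(1) \<open>0 < k'\<close>]]) (use *(2) in blast)
  qed
  then show ?thesis
  proof (rule wp_mono, elim exE conjE)
    fix N and s' :: store and \<phi> a' S' R' k' rd' st'
    assume *: "epoch_inv a' S' R' k' rd' st' s'" "\<not> bval s' ?b" "\<phi> + N \<le> epoch_pot a R k"
    have "k' = 0" using *(2) kk[OF *(1)] by simp
    moreover have "progress R' k' rd' st' s'" using *(1) by (simp add: epoch_inv_def)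
    then have "finite R'" "card R' = k' * n" using card_R_le by (blast, simp add: progress_def)
    ultimately have "k' = 0" "R' = {}" by auto
    then have "epoch_inv a' S' {} 0 rd' st' s'" using *(1) by simp
    moreover have "N \<le> epoch_pot a R k" using *(3) by linarith
    ultimately show "(\<exists>a' S' rd' st'. epoch_inv a' S' {} 0 rd' st' s') \<and> N \<le> epoch_pot a R k" by blast
  qed
qed

end

section \<open>Phases as segments of the degree order\<close>

text \<open>Truncated subtraction covers i = 0, where both sides hold as m \<ge> 2. Comparing the
  scale with m thus runs exactly the prescribed phases without computing a logarithm.\<close>

lemma phase_index_iff:
  assumes "2 \<le> m"
  shows "int i \<le> \<lceil>log 2 (real m)\<rceil> \<longleftrightarrow> 2 ^ (i - 1) < m"
proof (cases i)
  case 0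
  then show ?thesis using assms by (simp add: zero_le_log_cancel_iff le_ceiling_iff order.strict_trans2[of "-1" 0])
next
  case (Suc j)
  have "int i \<le> \<lceil>log 2 (real m)\<rceil> \<longleftrightarrow> int j < \<lceil>log 2 (real m)\<rceil>" by (simp add: Suc; linarith)
  also have "\<dots> \<longleftrightarrow> real j < log 2 (real m)" by (simp add: less_ceiling_iff)
  also have "\<dots> \<longleftrightarrow> 2 powr real j < real m" using assms by (subst less_log_iff) auto
  also have "\<dots> \<longleftrightarrow> real (2 ^ j) < real m" by (simp add: powr_realpow)
  also have "\<dots> \<longleftrightarrow> 2 ^ j < m" by (simp only: of_nat_less_iff)
  finally show ?thesis by (simp add: Suc)
qed

text \<open>Fixing \<open>od\<close> fixes how ties between degrees are broken; every phase then
  takes the next segment of this order.\<close>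

locale ordered_instance = instance_data +
  fixes od :: "nat \<Rightarrow> nat"
  assumes od: "bij_betw od {0..<m} {1..m}"
    and od_sorted: "\<And>x y. x \<le> y \<Longrightarrow> y < m \<Longrightarrow> deg (od y) \<le> deg (od x)"
begin

definition ord_is :: "store \<Rightarrow> bool" where
  "ord_is s \<longleftrightarrow> (\<forall>x<m. itab s ''ord'' [int x] = int (od x))"

text \<open>The number of goods taken before phase i. The phase sizes are n * \<open>rt\<close>
  times 1, 1, 2, 4, ..., and the partial sums of this sequence are again powers of two.\<close>

definition ppos :: "nat \<Rightarrow> nat" where
  "ppos i = (if i = 0 then 0 else min m (phase_scale i * n * rt))"

lemma ppos_Suc: "ppos (Suc i) = min m (ppos i + phase_scale i * n * rt)"
proof (cases i)
  case (Suc j)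
  have "phase_scale (Suc (Suc j)) = 2 * phase_scale (Suc j)" by (simp add: phase_scale_def)
  then show ?thesis unfolding Suc ppos_def by (simp add: min_def)
qed (simp add: ppos_def phase_scale_def)

lemma ppos_le: "ppos i \<le> m" "ppos i \<le> ppos (Suc i)"
  by (simp_all add: ppos_Suc) (simp_all add: ppos_def)

lemma n_dvd_ppos: "n dvd ppos i"
  using n_dvd_m by (simp add: ppos_def min_def)

lemma phase_size_eq: "phase_size n E i = phase_scale i * n * rt"
proof -
  have "nat (max (int i - 1) 0) = i - 1" by simp
  then show ?thesis by (simp add: phase_size_def phase_scale_def rt_def)
qed

lemma od_image: "A \<subseteq> {0..<m} \<Longrightarrow> B \<subseteq> {0..<m} \<Longrightarrow> od ` (A - B) = od ` A - od ` B"
  "A \<subseteq> {0..<m} \<Longrightarrow> card (od ` A) = card A" "x < m \<Longrightarrow> od x \<in> {1..m}"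
  using inj_on_image_set_diff[OF bij_betw_imp_inj_on[OF od], of A B]
    card_image[OF inj_on_subset[OF bij_betw_imp_inj_on[OF od], of A]] od
  by (auto simp: bij_betw_def)

abbreviation goods :: "nat \<Rightarrow> nat \<Rightarrow> nat set" where "goods x y \<equiv> od ` {x..<y}"

lemma goods_split:
  assumes "x \<le> y" "y \<le> z" "z \<le> m"
  shows "goods x z = goods x y \<union> goods y z" "goods x y \<inter> goods y z = {}" "goods x z - goods x y = goods y z"
proof -
  have "{x..<z} = {x..<y} \<union> {y..<z}" using assms by auto
  then show 1: "goods x z = goods x y \<union> goods y z" by auto
  have "{x..<y} - {y..<z} = {x..<y}" by auto
  then have "goods x y = goods x y - goods y z" using od_image(1)[of "{x..<y}" "{y..<z}"] assms by auto
  then show "goods x y \<inter> goods y z = {}" by blast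
  then show "goods x z - goods x y = goods y z" using 1 by blast
qed

lemma highest_degree_goods:
  "highest_degree E (goods (ppos i) m) (phase_size n E i) (goods (ppos i) (ppos (Suc i)))"
  unfolding highest_degree_def
proof (intro conjI ballI)
  have min_diff: "min x (p + y) - p = min y (x - p)" if "p \<le> x" for x y p :: nat
    using that by (cases "x \<le> p + y") (auto simp: min_def)
  note sp = goods_split[OF ppos_le(2)[of i] ppos_le(1)[of "Suc i"] order.refl]
  show "goods (ppos i) (ppos (Suc i)) \<subseteq> goods (ppos i) m" using sp(1) by blast
  have "card (goods (ppos i) (ppos (Suc i))) = ppos (Suc i) - ppos i" "card (goods (ppos i) m) = m - ppos i"
    using ppos_le[of i] ppos_le(1)[of "Suc i"] by (subst od_image(2); auto)+
  then show "card (goods (ppos i) (ppos (Suc i))) = min (phase_size n E i) (card (goods (ppos i) m))"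
    unfolding phase_size_eq unfolding ppos_Suc using min_diff[OF ppos_le(1)[of i]] by simp
  fix g h assume "g \<in> goods (ppos i) (ppos (Suc i))" "h \<in> goods (ppos i) m - goods (ppos i) (ppos (Suc i))"
  then obtain x y where "g = od x" "x < ppos (Suc i)" "h = od y" "ppos (Suc i) \<le> y" "y < m"
    unfolding sp(3) by auto
  then show "deg_in E UNIV h \<le> deg_in E UNIV g" unfolding deg_in_UNIV by (auto intro: od_sorted)
qed

text \<open>In phase 0 the bundles have at most \<open>rt\<close> goods each; later only goods of small degree are left,
  as the goods that precede them in the order all have at least their degree.\<close>

lemma phase_bound:
  assumes "g \<in> goods (ppos i) (ppos (Suc i))"
  shows "real (min (deg g) (ppos (Suc i) div n)) * real (phase_scale i) \<le> base_delta i"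
proof (cases "i = 0")
  case True
  have "ppos (Suc i) \<le> n * rt" using True by (simp add: ppos_Suc ppos_def phase_scale_def)
  then have "ppos (Suc i) div n \<le> rt" using n3 by (metis div_le_mono nonzero_mult_div_cancel_left not_numeral_le_zero)
  then show ?thesis using True by (simp add: base_delta_def phase_scale_def)
next
  case False
  obtain x where x: "g = od x" "ppos i \<le> x" "x < ppos (Suc i)" using assms by auto
  then have xm: "x < m" using ppos_le(1)[of "Suc i"] by linarith
  \<comment> \<open>As phase i contains a good, the cap m has not been reached before it.\<close>
  then have p: "ppos i = phase_scale i * n * rt" using x(2) False by (auto simp: ppos_def min_def split: if_splits)
  have "ppos i * deg g = (\<Sum>h\<in>goods 0 (ppos i). deg g)"
    using od_image(2)[of "{0..<ppos i}"] ppos_le(1)[of i] by simp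
  also have "\<dots> \<le> (\<Sum>h\<in>goods 0 (ppos i). deg h)"
    using x xm by (intro sum_mono) (auto intro: od_sorted)
  also have "\<dots> \<le> 2 * card E" by (rule sum_deg) simp
  finally have "real (phase_scale i * n * rt * deg g) \<le> real (2 * card E)" unfolding p by (simp only: of_nat_le_iff)
  then have 1: "real (deg g) * real (phase_scale i) * real n * real rt \<le> 2 * real (card E)" by (simp add: mult_ac)
  let ?r = "sqrt (real (card E))"
  have r: "0 < ?r" "?r * ?r = real (card E)" using E1 by simp_all
  \<comment> \<open>Replacing \<open>rt\<close> by the smaller sqrt |E| allows cancelling one root,
    which turns 2 * |E| into 2 * sqrt |E|, that is n times \<open>\<Delta>\<^sub>1\<close>.\<close>
  have "real (deg g) * real (phase_scale i) * real n * ?r \<le> real (deg g) * real (phase_scale i) * real n * real rt"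
    using rt_bounds(3) by (intro mult_left_mono) auto
  then have "real (deg g) * real (phase_scale i) * real n * ?r \<le> 2 * ?r * ?r" using 1 r(2) by linarith
  then have "real (deg g) * real (phase_scale i) * real n \<le> 2 * ?r" using r(1) by (simp only: mult_le_cancel_right_pos)
  then have "real (deg g) * real (phase_scale i) \<le> base_delta i"
    using False n3 by (simp add: base_delta_def \<Delta>\<^sub>1_def field_simps)
  moreover have "real (min (deg g) (ppos (Suc i) div n)) * real (phase_scale i) \<le> real (deg g) * real (phase_scale i)"
    by (intro mult_right_mono) auto
  ultimately show ?thesis by linarith
qed

section \<open>The chain of phases\<close>

text \<open>The counterpart of \<open>ran\<close> for whole phases: completed phases are described
  by what they do to an arbitrary continuation.\<close>

definition reached :: "nat \<Rightarrow> state \<Rightarrow> round list \<Rightarrow> bool" where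
  "reached i st tr \<longleftrightarrow> (\<forall>tr' st'. phases n m v E i (goods (ppos i) m) st tr' st' \<longrightarrow>
     phases n m v E 0 {1..m} (id, \<lambda>_. {}) (tr @ tr') st')"

definition phase_inv :: "nat \<Rightarrow> nat \<Rightarrow> state \<Rightarrow> store \<Rightarrow> bool" where
  "phase_inv i rd st s \<longleftrightarrow> static s \<and> ord_is s \<and> itab s ''kind'' [] = (if i = 0 then 0 else 1) \<and>
    itab s ''sc'' [] = int (phase_scale i) \<and> itab s ''pos'' [] = int (ppos i) \<and> represents rd st s \<and>
    rd * n = ppos i \<and> unalloc s = goods (ppos i) m \<and>
    (\<forall>e \<kappa>. itab s ''ep'' [] < e \<longrightarrow> itab s ''bc'' (e # \<kappa>) = 0) \<and> 0 \<le> itab s ''ep'' [] \<and> itab s ''ep'' [] \<le> int rd \<and>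
    (\<exists>tr. out s = concat (map (log_round n) tr) \<and> reached i st tr)"

text \<open>The growth of the scale pays for the phases themselves, with an extra unit for phase 0
  because phases 0 and 1 have equal scale. Each good pays 2 units for being taken and for the search
  of q, and \<open>epoch_const\<close> for the epochs; each edge end pays n + 1 units as in the
  bucket loop.\<close>

definition phase_pot :: "nat \<Rightarrow> nat" where
  "phase_pot i = (m - phase_scale i) + (if i = 0 then 1 else 0) + (epoch_const n + 2) * (m - ppos i) +
    (n + 1) * (\<Sum>g\<in>goods (ppos i) m. deg g)"

lemma wp_take:
  assumes "itab s ''pos'' [] = int (ppos i)" "itab s ''sc'' [] = int (phase_scale i)" "itab s ''r'' [] = int rt"
    "itab s ''m'' [] = int m" "ord_is s"
  shows "wp W (take_prog n) (\<lambda>N s'. itab s' ''pos'' [] = int (ppos (Suc i)) \<and>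
    enum (\<lambda>x. itab s' ''cur'' [itab s ''ep'' [], x]) (itab s' ''cn'' []) (goods (ppos i) (ppos (Suc i))) \<and>
    N \<le> ppos (Suc i) - ppos i) s"
proof -
  let ?p = "ppos i" and ?nx = "ppos (Suc i)" and ?ep = "itab s ''ep'' []"
  note le = ppos_le(2)[of i] ppos_le(1)[of "Suc i"]
  let ?I = "\<lambda>l (s' :: store). itab s' ''pos'' [] = int (?p + l) \<and> itab s' ''nx'' [] = int ?nx \<and> itab s' ''cn'' [] = int l \<and>
    itab s' ''ep'' [] = ?ep \<and> ord_is s' \<and> enum (\<lambda>x. itab s' ''cur'' [?ep, x]) (int l) (goods ?p (?p + l))"
  have loop: "wp W (While (ILess (V ''pos'') (V ''nx'')) take_body) (\<lambda>N s'. ?I (?nx - ?p) s' \<and> N \<le> ?nx - ?p) s0"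
    if "?I 0 s0" for s0
  proof (rule wp_for[where I = ?I, OF that])
    fix l and s' :: store assume I: "?I l s'"
    show "bval s' (ILess (V ''pos'') (V ''nx'')) \<longleftrightarrow> l < ?nx - ?p" if "l \<le> ?nx - ?p" using I le by auto
    assume l: "l < ?nx - ?p"
    then have pl: "?p + l < m" using le by linarith
    have ods: "itab s' ''ord'' [int (?p + l)] = int (od (?p + l))" using I pl by (simp only: ord_is_def)
    have "od (?p + l) \<in> {1..m}" using od_image(3)[OF pl] .
    then have oW: "int (od (?p + l)) \<le> int W" using W by auto
    have bnd: "int l + 1 \<le> int W" "int (?p + l) + 1 \<le> int W" using pl W_int by linarith+
    have g: "goods ?p (?p + Suc l) = insert (od (?p + l)) (goods ?p (?p + l))"
      by (simp add: atLeastLessThanSuc)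
    have "od (?p + l) \<notin> goods ?p (?p + l)"
      using goods_split(2)[of ?p "?p + l" "Suc (?p + l)"] pl by auto
    then have "enum (\<lambda>x. if x = int l then int (od (?p + l)) else itab s' ''cur'' [?ep, x]) (int l + 1)
      (insert (od (?p + l)) (goods ?p (?p + l)))"
      using I by (intro enum_push[where h = "\<lambda>x. itab s' ''cur'' [?ep, x]"]) auto
    moreover have "int l + 1 = int (Suc l)" "int (?p + l) + 1 = int (?p + Suc l)" by simp_all
    ultimately show "vc W take_body (?I (Suc l)) s'"
      unfolding take_body_def g using I ods oW bnd
      by (simp add: ord_is_def del: of_nat_add of_nat_Suc add_Suc_right)
  qed
  have test: "int ?p + int (phase_scale i) * (int n * int rt) < int m \<longleftrightarrow> ?p + phase_scale i * n * rt < m"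
    by (simp add: mult.assoc flip: of_nat_mult of_nat_add)
  let ?c = "Cond (ILess (IAdd (V ''pos'') (IMul (V ''sc'') (IMul (IConst (int n)) (V ''r'')))) (V ''m''))
      (''nx'' ::= IAdd (V ''pos'') (IMul (V ''sc'') (IMul (IConst (int n)) (V ''r''))))
      (''nx'' ::= V ''m'')"
  have cvc: "vc W ?c (\<lambda>s'. s' = iupdate ''nx'' [] (int ?nx) s) s"
  proof (cases "?p + phase_scale i * n * rt < m")
    case True
    then have "int ?nx = int ?p + int (phase_scale i) * (int n * int rt)" by (simp add: ppos_Suc mult.assoc)
    moreover have "int ?nx \<le> int W" using le W by simp
    ultimately show ?thesis using True test assms by simp
  next
    case False
    then have "int ?nx = int m" by (simp add: ppos_Suc)
    then show ?thesis using False test assms W by simp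
  qed
  have "wp W (?c ;; ''cn'' ::= IConst 0 ;; While (ILess (V ''pos'') (V ''nx'')) take_body)
    (\<lambda>N s'. ?I (?nx - ?p) s' \<and> N \<le> ?nx - ?p) s"
  proof (rule wp_SeqI[OF wp_vc[OF cvc]], elim conjE)
    fix N and s' :: store assume "N = (0::nat)" "s' = iupdate ''nx'' [] (int ?nx) s"
    then show "wp W (''cn'' ::= IConst 0 ;; While (ILess (V ''pos'') (V ''nx'')) take_body)
      (\<lambda>N'. \<lambda>s'. ?I (?nx - ?p) s' \<and> N + N' \<le> ?nx - ?p) s'"
      using assms by (intro wp_Set_Seq) (auto simp: ord_is_def intro!: wp_mono[OF loop])
  qed
  then show ?thesis
    unfolding take_prog_def using le by (elim wp_mono) simp
qed

text \<open>Doubling finds the largest power of two q with q ^ (n - 1) \<le> k. From 2 ^ a \<le> k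
  follows a + 1 \<le> k, so the k rounds ahead leave room for the epoch numbers of the
  phase.\<close>

lemma wp_grid:
  assumes cn: "itab s ''cn'' [] = int (k * n)" and k: "k * n \<le> m"
  shows "wp W (grid_prog n) (\<lambda>N s'. \<exists>a. itab s' ''k'' [] = int k \<and> itab s' ''q'' [] = 2 ^ a \<and> a \<le> lgQ \<and>
    (0 < k \<longrightarrow> (2 ^ a) ^ (n - 1) \<le> k \<and> a + 1 \<le> k) \<and> k < (2 * 2 ^ a) ^ (n - 1) \<and> N \<le> k) s"
proof -
  have n1: "1 \<le> n - 1" using n3 by simp
  have km: "k \<le> m" using k n3 by (metis le_trans mult.commute mult_le_mono1 nat_mult_1 one_le_numeral order.trans)
  have self: "x \<le> x ^ (n - 1)" for x :: nat
    using n1 by (cases "x = 0") (auto intro: self_le_power)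
  define a where "a = (LEAST a. k < (2 * 2 ^ a) ^ (n - 1))"
  have "k < 2 * 2 ^ k" using less_exp[of k] by linarith
  then have "k < (2 * 2 ^ k) ^ (n - 1)" using self[of "2 * 2 ^ k"] by (rule order.strict_trans2)
  then have a: "k < (2 * 2 ^ a) ^ (n - 1)" and ak: "a \<le> k"
    unfolding a_def by (rule LeastI, rule Least_le)
  have below: "(2 * 2 ^ j) ^ (n - 1) \<le> k" if "j < a" for j
    using not_less_Least[OF that[unfolded a_def]] by simp
  have low: "(2 ^ a) ^ (n - 1) \<le> k" if "0 < k"
    using that below[of "a - 1"] by (cases a) auto
  have "2 ^ a \<le> k" if "0 < k" using self[of "2 ^ a"] low[OF that] by linarith
  moreover have "a = 0" if "k = 0" using ak that by simp
  ultimately have ma: "2 ^ a \<le> m" using km m3 by (cases "k = 0") auto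
  have alg: "a \<le> lgQ"
    using ma lgQ_bounds(1) by (metis le_trans linorder_not_less one_less_numeral_iff power_strict_increasing semiring_norm(76) order.strict_trans2 less_irrefl)
  have a1: "a + 1 \<le> k" if "0 < k" using \<open>0 < k \<Longrightarrow> 2 ^ a \<le> k\<close>[OF that] less_exp[of a] by linarith
  let ?I = "\<lambda>j (s' :: store). itab s' ''k'' [] = int k \<and> itab s' ''q'' [] = 2 ^ j"
  let ?b = "ile (ipow (IMul (IConst 2) (V ''q'')) (n - 1)) (V ''k'')"
  have loop: "wp W (While ?b (''q'' ::= IMul (IConst 2) (V ''q''))) (\<lambda>N s'. ?I a s' \<and> N \<le> a) s0" if "?I 0 s0" for s0
  proof (rule wp_for[where I = ?I, OF that])
    fix j and s' :: store assume I: "?I j s'"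
    have "int ((2 * 2 ^ j) ^ (n - 1)) \<le> int k \<longleftrightarrow> (2 * 2 ^ j) ^ (n - 1) \<le> k" by (simp only: of_nat_le_iff)
    then have le: "(2 * (2::int) ^ j) ^ (n - 1) \<le> int k \<longleftrightarrow> (2 * 2 ^ j) ^ (n - 1) \<le> k"
      by (simp only: of_nat_power of_nat_mult of_nat_numeral)
    have ij: "j < a \<longleftrightarrow> (2 * 2 ^ j) ^ (n - 1) \<le> k" if "j \<le> a"
    proof (cases "j = a")
      case False
      then show ?thesis using that below[of j] by simp
    next
      case True
      then show ?thesis using a leD by blast
    qed
    show "bval s' ?b \<longleftrightarrow> j < a" if "j \<le> a"
      unfolding ij[OF that] le [symmetric] using I by (simp only: bval.simps ival.simps ival_ipow list.map not_less)
    assume "j < a"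
    then have "2 * 2 ^ j \<le> k" using below self[of "2 * 2 ^ j"] le_trans by blast
    moreover have "k \<le> W" using km W by simp
    ultimately have "2 * 2 ^ j \<le> W" by (rule le_trans)
    then have "int (2 * 2 ^ j) \<le> int W" by (rule of_nat_mono)
    then show "vc W (''q'' ::= IMul (IConst 2) (V ''q'')) (?I (Suc j)) s'" using I by simp
  qed
  have "wp W (grid_prog n) (\<lambda>N s'. ?I a s' \<and> N \<le> a) s"
    unfolding grid_prog_def
  proof (intro wp_Set_Seq)
    have "int (k * n) div int n = int k" using n3 by simp
    then have dv: "ival s (IDiv (V ''cn'') (IConst (int n))) = int k" using cn by simp
    show "\<bar>ival s (IDiv (V ''cn'') (IConst (int n)))\<bar> \<le> int W" unfolding dv using km W by simp
    show "\<bar>ival (iupdate ''k'' (map (ival s) []) (ival s (IDiv (V ''cn'') (IConst (int n)))) s) (IConst 1)\<bar> \<le> int W"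
      using W m3 by simp
    show "wp W (While ?b (''q'' ::= IMul (IConst 2) (V ''q''))) (\<lambda>N s'. ?I a s' \<and> N \<le> a)
      (iupdate ''q'' (map (ival (iupdate ''k'' (map (ival s) []) (ival s (IDiv (V ''cn'') (IConst (int n)))) s)) [])
        (ival (iupdate ''k'' (map (ival s) []) (ival s (IDiv (V ''cn'') (IConst (int n)))) s) (IConst 1))
        (iupdate ''k'' (map (ival s) []) (ival s (IDiv (V ''cn'') (IConst (int n)))) s))"
      unfolding dv by (rule loop) simp
  qed
  then show ?thesis
    by (rule wp_mono) (use low a1 a alg ak in auto)
qed

lemma writes_epoch_body: "''pos'' \<notin> iwrites (epoch_body n)" "''ord'' \<notin> iwrites (epoch_body n)"
  using subsetD[OF writes_inner_loop[of n], of "''pos''"] subsetD[OF writes_inner_loop[of n], of "''ord''"]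
  by (auto simp: epoch_body_def filter_body_def)

lemma represents_frame:
  assumes "represents rd st s" "\<And>a. a \<in> {''sig'', ''bun'', ''dg''} \<Longrightarrow> itab s' a = itab s a" "rtab s' ''u'' = rtab s ''u''"
  shows "represents rd st s'" "unalloc s' = unalloc s"
proof -
  have eq: "itab s' ''sig'' = itab s ''sig''" "itab s' ''bun'' = itab s ''bun''" "itab s' ''dg'' = itab s ''dg''"
    using assms(2) by simp_all
  have "represents rd st s' \<longleftrightarrow> represents rd st s"
    by (simp only: represents_def owners_ok_def bundles_ok_def degrees_ok_def eq assms(3))
  then show "represents rd st s'" using assms(1) by blast
  show "unalloc s' = unalloc s" by (simp only: unalloc_def eq)
qed

lemma phase_step:
  assumes inv: "phase_inv i rd st s" and lt: "phase_scale i < m"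
  shows "wp W (phase_body n) (\<lambda>N s'. \<exists>rd' st'. phase_inv (Suc i) rd' st' s' \<and> phase_pot (Suc i) + N + 1 \<le> phase_pot i) s"
proof -
  define p nx where "p = ppos i" and "nx = ppos (Suc i)"
  let ?L = "goods p nx" and ?U = "goods nx m" and ?ep = "itab s ''ep'' []"
  have le: "p \<le> nx" "nx \<le> m" using ppos_le by (simp_all add: p_def nx_def)
  note sp = goods_split[OF le order.refl]
  interpret pd: phase_data n m v E es W i nx ?L ?U st "out s"
  proof unfold_locales
    show "?L \<subseteq> {1..m}" using od_image(3) le by auto
    show "?L \<inter> ?U = {}" using sp(2) .
    show "real (min (deg g) (nx div n)) * real (phase_scale i) \<le> base_delta i" if "g \<in> ?L" for g
      using phase_bound that by (simp add: p_def nx_def)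
  qed
  have st: "static s" and ord: "ord_is s" and kind: "itab s ''kind'' [] = (if i = 0 then 0 else 1)"
    and sc: "itab s ''sc'' [] = int (phase_scale i)" and pos: "itab s ''pos'' [] = int (ppos i)"
    and rep: "represents rd st s" and rd: "rd * n = p" and un: "unalloc s = goods p m"
    and fresh: "\<And>e \<kappa>. ?ep < e \<Longrightarrow> itab s ''bc'' (e # \<kappa>) = 0" and ep: "0 \<le> ?ep" "?ep \<le> int rd"
    using inv unfolding phase_inv_def p_def by blast+
  obtain tr where tr: "out s = concat (map (log_round n) tr)" "reached i st tr"
    using inv unfolding phase_inv_def by blast
  have mr: "itab s ''r'' [] = int rt" "itab s ''m'' [] = int m" using st by (simp_all add: static_def)
  have "n dvd nx" "n dvd p" using n_dvd_ppos by (simp_all add: p_def nx_def)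
  then have "n dvd nx - p" by (rule dvd_diff_nat)
  then obtain k where k: "nx - p = k * n" by (metis dvd_def mult.commute)
  have cardL: "card ?L = k * n" using od_image(2)[of "{p..<nx}"] le k by auto
  have nxk: "(rd + k) * n = nx" using k rd le by (simp add: algebra_simps)
  have kle: "k * n \<le> m" using k le by linarith
  show ?thesis
    unfolding phase_body_def
  proof (rule wp_SeqI[OF wp_frame[OF wp_take[OF pos sc mr ord]]], elim conjE)
    fix N1 and s1 :: store
    assume fr1: "framed (take_prog n) s s1" and pos1: "itab s1 ''pos'' [] = int (ppos (Suc i))"
      and cur1: "enum (\<lambda>x. itab s1 ''cur'' [?ep, x]) (itab s1 ''cn'' []) (goods (ppos i) (ppos (Suc i)))"
      and N1: "N1 \<le> ppos (Suc i) - ppos i"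
    have oth1: "itab s1 b = itab s b" if "b \<notin> {''nx'', ''cn'', ''cur'', ''pos''}" for b
      using fr1 that by (auto simp: framed_def take_prog_def take_body_def)
    have same1: "rtab s1 = rtab s" "out s1 = out s" using fr1 by (auto simp: framed_def take_prog_def take_body_def)
    have cn1: "itab s1 ''cn'' [] = int (k * n)" using enum_card(2)[OF cur1] cardL by (simp add: p_def nx_def)
    show "wp W (grid_prog n ;; While (ILess (IConst 0) (V ''k'')) (epoch_body n) ;;
        Cond (IEq (V ''kind'') (IConst 0)) (''kind'' ::= IConst 1) (''sc'' ::= IMul (V ''sc'') (IConst 2)))
      (\<lambda>N s'. \<exists>rd' st'. phase_inv (Suc i) rd' st' s' \<and> phase_pot (Suc i) + (N1 + N) + 1 \<le> phase_pot i) s1"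
    proof (rule wp_SeqI[OF wp_frame[OF wp_grid[OF cn1 kle]]], elim conjE exE)
      fix N2 and s2 :: store and a
      assume fr2: "framed (grid_prog n) s1 s2" and k2: "itab s2 ''k'' [] = int k" and q2: "itab s2 ''q'' [] = 2 ^ a" "a \<le> lgQ"
        and a: "0 < k \<longrightarrow> (2 ^ a) ^ (n - 1) \<le> k \<and> a + 1 \<le> k" and ka: "k < (2 * 2 ^ a) ^ (n - 1)" and N2: "N2 \<le> k"
      have oth2: "itab s2 b = itab s1 b" if "b \<notin> {''k'', ''q''}" for b
        using fr2 that by (auto simp: framed_def grid_prog_def)
      have same2: "rtab s2 = rtab s" "out s2 = out s" using fr2 same1 by (auto simp: framed_def grid_prog_def)
      have oth: "itab s2 b = itab s b" if "b \<notin> {''nx'', ''cn'', ''cur'', ''pos'', ''k'', ''q''}" for b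
        using oth1[of b] oth2[of b] that by simp
      have rep2: "represents rd st s2" "unalloc s2 = unalloc s"
        by (rule represents_frame[OF rep oth]; auto simp: same2)+
      have st2: "static s2" by (rule static_cong[OF st oth]) (auto simp: same2)
      have prog: "pd.progress ?L k rd st s2"
        unfolding pd.progress_def
      proof (intro conjI exI[of _ "[]"])
        show "unalloc s2 = ?L \<union> ?U" using rep2(2) un sp(1) by simp
        show "pd.ran ?L st []" by (simp add: pd.ran_def)
      qed (use st2 rep2 cardL nxk k2 same2 in auto)
      have eq2: "itab s2 ''ep'' = itab s ''ep''" "itab s2 ''bc'' = itab s ''bc''" "itab s2 ''kind'' = itab s ''kind''"
        "itab s2 ''sc'' = itab s ''sc''" "itab s2 ''cur'' = itab s1 ''cur''" "itab s2 ''cn'' = itab s1 ''cn''"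
        "itab s2 ''pos'' = itab s1 ''pos''" "itab s2 ''ord'' = itab s ''ord''"
        using oth[of "''ep''"] oth[of "''bc''"] oth[of "''kind''"] oth[of "''sc''"] oth[of "''ord''"]
          oth2[of "''cur''"] oth2[of "''cn''"] oth2[of "''pos''"] by simp_all
      have e2: "pd.epoch_inv a ?L ?L k rd st s2"
        unfolding pd.epoch_inv_def
      proof (intro conjI impI)
        show "enum (\<lambda>x. itab s2 ''cur'' [itab s2 ''ep'' [], x]) (itab s2 ''cn'' []) ?L"
          using cur1 by (simp add: eq2 p_def nx_def)
        have "k \<le> (4 * 2 ^ a) ^ (n - 1)" by (rule order.trans[OF less_imp_le[OF ka]]) (intro power_mono, auto)
        then show "card ?L \<le> n * (4 * 2 ^ a) ^ (n - 1)" unfolding cardL mult.commute[of n] by (rule mult_le_mono1)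
        show "\<forall>e \<kappa>. itab s2 ''ep'' [] < e \<longrightarrow> itab s2 ''bc'' (e # \<kappa>) = 0" using fresh by (simp add: eq2)
        show "itab s2 ''ep'' [] + (if 0 < k then int a + 1 else 0) \<le> int (rd + k)" using a ep by (auto simp: eq2)
      qed (use prog q2 kind sc ka ep in \<open>auto simp: eq2\<close>)
      show "wp W (While (ILess (IConst 0) (V ''k'')) (epoch_body n) ;;
          Cond (IEq (V ''kind'') (IConst 0)) (''kind'' ::= IConst 1) (''sc'' ::= IMul (V ''sc'') (IConst 2)))
        (\<lambda>N s'. \<exists>rd' st'. phase_inv (Suc i) rd' st' s' \<and> phase_pot (Suc i) + (N1 + (N2 + N)) + 1 \<le> phase_pot i) s2"
      proof (rule wp_SeqI[OF wp_frame[OF pd.epochs_correct[OF e2]]], elim conjE exE)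
        fix N3 and s3 :: store and a' S' rd' st'
        assume fr3: "framed (While (ILess (IConst 0) (V ''k'')) (epoch_body n)) s2 s3"
          and inv3: "pd.epoch_inv a' S' {} 0 rd' st' s3" and N3: "N3 \<le> pd.epoch_pot a ?L k"
        have pos3: "itab s3 ''pos'' = itab s1 ''pos''" "itab s3 ''ord'' = itab s ''ord''"
          using fr3 writes_epoch_body eq2 by (auto simp: framed_def)
        have prog3: "pd.progress {} 0 rd' st' s3" and kind3: "itab s3 ''kind'' [] = (if i = 0 then 0 else 1)"
          and sc3: "itab s3 ''sc'' [] = int (phase_scale i)"
          and fresh3: "\<forall>e \<kappa>. itab s3 ''ep'' [] < e \<longrightarrow> itab s3 ''bc'' (e # \<kappa>) = 0"
          and ep3: "0 \<le> itab s3 ''ep'' []" "itab s3 ''ep'' [] \<le> int rd'"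
          using inv3 unfolding pd.epoch_inv_def by auto
        obtain tr3 where tr3: "out s3 = out s @ concat (map (log_round n) tr3)" "pd.ran {} st' tr3"
          using prog3 unfolding pd.progress_def by blast
        have st3: "static s3" and rep3: "represents rd' st' s3" and un3: "unalloc s3 = ?U" and rd3: "rd' * n = nx"
          using prog3 unfolding pd.progress_def by simp_all
        have deg_run: "degree_ef1 n v E (phase_delta n E i) ?L st tr3 st'"
        proof -
          have "degree_ef1 n v E (phase_delta n E i) {} st' [] st'" by (rule degree_ef1.finish)
          then have "degree_ef1 n v E (phase_delta n E i) ?L st (tr3 @ []) st'"
            using tr3(2) unfolding pd.ran_def by blast
          then show ?thesis by simp
        qed
        have idx: "int i \<le> \<lceil>log 2 (real m)\<rceil>" using phase_index_iff[of m i] lt m3 by (simp add: phase_scale_def)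
        have reach: "reached (Suc i) st' (tr @ tr3)"
          unfolding reached_def
        proof (intro allI impI)
          fix tr' st'' assume "phases n m v E (Suc i) (goods (ppos (Suc i)) m) st' tr' st''"
          then have "phases n m v E i (goods p m) st (tr3 @ tr') st''"
            using phases.phase[OF idx _ deg_run, of "goods p m"] highest_degree_goods[of i] sp(3)
            by (simp add: p_def nx_def)
          then have "phases n m v E 0 {1..m} (id, \<lambda>_. {}) (tr @ (tr3 @ tr')) st''"
            using tr(2) unfolding reached_def p_def by blast
          then show "phases n m v E 0 {1..m} (id, \<lambda>_. {}) ((tr @ tr3) @ tr') st''" by simp
        qed
        have out3: "out s3 = concat (map (log_round n) (tr @ tr3))" using tr3(1) tr(1) by simp
        have new: "phase_inv (Suc i) rd' st' s4"
          if eq4: "\<And>b. b \<notin> {''kind'', ''sc''} \<Longrightarrow> itab s4 b = itab s3 b" "rtab s4 = rtab s3" "out s4 = out s3"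
            and "itab s4 ''kind'' [] = 1" "itab s4 ''sc'' [] = int (phase_scale (Suc i))" for s4 :: store
        proof -
          have "static s4" by (rule static_cong[OF st3 eq4(1)]) (auto simp: eq4(2))
          moreover have "represents rd' st' s4" "unalloc s4 = unalloc s3"
            by (rule represents_frame[OF rep3 eq4(1)]; auto simp: eq4(2))+
          moreover have "ord_is s4" using ord eq4(1)[of "''ord''"] pos3(2) by (simp add: ord_is_def)
          moreover have "itab s4 ''pos'' [] = int (ppos (Suc i))" using eq4(1)[of "''pos''"] pos3(1) pos1 by simp
          moreover have "itab s4 ''ep'' = itab s3 ''ep''" "itab s4 ''bc'' = itab s3 ''bc''" by (simp_all add: eq4(1))
          moreover have "\<exists>tr. out s4 = concat (map (log_round n) tr) \<and> reached (Suc i) st' tr"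
            using reach out3 eq4(3) by metis
          ultimately show ?thesis
            unfolding phase_inv_def using that(4,5) fresh3 ep3 rd3 un3 by (simp add: nx_def)
        qed
        have "(\<Sum>g\<in>goods p m. deg g) = (\<Sum>g\<in>?L. deg g) + (\<Sum>g\<in>?U. deg g)"
          unfolding sp(1) using sp(2) by (intro sum.union_disjoint) auto
        then have S: "(n + 1) * (\<Sum>g\<in>goods p m. deg g) = (n + 1) * (\<Sum>g\<in>?L. deg g) + (n + 1) * (\<Sum>g\<in>?U. deg g)"
          by (simp only: distrib_left)
        have "k * 1 \<le> k * n" using n3 by (intro mult_le_mono2) simp
        then have kd: "k \<le> nx - p" using k by simp
        have "m - p = (m - nx) + (nx - p)" using le by simp
        then have D: "(epoch_const n + 2) * (m - p) = (epoch_const n + 2) * (m - nx) + epoch_const n * (nx - p) + 2 * (nx - p)"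
          by (simp only: distrib_left distrib_right add.assoc)
        have Y: "epoch_const n * k \<le> epoch_const n * (nx - p)" using kd by (rule mult_le_mono2)
        \<comment> \<open>Doubling the scale lowers m - \<open>phase_scale i\<close> by at least
          one; between phases 0 and 1 the scale stays 1 and the extra unit is spent.\<close>
        have Z: "(m - phase_scale (Suc i)) + 1 \<le> (m - phase_scale i) + (if i = 0 then 1 else 0)"
        proof (cases i)
          case (Suc j)
          have e: "phase_scale (Suc i) = 2 * phase_scale i" "1 \<le> phase_scale i"
            by (simp_all add: phase_scale_def Suc)
          have "m - 2 * phase_scale i + 1 \<le> m - phase_scale i" using e(2) lt by linarith
          then show ?thesis by (simp add: e(1))
        qed (simp add: phase_scale_def)
        \<comment> \<open>The first grid satisfies q ^ (n - 1) \<le> k, which makes the geometric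
          series over the epochs linear in the size of the phase.\<close>
        have N3': "N3 \<le> epoch_const n * k + (n + 1) * (\<Sum>g\<in>?L. deg g)"
        proof (cases "0 < k")
          case True
          then have "epoch_const n * (2 ^ a) ^ (n - 1) \<le> epoch_const n * k" using a by (intro mult_le_mono2) blast
          then show ?thesis using N3 True unfolding pd.epoch_pot_def if_P[OF True] by linarith
        next
          case False
          then show ?thesis using N3 unfolding pd.epoch_pot_def if_not_P[OF False] by linarith
        qed
        have arith: "A1 + 0 + B1 + C1 + (n1 + (n2 + (n3 + 0))) + 1 \<le> A0 + I + B0 + C0"
          if "A1 + 1 \<le> A0 + I" "B0 = B1 + M' + 2 * d" "C0 = CL + C1" "n1 \<le> d" "n2 \<le> k'" "k' \<le> d"
            "n3 \<le> M + CL" "M \<le> M'" for A1 B1 C1 n1 n2 n3 A0 I B0 C0 M M' d CL k' :: nat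
          using that by linarith
        have "phase_pot (Suc i) = (m - phase_scale (Suc i)) + 0 + (epoch_const n + 2) * (m - nx) + (n + 1) * (\<Sum>g\<in>?U. deg g)"
          unfolding phase_pot_def nx_def by (simp only: nat.distinct if_False)
        moreover have "phase_pot i = (m - phase_scale i) + (if i = 0 then 1 else 0) + (epoch_const n + 2) * (m - p) +
            (n + 1) * (\<Sum>g\<in>goods p m. deg g)"
          unfolding phase_pot_def p_def ..
        ultimately have pot: "phase_pot (Suc i) + (N1 + (N2 + (N3 + 0))) + 1 \<le> phase_pot i"
          using arith[OF Z D S N1[folded p_def nx_def] N2 kd N3' Y] by (simp only:)
        show "wp W (Cond (IEq (V ''kind'') (IConst 0)) (''kind'' ::= IConst 1) (''sc'' ::= IMul (V ''sc'') (IConst 2)))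
          (\<lambda>N s'. \<exists>rd' st'. phase_inv (Suc i) rd' st' s' \<and> phase_pot (Suc i) + (N1 + (N2 + (N3 + N))) + 1 \<le> phase_pot i) s3"
        proof (rule wp_straight)
          have p4: "\<exists>rd' st'. phase_inv (Suc i) rd' st' s4 \<and> phase_pot (Suc i) + (N1 + (N2 + (N3 + 0))) + 1 \<le> phase_pot i"
            if "phase_inv (Suc i) rd' st' s4" for s4 using that pot by blast
          show "vc W (Cond (IEq (V ''kind'') (IConst 0)) (''kind'' ::= IConst 1) (''sc'' ::= IMul (V ''sc'') (IConst 2)))
            (\<lambda>s'. \<exists>rd' st'. phase_inv (Suc i) rd' st' s' \<and> phase_pot (Suc i) + (N1 + (N2 + (N3 + 0))) + 1 \<le> phase_pot i) s3"
          proof (cases "i = 0")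
            case True
            have "phase_inv (Suc i) rd' st' (iupdate ''kind'' [] 1 s3)"
              by (rule new) (use True sc3 in \<open>auto simp: phase_scale_def\<close>)
            moreover have "1 \<le> int W" using W m3 by simp
            ultimately show ?thesis using True kind3 p4 by simp
          next
            case False
            then have sc': "phase_scale (Suc i) = phase_scale i * 2" by (cases i) (auto simp: phase_scale_def)
            have "phase_inv (Suc i) rd' st' (iupdate ''sc'' [] (int (phase_scale i) * 2) s3)"
              by (rule new) (use False kind3 in \<open>auto simp: sc'\<close>)
            moreover have "int (phase_scale i) * 2 \<le> int W" using lt W_int by linarith
            ultimately show ?thesis using False kind3 sc3 p4 by simp
          qed
        qed
      qed
    qed
  qed
qed

lemma phases_loop_correct:
  assumes "phase_inv 0 0 (id, \<lambda>_. {}) s"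
  shows "wp W (While (ILess (V ''sc'') (V ''m'')) (phase_body n)) (\<lambda>N s'. N \<le> phase_pot 0 \<and>
    (\<exists>rd \<sigma> B tr. represents rd (\<sigma>, B) s' \<and> phases n m v E 0 {1..m} (id, \<lambda>_. {}) tr (\<sigma>, B) \<and>
      out s' = concat (map (log_round n) tr) \<and> itab s' ''m'' [] = int m)) s"
proof -
  let ?b = "ILess (V ''sc'') (V ''m'')"
  let ?I = "\<lambda>\<phi> (s' :: store). \<exists>i rd st. phase_inv i rd st s' \<and> \<phi> = phase_pot i"
  have b: "bval s' ?b \<longleftrightarrow> phase_scale i < m" if "phase_inv i rd st s'" for i rd st s'
    using that by (simp add: phase_inv_def static_def)
  have I0: "?I (phase_pot 0) s" using assms by blast
  have "wp W (While ?b (phase_body n)) (\<lambda>N s'. \<exists>\<phi>'. ?I \<phi>' s' \<and> \<not> bval s' ?b \<and> \<phi>' + N \<le> phase_pot 0) s"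
  proof (rule wp_While[where I = ?I, OF I0])
    fix \<phi> and s :: store assume "?I \<phi> s" and bv: "bval s ?b"
    then obtain i rd st where *: "phase_inv i rd st s" "\<phi> = phase_pot i" by blast
    then have "phase_scale i < m" using bv b by blast
    from phase_step[OF *(1) this]
    show "wp W (phase_body n) (\<lambda>N s'. \<exists>\<phi>'. ?I \<phi>' s' \<and> \<phi>' + N + 1 \<le> \<phi>) s"
      by (rule wp_mono) (use *(2) in blast)
  qed
  then show ?thesis
  proof (rule wp_mono, elim exE conjE)
    fix N and s' :: store and \<phi> i rd st
    assume *: "phase_inv i rd st s'" "\<not> bval s' ?b" "\<phi> + N \<le> phase_pot 0"
    obtain tr where tr: "out s' = concat (map (log_round n) tr)" "reached i st tr"
      using *(1) unfolding phase_inv_def by blast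
    have "\<not> 2 ^ (i - 1) < m" using b[OF *(1)] *(2) by (simp add: phase_scale_def)
    then have "\<lceil>log 2 (real m)\<rceil> < int i" using phase_index_iff[of m i] m3 by linarith
    then have "phases n m v E i (goods (ppos i) m) st [] st" by (rule phases.stop)
    then have "phases n m v E 0 {1..m} (id, \<lambda>_. {}) (tr @ []) st" using tr(2) unfolding reached_def by blast
    then have "phases n m v E 0 {1..m} (id, \<lambda>_. {}) tr (fst st, snd st)" by simp
    moreover have "represents rd (fst st, snd st) s'" "itab s' ''m'' [] = int m"
      using *(1) by (simp_all add: phase_inv_def static_def)
    moreover have "N \<le> phase_pot 0" using *(3) by linarith
    ultimately show "N \<le> phase_pot 0 \<and>
      (\<exists>rd \<sigma> B tr. represents rd (\<sigma>, B) s' \<and> phases n m v E 0 {1..m} (id, \<lambda>_. {}) tr (\<sigma>, B) \<and>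
        out s' = concat (map (log_round n) tr) \<and> itab s' ''m'' [] = int m)"
      using tr(1) by blast
  qed
qed

lemma phase_pot_0: "phase_pot 0 \<le> (epoch_const n + 3) * m + 2 * (n + 1) * card E"
proof -
  have "(n + 1) * (\<Sum>g\<in>goods (ppos 0) m. deg g) \<le> (n + 1) * (2 * card E)"
    by (intro mult_le_mono2 sum_deg) simp
  then show ?thesis using m3 by (simp add: phase_pot_def phase_scale_def ppos_def algebra_simps)
qed

end

section \<open>The whole program\<close>

definition prep_prog :: "nat \<Rightarrow> com" where
  "prep_prog n = adj_prog ;; sort_prog ;; const_prog ;; pieces_prog n"

definition init_prog :: "nat \<Rightarrow> com" where
  "init_prog n =
    ''kind'' ::= IConst 0 ;; ''sc'' ::= IConst 1 ;; ''pos'' ::= IConst 0 ;; ''ep'' ::= IConst 0 ;;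
    seqs (map (\<lambda>i. ISet ''sig'' [IConst (int i)] (IConst (int i))) [1..<Suc n])"

definition owner_body :: "nat \<Rightarrow> com" where
  "owner_body n =
    seqs (map (\<lambda>i. Cond (IEq (IGet ''sig'' [IConst (int i)]) (IGet ''bun'' [V ''x'']))
      (ISet ''owner'' [V ''x''] (IConst (int i))) Skip) [1..<Suc n]) ;;
    incr ''x'' []"

definition owner_prog :: "nat \<Rightarrow> com" where
  "owner_prog n = ''x'' ::= IConst 1 ;; While (ile (V ''x'') (V ''m'')) (owner_body n)"

definition graph_prog :: "nat \<Rightarrow> com" where
  "graph_prog n = prep_prog n ;; init_prog n ;;
    While (ILess (V ''sc'') (V ''m'')) (phase_body n) ;; owner_prog n"

text \<open>All parts together need at most \<open>epoch_const n\<close> + 13 iterations per good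
  and 2 * n + 12 per edge; one common, generous coefficient replaces both.\<close>

definition work_const :: "nat \<Rightarrow> nat" where
  "work_const n = epoch_const n + 2 * n + 30"

context instance_data
begin

text \<open>The ownership is a permutation of {1..n}, so at most one agent matches the bundle number
  of a good. An unallocated good has number 0, which matches nobody, and its entry keeps the value 0
  of a table never written.\<close>

lemma wp_owner:
  assumes own: "owners_ok \<sigma> s" and m: "itab s ''m'' [] = int m" and zero: "\<And>g. itab s ''owner'' [g] = 0"
  shows "wp W (owner_prog n) (\<lambda>N s'. (\<forall>g\<in>{1..m}. \<forall>j\<in>{1..n}. itab s' ''owner'' [int g] = int j \<longleftrightarrow>
    itab s ''bun'' [int g] = int (\<sigma> j)) \<and> out s' = out s \<and> N \<le> m) s"
proof -
  have \<sigma>: "\<sigma> permutes {1..n}" and sig: "\<And>j. j \<in> {1..n} \<Longrightarrow> itab s ''sig'' [int j] = int (\<sigma> j)"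
    using own by (auto simp: owners_ok_def)
  have inj: "\<sigma> x = \<sigma> y \<longleftrightarrow> x = y" for x y using permutes_inj[OF \<sigma>] by (auto dest: injD)
  let ?I = "\<lambda>k (s' :: store). itab s' ''x'' [] = int (Suc k) \<and> (\<forall>a. a \<notin> {''x'', ''owner''} \<longrightarrow> itab s' a = itab s a) \<and> out s' = out s \<and>
    (\<forall>g j. g \<in> {1..k} \<longrightarrow> j \<in> {1..n} \<longrightarrow> (itab s' ''owner'' [int g] = int j \<longleftrightarrow> itab s ''bun'' [int g] = int (\<sigma> j))) \<and>
    (\<forall>g>k. itab s' ''owner'' [int g] = 0)"
  have loop: "wp W (While (ile (V ''x'') (V ''m'')) (owner_body n)) (\<lambda>N s'. ?I m s' \<and> N \<le> m) s0" if "?I 0 s0" for s0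
  proof (rule wp_for[where I = ?I, OF that])
    fix k and s' :: store assume I: "?I k s'"
    then have oth: "itab s' a = itab s a" if "a \<notin> {''x'', ''owner''}" for a using that by blast
    have x: "itab s' ''x'' [] = int (Suc k)" and o': "out s' = out s" and later: "\<And>g. k < g \<Longrightarrow> itab s' ''owner'' [int g] = 0"
      and done_k: "\<And>g j. g \<in> {1..k} \<Longrightarrow> j \<in> {1..n} \<Longrightarrow> itab s' ''owner'' [int g] = int j \<longleftrightarrow> itab s ''bun'' [int g] = int (\<sigma> j)"
      using I by blast+
    show "bval s' (ile (V ''x'') (V ''m'')) \<longleftrightarrow> k < m" if "k \<le> m"
    proof -
      have "itab s' ''m'' [] = int m" using oth[of "''m''"] m by simp
      then show ?thesis using x by auto
    qed
    assume k: "k < m"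
    let ?b = "itab s ''bun'' [int (Suc k)]"
    let ?J = "\<lambda>l (s2 :: store). (\<forall>a. a \<noteq> ''owner'' \<longrightarrow> itab s2 a = itab s' a) \<and> out s2 = out s \<and>
      (\<forall>j\<in>{1..n}. itab s2 ''owner'' [int (Suc k)] = int j \<longleftrightarrow> j \<le> l \<and> ?b = int (\<sigma> j)) \<and>
      (\<forall>g. g \<noteq> Suc k \<longrightarrow> itab s2 ''owner'' [int g] = itab s' ''owner'' [int g])"
    have "vc W (seqs (map (\<lambda>i. Cond (IEq (IGet ''sig'' [IConst (int i)]) (IGet ''bun'' [V ''x'']))
      (ISet ''owner'' [V ''x''] (IConst (int i))) Skip) [1..<Suc n])) (?J (length [1..<Suc n])) s'"
    proof (rule vc_seqs_map)
      show "?J 0 s'" using later[of "Suc k"] o' by auto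
      fix l and s2 :: store assume l: "l < length [1..<Suc n]" and J: "?J l s2"
      then have xl: "[1..<Suc n] ! l = Suc l" "Suc l \<in> {1..n}" by (auto simp del: upt_Suc)
      have o2: "itab s2 a = itab s' a" if "a \<noteq> ''owner''" for a using J that by blast
      have e2: "itab s2 ''x'' [] = int (Suc k)" "itab s2 ''bun'' = itab s ''bun''" "itab s2 ''sig'' = itab s ''sig''"
        using x by (simp_all add: o2 oth del: of_nat_Suc)
      have sl: "itab s ''sig'' [int (Suc l)] = int (\<sigma> (Suc l))" using sig[OF xl(2)] .
      have W': "int (Suc l) \<le> int W" using xl(2) m3 W by simp
      have cur: "\<And>j. j \<in> {1..n} \<Longrightarrow> itab s2 ''owner'' [int (Suc k)] = int j \<longleftrightarrow> j \<le> l \<and> ?b = int (\<sigma> j)"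
        and og: "\<And>g. g \<noteq> Suc k \<Longrightarrow> itab s2 ''owner'' [int g] = itab s' ''owner'' [int g]" and out2: "out s2 = out s"
        using J by blast+
      show "vc W (Cond (IEq (IGet ''sig'' [IConst (int ([1..<Suc n] ! l))]) (IGet ''bun'' [V ''x'']))
        (ISet ''owner'' [V ''x''] (IConst (int ([1..<Suc n] ! l)))) Skip) (?J (Suc l)) s2"
      proof (cases "?b = int (\<sigma> (Suc l))")
        case True
        then show ?thesis
          unfolding xl(1) using W' by (auto simp: e2 sl o2 og out2 inj x simp del: of_nat_Suc)
      next
        case False
        then have "itab s2 ''owner'' [int (Suc k)] = int j \<longleftrightarrow> j \<le> Suc l \<and> ?b = int (\<sigma> j)" if "j \<in> {1..n}" for j
          using cur[OF that] by (auto simp: le_Suc_eq)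
        then show ?thesis
          unfolding xl(1) using False by (simp add: e2 sl o2 og out2 x del: of_nat_Suc)
      qed
    qed
    then have *: "vc W (seqs (map (\<lambda>i. Cond (IEq (IGet ''sig'' [IConst (int i)]) (IGet ''bun'' [V ''x'']))
      (ISet ''owner'' [V ''x''] (IConst (int i))) Skip) [1..<Suc n])) (?J n) s'" by (simp del: upt_Suc of_nat_Suc)
    show "vc W (owner_body n) (?I (Suc k)) s'"
      unfolding owner_body_def vc.simps
    proof (rule vc_mono[OF *])
      fix s2 :: store assume J: "?J n s2"
      let ?s3 = "iupdate ''x'' [] (int (Suc (Suc k))) s2"
      have x2: "itab s2 ''x'' [] = int (Suc k)" using J x by simp
      have "(itab ?s3 ''owner'' [int g] = int j) = (itab s ''bun'' [int g] = int (\<sigma> j))"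
        if "g \<in> {1..Suc k}" "j \<in> {1..n}" for g j
      proof (cases "g = Suc k")
        case True
        then show ?thesis using J that(2) by (simp del: of_nat_Suc)
      next
        case False
        then show ?thesis using J done_k[of g j] that by simp
      qed
      moreover have "itab ?s3 ''owner'' [int g] = 0" if "g > Suc k" for g using J later[of g] that by simp
      moreover have "itab ?s3 a = itab s a" if "a \<notin> {''x'', ''owner''}" for a using J oth[OF that] that by simp
      ultimately have I3: "?I (Suc k) ?s3" using J by simp
      have iv: "ival s2 (IAdd (V ''x'') (IConst 1)) = int (Suc (Suc k))" using x2 by simp
      have Wk: "int (Suc (Suc k)) \<le> int W" using k m3 W by simp
      show "\<bar>ival s2 (IAdd (V ''x'') (IConst 1))\<bar> \<le> int W \<and>
        ?I (Suc k) (iupdate ''x'' (map (ival s2) []) (ival s2 (IAdd (V ''x'') (IConst 1))) s2)"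
        unfolding list.map iv abs_of_nat by (rule conjI[OF Wk I3])
    qed
  qed
  have "wp W (owner_prog n) (\<lambda>N s'. ?I m s' \<and> N \<le> m) s"
    unfolding owner_prog_def
  proof (rule wp_Set_Seq)
    show "\<bar>ival s (IConst 1)\<bar> \<le> int W" using W m3 by simp
    show "wp W (While (ile (V ''x'') (V ''m'')) (owner_body n)) (\<lambda>N s'. ?I m s' \<and> N \<le> m)
      (iupdate ''x'' (map (ival s) []) (ival s (IConst 1)) s)"
      unfolding list.map ival.simps by (rule loop) (simp add: zero)
  qed
  then show ?thesis by (rule wp_mono) auto
qed

lemma prep_correct:
  defines "s0 \<equiv> input n m v es"
  shows "wp W (prep_prog n) (\<lambda>N s'. static s' \<and> N \<le> 8 * m + 10 * card E + 2) s0"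
proof -
  have in0: "itab s0 ''m'' [] = int m" "itab s0 ''e'' [] = int (card E)" "\<And>d. itab s0 ''sn'' [d] = 0"
    using length_es by (simp_all add: s0_def input_def)
  have vals0: "values_ok s0"
    unfolding values_ok_def s0_def input_def by (auto 0 3)
  show ?thesis
    unfolding prep_prog_def
  proof (rule wp_SeqI[OF wp_frame[OF adj_prog_correct[OF s0_def[THEN meta_eq_to_obj_eq]]]], elim conjE)
    fix N1 and s1 :: store assume adj1: "adj_ok s1" and N1: "N1 \<le> card E" and fr1: "framed adj_prog s0 s1"
    have in1: "itab s1 ''m'' [] = int m" "itab s1 ''e'' [] = int (card E)" "itab s1 ''sn'' [d] = 0" "rtab s1 = rtab s0" for d
      using fr1 in0 by (auto simp: framed_def adj_prog_def adj_body_def)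
    show "wp W (sort_prog ;; const_prog ;; pieces_prog n) (\<lambda>N s'. static s' \<and> N1 + N \<le> 8 * m + 10 * card E + 2) s1"
    proof (rule wp_SeqI[OF wp_frame[OF sort_prog_correct[OF adj1 in1(1,3)]]], elim conjE)
      fix N2 and s2 :: store assume ord2: "ord_ok s2" and N2: "N2 \<le> 3 * m" and fr2: "framed sort_prog s1 s2"
      have in2: "itab s2 ''m'' [] = int m" "itab s2 ''e'' [] = int (card E)" "itab s2 ''adj'' = itab s1 ''adj''"
        "itab s2 ''deg'' = itab s1 ''deg''" "rtab s2 = rtab s0"
        using fr2 in1 by (auto simp: framed_def sort_prog_def fill_body_def sort_body_def)
      show "wp W (const_prog ;; pieces_prog n) (\<lambda>N s'. static s' \<and> N1 + (N2 + N) \<le> 8 * m + 10 * card E + 2) s2"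
      proof (rule wp_SeqI[OF wp_frame[OF const_prog_correct[OF in2(1,2)]]], elim conjE)
        fix N3 and s3 :: store assume r3: "itab s3 ''r'' [] = int rt" "itab s3 ''Q'' [] = 2 ^ lgQ" and N3: "N3 \<le> card E + m"
          and fr3: "framed const_prog s2 s3"
        have in3: "itab s3 ''m'' [] = int m" "itab s3 ''e'' [] = int (card E)" "itab s3 ''adj'' = itab s1 ''adj''"
          "itab s3 ''deg'' = itab s1 ''deg''" "itab s3 ''ord'' = itab s2 ''ord''" "rtab s3 = rtab s0"
          using fr3 in2 by (auto simp: framed_def const_prog_def)
        show "wp W (pieces_prog n) (\<lambda>N s'. static s' \<and> N1 + (N2 + (N3 + N)) \<le> 8 * m + 10 * card E + 2) s3"
        proof (rule wp_mono[OF wp_frame[OF pieces_prog_correct[OF r3 in3(2)]]], elim conjE)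
          fix N4 and s4 :: store assume p4: "pieces_ok s4 0 (real rt)" "pieces_ok s4 1 \<Delta>\<^sub>1"
            and N4: "N4 \<le> 4 * m + 8 * card E + 2" and fr4: "framed (pieces_prog n) s3 s4"
          have in4: "itab s4 ''m'' [] = int m" "itab s4 ''adj'' = itab s1 ''adj''" "itab s4 ''Q'' [] = 2 ^ lgQ" "itab s4 ''r'' [] = int rt"
            "itab s4 ''deg'' = itab s1 ''deg''" "itab s4 ''ord'' = itab s2 ''ord''" "rtab s4 = rtab s0"
            using fr4 in3 r3 by (auto simp: framed_def pieces_prog_def sweep_prog_def sweep_body_def)
          have "adj_ok s4" "ord_ok s4" "values_ok s4"
            using adj1 ord2 vals0 by (simp_all add: adj_ok_def ord_ok_def values_ok_def in4)
          then have "static s4" using p4 in4 by (simp add: static_def)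
          then show "static s4 \<and> N1 + (N2 + (N3 + N4)) \<le> 8 * m + 10 * card E + 2"
            using N1 N2 N3 N4 by linarith
        qed
      qed
    qed
  qed
qed

text \<open>The order that the analysis of the phases takes as given is the one computed by the
  bucket sort.\<close>

lemma order_exists:
  assumes "ord_ok s"
  obtains od where "ordered_instance n m v E es W od" "\<And>x. x < m \<Longrightarrow> itab s ''ord'' [int x] = int (od x)"
proof -
  define od where "od x = nat (itab s ''ord'' [int x])" for x
  have en: "enum (\<lambda>j. itab s ''ord'' [j]) (int m) {1..m}"
    and sorted: "\<And>i j g h. 0 \<le> i \<Longrightarrow> i < j \<Longrightarrow> j < int m \<Longrightarrow> itab s ''ord'' [i] = int g \<Longrightarrow>
      itab s ''ord'' [j] = int h \<Longrightarrow> deg h \<le> deg g"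
    using assms unfolding ord_ok_def by blast+
  have od: "itab s ''ord'' [int x] = int (od x)" "od x \<in> {1..m}" if "x < m" for x
    using enum_mem[OF en, of "int x"] that by (auto simp: od_def)
  have inj: "inj_on od {0..<m}"
  proof (rule inj_onI)
    fix x y assume "x \<in> {0..<m}" "y \<in> {0..<m}" "od x = od y"
    then show "x = y" using enum_inj[OF en, of "int x" "int y"] od(1)[of x] od(1)[of y] by simp
  qed
  have "od ` {0..<m} = {1..m}"
    by (rule card_subset_eq) (use od(2) card_image[OF inj] in auto)
  then have "bij_betw od {0..<m} {1..m}" using inj by (simp add: bij_betw_def)
  moreover have "deg (od y) \<le> deg (od x)" if "x \<le> y" "y < m" for x y
    using sorted[of "int x" "int y" "od x" "od y"] od(1)[of x] od(1)[of y] that by (cases "x = y") auto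
  ultimately have "ordered_instance n m v E es W od" by unfold_locales
  then show ?thesis using od(1) by (rule that)
qed

lemma graph_prog_correct:
  "wp W (graph_prog n) (\<lambda>N s'. Suc N \<le> work_const n * (m + card E) \<and>
    (\<exists>tr A. graph_ef1 n m v E tr A \<and> outputs n m s' tr A)) (input n m v es)"
proof -
  let ?s0 = "input n m v es"
  have vi: "v i {} = 0" if "i \<in> {1..n}" for i
    using additive that unfolding additive_valuations_def by (metis empty_subsetI sum.empty)
  show ?thesis
    unfolding graph_prog_def
  proof (rule wp_SeqI[OF wp_frame[OF prep_correct]], elim conjE)
    fix N1 and s1 :: store
    assume st1: "static s1" and N1: "N1 \<le> 8 * m + 10 * card E + 2" and fr1: "framed (prep_prog n) ?s0 s1"
    have w: "''bun'' \<notin> iwrites (prep_prog n)" "''dg'' \<notin> iwrites (prep_prog n)" "''bc'' \<notin> iwrites (prep_prog n)"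
      "''owner'' \<notin> iwrites (prep_prog n)" "rwrites (prep_prog n) = {}" "\<not> emits (prep_prog n)"
      by (simp_all add: prep_prog_def adj_prog_def adj_body_def sort_prog_def fill_body_def sort_body_def
        const_prog_def pieces_prog_def sweep_prog_def sweep_body_def)
    have f1: "itab s1 a = itab ?s0 a" if "a \<notin> iwrites (prep_prog n)" for a using fr1 that by (simp add: framed_def)
    have zero1: "itab s1 ''bun'' ks = 0" "itab s1 ''dg'' ks = 0" "itab s1 ''bc'' ks = 0" "itab s1 ''owner'' ks = 0"
      for ks by (simp_all add: f1[OF w(1)] f1[OF w(2)] f1[OF w(3)] f1[OF w(4)] input_def)
    have r1: "rtab s1 = rtab ?s0" using fr1 unfolding framed_def w(5) by auto
    have out1: "out s1 = []" using fr1 w(6) unfolding framed_def by (simp add: input_def)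
    obtain od where od: "ordered_instance n m v E es W od" "\<And>x. x < m \<Longrightarrow> itab s1 ''ord'' [int x] = int (od x)"
      using order_exists st1 unfolding static_def by metis
    interpret oi: ordered_instance n m v E es W od by (rule od(1))
    let ?J = "\<lambda>l (s2 :: store). (\<forall>j. j \<in> {1..l} \<longrightarrow> itab s2 ''sig'' [int j] = int j) \<and> itab s2 ''kind'' [] = 0 \<and> itab s2 ''sc'' [] = 1 \<and>
      itab s2 ''pos'' [] = 0 \<and> itab s2 ''ep'' [] = 0 \<and>
      (\<forall>a. a \<notin> {''sig'', ''kind'', ''sc'', ''pos'', ''ep''} \<longrightarrow> itab s2 a = itab s1 a) \<and> rtab s2 = rtab s1 \<and> out s2 = out s1"
    have "vc W (seqs (map (\<lambda>i. ISet ''sig'' [IConst (int i)] (IConst (int i))) [1..<Suc n])) (?J (length [1..<Suc n]))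
      (iupdate ''ep'' [] 0 (iupdate ''pos'' [] 0 (iupdate ''sc'' [] 1 (iupdate ''kind'' [] 0 s1))))"
    proof (rule vc_seqs_map)
      fix l and s2 :: store assume l: "l < length [1..<Suc n]" and J: "?J l s2"
      then have xl: "[1..<Suc n] ! l = Suc l" "Suc l \<in> {1..n}" by (auto simp del: upt_Suc)
      have W': "int (Suc l) \<le> int W" using xl(2) m3 W by simp
      show "vc W (ISet ''sig'' [IConst (int ([1..<Suc n] ! l))] (IConst (int ([1..<Suc n] ! l)))) (?J (Suc l)) s2"
        unfolding xl(1) using J W' by (auto simp: le_Suc_eq simp del: of_nat_Suc)
    qed simp
    then have init: "vc W (init_prog n) (?J n) s1"
      unfolding init_prog_def using W m3 by (simp del: upt_Suc)
    show "wp W (init_prog n ;; While (ILess (V ''sc'') (V ''m'')) (phase_body n) ;; owner_prog n)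
      (\<lambda>N s'. Suc (N1 + N) \<le> work_const n * (m + card E) \<and> (\<exists>tr A. graph_ef1 n m v E tr A \<and> outputs n m s' tr A)) s1"
    proof (rule wp_SeqI[OF wp_vc[OF init]])
      fix N2 :: nat and s2 :: store assume J: "N2 = 0 \<and> ?J n s2"
      have oth2: "itab s2 a = itab s1 a" if "a \<notin> {''sig'', ''kind'', ''sc'', ''pos'', ''ep''}" for a using J that by blast
      have s2: "itab s2 ''kind'' [] = 0" "itab s2 ''sc'' [] = 1" "itab s2 ''pos'' [] = 0" "itab s2 ''ep'' [] = 0"
        "rtab s2 = rtab s1" "out s2 = []" and N2: "N2 = 0" using J out1 by auto
      have sig2: "itab s2 ''sig'' [int j] = int j" if "j \<in> {1..n}" for j using J that by blast
      have eq2: "itab s2 ''bun'' = itab s1 ''bun''" "itab s2 ''dg'' = itab s1 ''dg''" "itab s2 ''bc'' = itab s1 ''bc''"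
        "itab s2 ''ord'' = itab s1 ''ord''" "itab s2 ''owner'' = itab s1 ''owner''" by (simp_all add: oth2)
      have st2: "static s2" by (rule static_cong[OF st1 oth2]) (auto simp: s2)
      have u0: "rtab s2 ''u'' ks = 0" for ks using r1 s2(5) by (simp add: input_def)
      \<comment> \<open>Tables that were never written read as 0, which already represents empty
        bundles of value 0 and zero degree counters.\<close>
      have rep2: "represents 0 (id, \<lambda>_. {}) s2"
        unfolding represents_def owners_ok_def bundles_ok_def degrees_ok_def
        using sig2 vi by (auto simp: eq2 zero1 u0 EF1_def deg_in_def permutes_id)
      have un2: "unalloc s2 = {1..m}" by (auto simp: unalloc_def eq2 zero1)
      have "oi.goods (oi.ppos 0) m = {1..m}" using oi.od by (simp add: oi.ppos_def bij_betw_def)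
      then have inv: "oi.phase_inv 0 0 (id, \<lambda>_. {}) s2"
        unfolding oi.phase_inv_def oi.reached_def oi.ord_is_def
        using st2 od(2) rep2 un2 s2 by (auto simp: eq2 zero1 phase_scale_def oi.ppos_def intro!: exI[of _ "[]"])
      have own2: "itab s2 ''owner'' ks = 0" for ks by (simp add: eq2 zero1)
      show "wp W (While (ILess (V ''sc'') (V ''m'')) (phase_body n) ;; owner_prog n)
        (\<lambda>N s'. Suc (N1 + (N2 + N)) \<le> work_const n * (m + card E) \<and> (\<exists>tr A. graph_ef1 n m v E tr A \<and> outputs n m s' tr A)) s2"
      proof (rule wp_SeqI[OF wp_frame[OF oi.phases_loop_correct[OF inv]]], elim conjE exE)
        fix N3 and s3 :: store and rd \<sigma> B tr
        assume N3: "N3 \<le> oi.phase_pot 0" and rep3: "represents rd (\<sigma>, B) s3"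
          and run: "phases n m v E 0 {1..m} (id, \<lambda>_. {}) tr (\<sigma>, B)"
          and out3: "out s3 = concat (map (log_round n) tr)" and m3': "itab s3 ''m'' [] = int m"
          and fr3: "framed (While (ILess (V ''sc'') (V ''m'')) (phase_body n)) s2 s3"
        have "''owner'' \<notin> iwrites (phase_body n)"
          using subsetD[OF writes_inner_loop[of n], of "''owner''"]
          by (auto simp: phase_body_def take_prog_def take_body_def grid_prog_def epoch_body_def filter_body_def)
        then have "itab s3 ''owner'' = itab s2 ''owner''" using fr3 by (simp add: framed_def)
        then have own3: "itab s3 ''owner'' [g] = 0" for g using own2 by simp
        have ok3: "owners_ok \<sigma> s3" "bundles_ok B s3" using rep3 by (simp_all add: represents_def)
        show "wp W (owner_prog n) (\<lambda>N s'. Suc (N1 + (N2 + (N3 + N))) \<le> work_const n * (m + card E) \<and>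
          (\<exists>tr A. graph_ef1 n m v E tr A \<and> outputs n m s' tr A)) s3"
        proof (rule wp_mono[OF wp_owner[OF ok3(1) m3' own3]], elim conjE)
          fix N4 and s4 :: store
          assume own4: "\<forall>g\<in>{1..m}. \<forall>j\<in>{1..n}. itab s4 ''owner'' [int g] = int j \<longleftrightarrow> itab s3 ''bun'' [int g] = int (\<sigma> j)"
            and out4: "out s4 = out s3" and N4: "N4 \<le> m"
          have "B (\<sigma> j) = {g \<in> {1..m}. itab s4 ''owner'' [int g] = int j}" if "j \<in> {1..n}" for j
          proof -
            have "\<sigma> j \<in> {1..n}" using ok3(1) that permutes_in_image[of \<sigma>] unfolding owners_ok_def by blast
            then have "B (\<sigma> j) = {g \<in> {1..m}. itab s3 ''bun'' [int g] = int (\<sigma> j)}"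
              using ok3(2) unfolding bundles_ok_def by blast
            then show ?thesis using own4 that by blast
          qed
          then have "outputs n m s4 tr (B \<circ> \<sigma>)" using out4 out3 by (simp add: outputs_def)
          moreover have "graph_ef1 n m v E tr (B \<circ> \<sigma>)" using run unfolding graph_ef1_def by blast
          moreover have "Suc (N1 + (N2 + (N3 + N4))) \<le> work_const n * (m + card E)"
          proof -
            have "Suc (N1 + (N2 + (N3 + N4))) \<le> (epoch_const n + 3) * m + 2 * (n + 1) * card E + 9 * m + 10 * card E + 3"
              using N1 N2 N3 N4 oi.phase_pot_0 by linarith
            also have "\<dots> \<le> (epoch_const n + 13) * m + (2 * n + 12) * card E"
              using m3 by (simp add: algebra_simps)
            also have "\<dots> \<le> work_const n * m + work_const n * card E"
              by (intro add_mono mult_le_mono1) (simp_all add: work_const_def)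
            finally show ?thesis by (simp add: distrib_left)
          qed
          ultimately show "Suc (N1 + (N2 + (N3 + N4))) \<le> work_const n * (m + card E) \<and>
            (\<exists>tr A. graph_ef1 n m v E tr A \<and> outputs n m s4 tr A)" by blast
        qed
      qed
    qed
  qed
qed

end

theorem theorem15:
  fixes n :: nat
  assumes "n \<ge> 3"
  shows "\<exists>(p :: com) (K :: nat) (C :: real).
    implements_within n p K (\<lambda>m e. C * (real m + real e))"
proof (intro exI)
  let ?p = "graph_prog n" and ?C = "real (straight_cost (graph_prog n) * work_const n)"
  show "implements_within n ?p 2 (\<lambda>m e. ?C * (real m + real e))"
    unfolding implements_within_def
  proof (intro allI impI, elim conjE)
    fix m v E es
    assume *: "additive_valuations n m v" "n dvd m" "simple_graph m E" "1 \<le> card E" "edge_list es E"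
    have "E \<noteq> {}" using *(4) by auto
    then have "0 < m" using *(3) by (auto simp: simple_graph_def)
    then have "n \<le> m" using *(2) by (rule dvd_imp_le[rotated])
    \<comment> \<open>From m \<ge> n \<ge> 3 and |E| \<ge> 1, squaring m + |E| gains the factor 4
      required of the word bound; hence the exponent 2.\<close>
    then have "4 \<le> m + card E" using assms *(4) by linarith
    then have "4 * (m + card E) \<le> (m + card E)\<^sup>2" unfolding power2_eq_square by (rule mult_le_mono1)
    then interpret instance_data n m v E es "(m + card E)\<^sup>2"
      using assms * by unfold_locales
    obtain T s' N tr A where run: "exec ((m + card E)\<^sup>2) ?p (input n m v es) T s'"
      "T \<le> straight_cost ?p * Suc N" "Suc N \<le> work_const n * (m + card E)"
      "graph_ef1 n m v E tr A" "outputs n m s' tr A"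
      using graph_prog_correct unfolding wp_def by blast
    have "T \<le> straight_cost ?p * (work_const n * (m + card E))"
      using run(2,3) by (meson le_trans mult_le_mono2)
    then have "real T \<le> real (straight_cost ?p * (work_const n * (m + card E)))" by (simp only: of_nat_le_iff)
    then have "real T \<le> ?C * (real m + real (card E))" by (simp add: mult.assoc)
    then show "\<exists>T s' tr A. exec ((m + card E)\<^sup>2) ?p (input n m v es) T s' \<and>
      graph_ef1 n m v E tr A \<and> outputs n m s' tr A \<and> real T \<le> ?C * (real m + real (card E))"
      using run(1,4,5) by blast
  qed
qed

end
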